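(* Let $\psi:\mathfrak n^+\to\mathbb C$ be a Lie algebra homomorphism such that $\psi(d_1)\neq0$ and $\psi(d_2)\neq 0$, and let $S$ be a simple Whittaker module of type $\psi$ for $\mathcal V$. Then $S\cong L_{\psi,\xi}$ (as $\mathcal V$-modules) for some $\xi\in\mathbb C$.
   Context: The Virasoro algebra is the complex Lie algebra $\mathcal V$ with basis $\{z\}\cup\{d_k : k\in\mathbb Z\}$ and bracket $[d_k,d_j]=(j-k)d_{k+j}+\delta_{j,-k}\frac{k^3-k}{12}z$, $[z,d_k]=0$. Let $\mathfrak n^+=\mathrm{span}_{\mathbb C}\{d_1,d_2,\dots\}$. For a $\mathcal V$-module $V$, a vector $w\in V$ is a Whittaker vector (of type $\psi$) if $xw=\psi(x)w$ for all $x\in\mathfrak n^+$; $V$ is a Whittaker module of type $\psi$ if it is generated as a $\mathcal V$-module by a Whittaker vector of type $\psi$ (a cyclic Whittaker vector). Let $\mathbb C_\psi$ be the one-dimensional $\mathfrak n^+$-module on which $x$ acts by $\psi(x)$, let $M_\psi=U(\mathcal V)\otimes_{U(\mathfrak n^+)}\mathbb C_\psi$, and for $\xi\in\mathbb C$ set $L_{\psi,\xi}=M_\psi/(z-\xi)M_\psi$. *)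

theory Defs
  imports "HOL-Algebra.Algebra" "HOL-Algebra.Algebraic_Closure_Type" "HOL-Library.Poly_Mapping"
begin

section \<open>The Virasoro algebra\<close>

text \<open>
  For a set \<open>B\<close> of formal symbols, the type \<open>B \<Rightarrow>\<^sub>0 complex\<close> of finitely supported functions is the
  complex vector space with basis \<open>B\<close>; the basis vector belonging to \<open>b\<close> is
  \<open>Poly_Mapping.single b 1\<close>.
\<close>

definition cscale :: "complex \<Rightarrow> ('b \<Rightarrow>\<^sub>0 complex) \<Rightarrow> ('b \<Rightarrow>\<^sub>0 complex)"
  where "cscale c p = Poly_Mapping.map ((*) c) p"

datatype vir_basis = Z_sym | D_sym int

type_synonym vir = "vir_basis \<Rightarrow>\<^sub>0 complex"

definition vz :: vir
  where "vz = Poly_Mapping.single Z_sym 1"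

definition vd :: "int \<Rightarrow> vir"
  where "vd k = Poly_Mapping.single (D_sym k) 1"

fun basis_bracket :: "vir_basis \<Rightarrow> vir_basis \<Rightarrow> vir" where
  "basis_bracket (D_sym k) (D_sym j) =
     cscale (of_int (j - k)) (vd (k + j)) +
     (if j = - k then cscale ((of_int k ^ 3 - of_int k) / 12) vz else 0)"
| "basis_bracket _ _ = 0"

definition vbracket :: "vir \<Rightarrow> vir \<Rightarrow> vir"
  where "vbracket x y =
    (\<Sum>a\<in>Poly_Mapping.keys x. \<Sum>b\<in>Poly_Mapping.keys y.
       cscale (Poly_Mapping.lookup x a * Poly_Mapping.lookup y b) (basis_bracket a b))"

definition nplus :: "vir set"
  where "nplus = module.span cscale (vd ` {1..})"

text \<open>
  A Lie algebra homomorphism from a Lie subalgebra \<open>h\<close> to the one-dimensional (hence abelian)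
  Lie algebra of complex numbers. Values outside \<open>h\<close> are irrelevant, here and below.
\<close>

definition lie_hom_to_complex :: "vir set \<Rightarrow> (vir \<Rightarrow> complex) \<Rightarrow> bool"
  where "lie_hom_to_complex h \<psi> \<longleftrightarrow>
    (\<forall>x\<in>h. \<forall>y\<in>h. \<psi> (x + y) = \<psi> x + \<psi> y) \<and>
    (\<forall>c. \<forall>x\<in>h. \<psi> (cscale c x) = c * \<psi> x) \<and>
    (\<forall>x\<in>h. \<forall>y\<in>h. \<psi> (vbracket x y) = \<psi> x * \<psi> y - \<psi> y * \<psi> x)"


section \<open>Modules over Lie subalgebras\<close>

abbreviation complex_field :: "complex ring"
  where "complex_field \<equiv> ring_of_type_algebra"

text \<open>
  As for the library's record of modules, the fields \<open>mult\<close> and \<open>one\<close> inherited from rings play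
  no role.
\<close>

record 'm lie_module = "(complex, 'm) module" +
  act :: "vir \<Rightarrow> 'm \<Rightarrow> 'm"

locale lie_module = module complex_field M for h :: "vir set" and M :: "'m lie_module" (structure) +
  assumes act_closed: "x \<in> h \<Longrightarrow> m \<in> carrier M \<Longrightarrow> act M x m \<in> carrier M"
    and act_add: "x \<in> h \<Longrightarrow> m \<in> carrier M \<Longrightarrow> m' \<in> carrier M \<Longrightarrow>
      act M x (m \<oplus> m') = act M x m \<oplus> act M x m'"
    and act_smult: "x \<in> h \<Longrightarrow> m \<in> carrier M \<Longrightarrow> act M x (c \<odot>\<^bsub>M\<^esub> m) = c \<odot>\<^bsub>M\<^esub> act M x m"
    and add_act: "x \<in> h \<Longrightarrow> y \<in> h \<Longrightarrow> m \<in> carrier M \<Longrightarrow>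
      act M (x + y) m = act M x m \<oplus> act M y m"
    and cscale_act: "x \<in> h \<Longrightarrow> m \<in> carrier M \<Longrightarrow> act M (cscale c x) m = c \<odot>\<^bsub>M\<^esub> act M x m"
    and bracket_act: "x \<in> h \<Longrightarrow> y \<in> h \<Longrightarrow> m \<in> carrier M \<Longrightarrow>
      act M (vbracket x y) m = act M x (act M y m) \<ominus> act M y (act M x m)"

definition lie_submodule :: "vir set \<Rightarrow> 'm lie_module \<Rightarrow> 'm set \<Rightarrow> bool"
  where "lie_submodule h M N \<longleftrightarrow>
    submodule N complex_field M \<and> (\<forall>x\<in>h. \<forall>m\<in>N. act M x m \<in> N)"

definition generated_submodule :: "vir set \<Rightarrow> 'm lie_module \<Rightarrow> 'm set \<Rightarrow> 'm set"
  where "generated_submodule h M A = \<Inter>{N. lie_submodule h M N \<and> A \<subseteq> N}"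

definition simple_lie_module :: "vir set \<Rightarrow> 'm lie_module \<Rightarrow> bool"
  where "simple_lie_module h M \<longleftrightarrow>
    lie_module h M \<and> carrier M \<noteq> {\<zero>\<^bsub>M\<^esub>} \<and>
    (\<forall>N. lie_submodule h M N \<longrightarrow> N = {\<zero>\<^bsub>M\<^esub>} \<or> N = carrier M)"

definition lie_module_iso :: "vir set \<Rightarrow> 'm lie_module \<Rightarrow> 'n lie_module \<Rightarrow> ('m \<Rightarrow> 'n) set"
  where "lie_module_iso h M N =
    {f. bij_betw f (carrier M) (carrier N) \<and>
        (\<forall>m\<in>carrier M. \<forall>m'\<in>carrier M. f (m \<oplus>\<^bsub>M\<^esub> m') = f m \<oplus>\<^bsub>N\<^esub> f m') \<and>
        (\<forall>c. \<forall>m\<in>carrier M. f (c \<odot>\<^bsub>M\<^esub> m) = c \<odot>\<^bsub>N\<^esub> f m) \<and>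
        (\<forall>x\<in>h. \<forall>m\<in>carrier M. f (act M x m) = act N x (f m))}"

definition isomorphic_modules :: "vir set \<Rightarrow> 'm lie_module \<Rightarrow> 'n lie_module \<Rightarrow> bool"
  where "isomorphic_modules h M N \<longleftrightarrow> lie_module_iso h M N \<noteq> {}"

text \<open>
  The quotient by a linear subspace \<open>N\<close> that is stable under \<open>act M\<close>, with operations on cosets
  in the style of the library's \<open>rcoset_mult\<close>: for such \<open>N\<close>, each of the unions below ranges
  over equal cosets.
\<close>

definition quotient_module :: "'m lie_module \<Rightarrow> 'm set \<Rightarrow> 'm set lie_module"
  where "quotient_module M N =
    \<lparr>carrier = a_rcosets\<^bsub>M\<^esub> N, monoid.mult = undefined, one = undefined,
     ring.zero = N, add = set_add M,
     module.smult = (\<lambda>c A. \<Union>m\<in>A. N +>\<^bsub>M\<^esub> (c \<odot>\<^bsub>M\<^esub> m)),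
     act = (\<lambda>x A. \<Union>m\<in>A. N +>\<^bsub>M\<^esub> act M x m)\<rparr>"


section \<open>Universal enveloping algebras\<close>

instantiation list :: (type) monoid_add
begin
definition zero_list :: "'a list" where "zero_list = []"
definition plus_list :: "'a list \<Rightarrow> 'a list \<Rightarrow> 'a list" where "plus_list = (@)"
instance by standard (simp_all add: zero_list_def plus_list_def)
end

text \<open>
  With concatenation as addition of exponents, the convolution product of
  \<open>Poly_Mapping\<close> on \<open>'a list \<Rightarrow>\<^sub>0 complex\<close> is the product of noncommutative polynomials,
  so \<open>free_algebra h\<close> is the free unital associative algebra on the set \<open>h\<close>.
  The enveloping algebra \<open>uea h\<close> of a Lie subalgebra \<open>h\<close> is its quotient by the two-sided ideal
  which makes \<open>h \<rightarrow> uea h\<close> linear and turns the Lie bracket into the commutator. (The linearity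
  relations alone give the tensor algebra of \<open>h\<close>.)
\<close>

definition free_algebra :: "vir set \<Rightarrow> (vir list \<Rightarrow>\<^sub>0 complex) ring"
  where "free_algebra h =
    \<lparr>carrier = {p. Poly_Mapping.keys p \<subseteq> lists h},
     monoid.mult = (*), one = 1, ring.zero = 0, add = (+)\<rparr>"

definition letter :: "vir \<Rightarrow> (vir list \<Rightarrow>\<^sub>0 complex)"
  where "letter x = Poly_Mapping.single [x] 1"

definition uea_relations :: "vir set \<Rightarrow> (vir list \<Rightarrow>\<^sub>0 complex) set"
  where "uea_relations h =
    {letter (x + y) - letter x - letter y |x y. x \<in> h \<and> y \<in> h} \<union>
    {letter (cscale c x) - cscale c (letter x) |c x. x \<in> h} \<union>
    {letter x * letter y - letter y * letter x - letter (vbracket x y) |x y. x \<in> h \<and> y \<in> h}"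

definition uea_ideal :: "vir set \<Rightarrow> (vir list \<Rightarrow>\<^sub>0 complex) set"
  where "uea_ideal h = Idl\<^bsub>free_algebra h\<^esub> (uea_relations h)"

type_synonym uea_elem = "(vir list \<Rightarrow>\<^sub>0 complex) set"

definition uea :: "vir set \<Rightarrow> uea_elem ring"
  where "uea h = free_algebra h Quot uea_ideal h"

definition uea_of :: "vir set \<Rightarrow> (vir list \<Rightarrow>\<^sub>0 complex) \<Rightarrow> uea_elem"
  where "uea_of h p = uea_ideal h +>\<^bsub>free_algebra h\<^esub> p"

definition uea_smult :: "vir set \<Rightarrow> complex \<Rightarrow> uea_elem \<Rightarrow> uea_elem"
  where "uea_smult h c u = uea_of h (cscale c 1) \<otimes>\<^bsub>uea h\<^esub> u"

text \<open>
  The algebra homomorphism from \<open>uea h\<close> to the enveloping algebra of the whole Virasoro algebra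
  induced by the inclusion of \<open>h\<close>; the union ranges over equal cosets.
\<close>

definition uea_incl :: "uea_elem \<Rightarrow> uea_elem"
  where "uea_incl r = (\<Union>p\<in>r. uea_of UNIV p)"

text \<open>
  The action of \<open>uea h\<close> on an \<open>h\<close>-module: a word \<open>x\<^sub>1 \<dots> x\<^sub>n\<close> acts by successive application of
  \<open>x\<^sub>n, \<dots>, x\<^sub>1\<close>, and a coset acts by the common action of all its representatives.
\<close>

definition free_act :: "'n lie_module \<Rightarrow> (vir list \<Rightarrow>\<^sub>0 complex) \<Rightarrow> 'n \<Rightarrow> 'n"
  where "free_act N p v =
    (\<Oplus>\<^bsub>N\<^esub>ws\<in>Poly_Mapping.keys p. Poly_Mapping.lookup p ws \<odot>\<^bsub>N\<^esub> foldr (act N) ws v)"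

definition uea_act :: "'n lie_module \<Rightarrow> uea_elem \<Rightarrow> 'n \<Rightarrow> 'n"
  where "uea_act N r v = the_elem ((\<lambda>p. free_act N p v) ` r)"


section \<open>Induced modules\<close>

text \<open>
  For an \<open>h\<close>-module \<open>N\<close> we construct the tensor product of \<open>uea UNIV\<close> and \<open>N\<close> over \<open>uea h\<close> as the
  free vector space on pairs \<open>(u, v)\<close> modulo the bilinearity and balancing relations.
\<close>

definition pure_tensor :: "uea_elem \<Rightarrow> 'n \<Rightarrow> (uea_elem \<times> 'n \<Rightarrow>\<^sub>0 complex)"
  where "pure_tensor u v = Poly_Mapping.single (u, v) 1"

text \<open>
  The action of \<open>x\<close> on the left factor sends \<open>(u, v)\<close> to \<open>(x u, v)\<close>. Before passing to the quotient
  this is not yet a Lie algebra action, so the following record is not a Lie module.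
\<close>

definition free_tensor :: "'n lie_module \<Rightarrow> (uea_elem \<times> 'n \<Rightarrow>\<^sub>0 complex) lie_module"
  where "free_tensor N =
    \<lparr>carrier = {t. Poly_Mapping.keys t \<subseteq> carrier (uea UNIV) \<times> carrier N},
     monoid.mult = undefined, one = undefined, ring.zero = 0, add = (+),
     module.smult = cscale,
     act = (\<lambda>x t. \<Sum>(u, v)\<in>Poly_Mapping.keys t.
       cscale (Poly_Mapping.lookup t (u, v))
         (pure_tensor (uea_of UNIV (letter x) \<otimes>\<^bsub>uea UNIV\<^esub> u) v))\<rparr>"

definition tensor_relations :: "vir set \<Rightarrow> 'n lie_module \<Rightarrow> (uea_elem \<times> 'n \<Rightarrow>\<^sub>0 complex) set"
  where "tensor_relations h N =
    {pure_tensor (u \<oplus>\<^bsub>uea UNIV\<^esub> u') v - pure_tensor u v - pure_tensor u' v |u u' v.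
       u \<in> carrier (uea UNIV) \<and> u' \<in> carrier (uea UNIV) \<and> v \<in> carrier N} \<union>
    {pure_tensor u (v \<oplus>\<^bsub>N\<^esub> v') - pure_tensor u v - pure_tensor u v' |u v v'.
       u \<in> carrier (uea UNIV) \<and> v \<in> carrier N \<and> v' \<in> carrier N} \<union>
    {pure_tensor (uea_smult UNIV c u) v - cscale c (pure_tensor u v) |c u v.
       u \<in> carrier (uea UNIV) \<and> v \<in> carrier N} \<union>
    {pure_tensor u (c \<odot>\<^bsub>N\<^esub> v) - cscale c (pure_tensor u v) |c u v.
       u \<in> carrier (uea UNIV) \<and> v \<in> carrier N} \<union>
    {pure_tensor (u \<otimes>\<^bsub>uea UNIV\<^esub> uea_incl r) v - pure_tensor u (uea_act N r v) |u r v.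
       u \<in> carrier (uea UNIV) \<and> r \<in> carrier (uea h) \<and> v \<in> carrier N}"

definition induced_module ::
    "vir set \<Rightarrow> 'n lie_module \<Rightarrow> (uea_elem \<times> 'n \<Rightarrow>\<^sub>0 complex) set lie_module"
  where "induced_module h N =
    quotient_module (free_tensor N) (module.span cscale (tensor_relations h N))"


section \<open>Whittaker modules\<close>

definition whittaker_vector :: "(vir \<Rightarrow> complex) \<Rightarrow> 'm lie_module \<Rightarrow> 'm \<Rightarrow> bool"
  where "whittaker_vector \<psi> M w \<longleftrightarrow>
    w \<in> carrier M \<and> (\<forall>x\<in>nplus. act M x w = \<psi> x \<odot>\<^bsub>M\<^esub> w)"

definition whittaker_module :: "(vir \<Rightarrow> complex) \<Rightarrow> 'm lie_module \<Rightarrow> bool"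
  where "whittaker_module \<psi> M \<longleftrightarrow>
    lie_module UNIV M \<and>
    (\<exists>w. whittaker_vector \<psi> M w \<and> generated_submodule UNIV M {w} = carrier M)"

definition C_psi :: "(vir \<Rightarrow> complex) \<Rightarrow> complex lie_module"
  where "C_psi \<psi> =
    \<lparr>carrier = UNIV, monoid.mult = undefined, one = undefined, ring.zero = 0, add = (+),
     module.smult = (*), act = (\<lambda>x c. \<psi> x * c)\<rparr>"

type_synonym M_elem = "(uea_elem \<times> complex \<Rightarrow>\<^sub>0 complex) set"

definition M_psi :: "(vir \<Rightarrow> complex) \<Rightarrow> M_elem lie_module"
  where "M_psi \<psi> = induced_module nplus (C_psi \<psi>)"

definition L_psi_xi :: "(vir \<Rightarrow> complex) \<Rightarrow> complex \<Rightarrow> M_elem set lie_module"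
  where "L_psi_xi \<psi> \<xi> =
    quotient_module (M_psi \<psi>)
      {act (M_psi \<psi>) vz m \<ominus>\<^bsub>M_psi \<psi>\<^esub> (\<xi> \<odot>\<^bsub>M_psi \<psi>\<^esub> m) |m. m \<in> carrier (M_psi \<psi>)}"

end

theory Submission
  imports Defs "HOL-Computational_Algebra.Fundamental_Theorem_Algebra"
begin

text \<open>
  Let \<open>w\<close> be a cyclic Whittaker vector of a simple module \<open>S\<close>, and write \<open>d_k\<close> for the action of
  \<open>vd k\<close> and \<open>z\<close> for that of \<open>vz\<close>. Everything rests on one fact about the elements
  \<open>d_(-k1) ... d_(-kn) u\<close> with \<open>0 \<le> k1 \<le> ... \<le> kn\<close> and \<open>u\<close> a Whittaker vector of an arbitrary
  module: a finite sum of such elements with distinct exponent lists vanishes only if all the vectors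
  \<open>u\<close> in it vanish (\<open>sorted_words_independent\<close>). Give the factor \<open>d_(-k)\<close> the weight \<open>k + 1\<close>. Then
  \<open>d_m - \<psi>(d_m)\<close> with \<open>m \<ge> 2\<close> lowers the weight by at least \<open>m - 1\<close>, and the only contribution which lowers it by
  exactly \<open>m - 1\<close> replaces one factor \<open>d_(-(m-2))\<close> by a multiple of \<open>\<psi>(d_2)\<close>, because
  \<open>[d_m, d_(-(m-2))]\<close> is a multiple of \<open>d_2\<close>. So modulo lower weight \<open>d_m - \<psi>(d_m)\<close> acts as a nonzero multiple
  of the partial derivative by the variable \<open>d_(-(m-2))\<close>, and a nonconstant polynomial has a nonzero
  partial derivative. An induction on the weight strips off all factors.

  Two consequences give the theorem. First, \<open>z\<close> acts on \<open>S\<close> by a scalar (\<open>central_character\<close>). The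
  image of \<open>z\<close> is a submodule; if it is zero there is nothing to show, and otherwise
  \<open>w = z v\<close> for some \<open>v\<close>. Writing \<open>v\<close> as a sum of ordered words in \<open>d_(-k)\<close> applied to vectors
  \<open>p(z) w\<close> and comparing the terms of the empty word gives \<open>w = z p(z) w\<close> for some polynomial \<open>p\<close>. So a
  nonzero polynomial in \<open>z\<close> kills \<open>w\<close>, hence \<open>z\<close> has an eigenvector, and its eigenspace is a nonzero
  submodule.

  Secondly, let \<open>\<xi>\<close> be this scalar. The universal property of the induced module gives a homomorphism
  from \<open>L\<close> (the quotient of the induced module by \<open>z - \<xi>\<close>) onto \<open>S\<close>, which sends the generator to \<open>w\<close>
  (\<open>L_psi_xi_universal\<close>). Every element of \<open>L\<close> is a complex
  combination of ordered words applied to the generator, since every product of \<open>d_k\<close> can be reordered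
  (\<open>all_sorted_form\<close>); the corresponding words in \<open>S\<close> are linearly independent, so the homomorphism is injective.

  A module generated by one vector is the quotient of the free algebra on the
  Virasoro algebra by the annihilator of the generator. All computations with words take place in this free algebra,
  modulo an annihilator.
\<close>

section \<open>Polynomials in a linear operator\<close>

text \<open>The value \<open>p(f) v\<close> of the polynomial \<open>p\<close> at the linear operator \<open>f\<close>, by Horner's scheme.\<close>
definition poly_op :: "(complex \<Rightarrow> 'v \<Rightarrow> 'v) \<Rightarrow> ('v \<Rightarrow> 'v) \<Rightarrow> complex poly \<Rightarrow> 'v \<Rightarrow> 'v::ab_group_add"
  where "poly_op scale f p v = fold_coeffs (\<lambda>a r. scale a v + f r) p 0"

lemma poly_op_0 [simp]: "poly_op scale f 0 v = 0"
  by (simp add: poly_op_def)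

context
  fixes scale :: "complex \<Rightarrow> 'v::ab_group_add \<Rightarrow> 'v" and f :: "'v \<Rightarrow> 'v"
  assumes scale: "vector_space scale" and f: "module_hom scale scale f"
begin

interpretation vector_space scale by (fact scale)

lemma poly_op_pCons: "poly_op scale f (pCons a p) v = scale a v + f (poly_op scale f p v)"
  using module_hom.zero[OF f] by (cases "a = 0 \<and> p = 0") (auto simp: poly_op_def)

lemma poly_op_add: "poly_op scale f (p + q) v = poly_op scale f p v + poly_op scale f q v"
  by (induction p q rule: poly_induct2)
    (simp_all add: poly_op_pCons module_hom.add[OF f] scale_left_distrib algebra_simps)

lemma poly_op_smult: "poly_op scale f (smult c p) v = scale c (poly_op scale f p v)"
  by (induction p) (simp_all add: poly_op_pCons module_hom.scale[OF f] scale_right_distrib)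

end

text \<open>
  If \<open>q(f)\<close> kills \<open>w\<close> modulo \<open>I\<close>, split off a root: \<open>q = (X - \<xi>) r\<close>. Either \<open>r(f) w\<close> is an eigenvector
  modulo \<open>I\<close>, or \<open>r\<close> kills \<open>w\<close> as well and has smaller degree.
\<close>
lemma eigenvector_of_annihilating_poly:
  fixes scale :: "complex \<Rightarrow> 'v::ab_group_add \<Rightarrow> 'v"
  assumes "vector_space scale" "module_hom scale scale f" "module.subspace scale I"
    and "w \<notin> I" "q \<noteq> 0" "poly_op scale f q w \<in> I"
  shows "\<exists>\<xi> v. v \<notin> I \<and> f v - scale \<xi> v \<in> I"
proof -
  interpret vector_space scale by fact
  note poly_op = poly_op_pCons[OF assms(1,2)] poly_op_add[OF assms(1,2)] poly_op_smult[OF assms(1,2)]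
  show ?thesis
    using assms(5,6)
  proof (induction "degree q" arbitrary: q rule: less_induct)
    case less
    have "\<not> constant (poly q)"
    proof
      assume "constant (poly q)"
      then obtain a where "q = [:a:]" using constant_degree degree_eq_zeroE by metis
      with less.prems have "a \<noteq> 0" "scale a w \<in> I"
        using module_hom.zero[OF assms(2)] by (auto simp: poly_op)
      then have "w \<in> I" using subspace_scale[OF assms(3), of "scale a w" "inverse a"] by simp
      with assms(4) show False by simp
    qed
    then obtain \<xi> where "poly q \<xi> = 0" using fundamental_theorem_of_algebra by blast
    then obtain r where q: "q = [:- \<xi>, 1:] * r" by (auto simp: poly_eq_0_iff_dvd)
    have "poly_op scale f q w = f (poly_op scale f r w) - scale \<xi> (poly_op scale f r w)"
    proof -
      have "q = pCons 0 r + smult (- \<xi>) r" by (simp add: q)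
      then show ?thesis by (simp only: poly_op) simp
    qed
    moreover have "degree r < degree q" "r \<noteq> 0"
      using less.prems(1) by (auto simp: q degree_mult_eq simp del: mult_pCons_left)
    ultimately show ?case
      using less.hyps[of r] less.prems(2) by (cases "poly_op scale f r w \<in> I") auto
  qed
qed

section \<open>Ordered words applied to Whittaker vectors\<close>

text \<open>
  A Virasoro module presented as a quotient: \<open>D k\<close> and \<open>Z\<close> are linear operators on a vector space
  which preserve the subspace \<open>I\<close> and satisfy the Virasoro relations modulo \<open>I\<close>. Working modulo \<open>I\<close> keeps the
  whole computation on a type. The space \<open>U\<close> consists of
  vectors whose classes are Whittaker vectors. It is a parameter because the decomposition into ordered
  words is needed both for the span of all \<open>p(z) w\<close> and for the scalar multiples of \<open>w\<close>.
\<close>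
locale whittaker_space = vector_space scale
  for scale :: "complex \<Rightarrow> 'v::ab_group_add \<Rightarrow> 'v" (infixr "*s" 75) +
  fixes D :: "int \<Rightarrow> 'v \<Rightarrow> 'v" and Z :: "'v \<Rightarrow> 'v" and \<psi> :: "nat \<Rightarrow> complex" and I U :: "'v set"
  assumes D_linear: "module_hom scale scale (D k)"
    and Z_linear: "module_hom scale scale Z"
    and I_subspace: "subspace I" and U_subspace: "subspace U" and I_sub_U: "I \<subseteq> U"
    and D_I: "v \<in> I \<Longrightarrow> D k v \<in> I" and Z_I: "v \<in> I \<Longrightarrow> Z v \<in> I" and Z_U: "v \<in> U \<Longrightarrow> Z v \<in> U"
    and D_bracket: "D k (D j v) - D j (D k v) - (of_int (j - k) *s D (k + j) v +
          (if j = - k then ((of_int k ^ 3 - of_int k) / 12) *s Z v else 0)) \<in> I"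
    and Z_central: "Z (D k v) - D k (Z v) \<in> I"
    and whittaker: "u \<in> U \<Longrightarrow> 1 \<le> m \<Longrightarrow> D (int m) u - \<psi> m *s u \<in> I"
    and psi_high: "3 \<le> m \<Longrightarrow> \<psi> m = 0" and psi_2: "\<psi> 2 \<noteq> 0"
begin

lemmas D_add = module_hom.add[OF D_linear] and D_scale = module_hom.scale[OF D_linear]
  and D_diff = module_hom.diff[OF D_linear] and D_sum = module_hom.sum[OF D_linear]
  and D_zero = module_hom.zero[OF D_linear]
  and Z_add = module_hom.add[OF Z_linear] and Z_scale = module_hom.scale[OF Z_linear]
  and Z_zero = module_hom.zero[OF Z_linear]
  and Z_diff = module_hom.diff[OF Z_linear] and Z_sum = module_hom.sum[OF Z_linear]

lemma subspace_unscale: "subspace V \<Longrightarrow> a \<noteq> 0 \<Longrightarrow> a *s v \<in> V \<Longrightarrow> v \<in> V"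
  using subspace_scale[of V "a *s v" "inverse a"] by simp

definition word :: "nat list \<Rightarrow> 'v \<Rightarrow> 'v"
  where "word ks u = foldr (\<lambda>k. D (- int k)) ks u"

text \<open>
  The factor \<open>d_(-k)\<close> has weight \<open>k + 1\<close>. With the natural weight \<open>k\<close> the element \<open>d_0\<close> would not be
  seen; with the additional \<open>1\<close> every commutator of two factors has smaller weight than their product.
\<close>
definition wt :: "nat list \<Rightarrow> nat"
  where "wt ks = sum_list (map Suc ks)"

text \<open>
  The weight filtration. The bound is an integer, so that subtracting from it does not truncate:
  below \<open>0\<close> the filtration is \<open>I\<close>, that is, zero in the quotient.
\<close>
definition P :: "int \<Rightarrow> 'v set"
  where "P n = span (I \<union> {word ks u |ks u. u \<in> U \<and> int (wt ks) \<le> n})"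

text \<open>The operator \<open>d_m - \<psi>(d_m)\<close>, which kills the Whittaker vectors.\<close>
definition E :: "nat \<Rightarrow> 'v \<Rightarrow> 'v"
  where "E m v = D (int m) v - \<psi> m *s v"

lemma word_simps [simp]: "word [] u = u" "word (k # ks) u = D (- int k) (word ks u)"
  by (simp_all add: word_def)

lemma wt_simps [simp]: "wt [] = 0" "wt (k # ks) = Suc (k + wt ks)"
  by (simp_all add: wt_def)

lemma word_add: "word ks (u + v) = word ks u + word ks v"
  by (induction ks) (simp_all add: D_add)

lemma word_zero: "word ks 0 = 0"
  by (induction ks) (simp_all add: D_zero)

lemma word_scale: "word ks (c *s u) = c *s word ks u"
  by (induction ks) (simp_all add: D_scale)

lemma word_I: "u \<in> I \<Longrightarrow> word ks u \<in> I"
  by (induction ks) (simp_all add: D_I)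

lemma subspace_P: "subspace (P n)"
  unfolding P_def by (rule subspace_span)

lemmas P_add = subspace_add[OF subspace_P] and P_scale = subspace_scale[OF subspace_P]
  and P_diff = subspace_diff[OF subspace_P] and P_sum = subspace_sum[OF subspace_P]
  and P_0 = subspace_0[OF subspace_P]

lemma I_sub_P: "v \<in> I \<Longrightarrow> v \<in> P n"
  unfolding P_def by (rule span_base) simp

lemma word_in_P: "u \<in> U \<Longrightarrow> int (wt ks) \<le> n \<Longrightarrow> word ks u \<in> P n"
  unfolding P_def by (rule span_base) blast

lemma P_mono: "v \<in> P m \<Longrightarrow> m \<le> n \<Longrightarrow> v \<in> P n"
  unfolding P_def by (erule subsetD[OF span_mono, rotated]) force

lemma P_neg_eq: assumes "n < 0" shows "P n = I"
proof -
  have "{word ks u |ks u. u \<in> U \<and> int (wt ks) \<le> n} = {}"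
    using assms by auto
  then have "P n = span I" by (simp only: P_def Un_empty_right)
  then show ?thesis using I_subspace by (simp add: span_eq_iff)
qed

lemma P_induct [consumes 1, case_names I word add scale]:
  assumes "v \<in> P n"
    and "\<And>v. v \<in> I \<Longrightarrow> Q v"
    and "\<And>ks u. u \<in> U \<Longrightarrow> int (wt ks) \<le> n \<Longrightarrow> Q (word ks u)"
    and "\<And>x y. Q x \<Longrightarrow> Q y \<Longrightarrow> Q (x + y)"
    and "\<And>c x. Q x \<Longrightarrow> Q (c *s x)"
  shows "Q v"
proof -
  have Q0: "Q 0" using assms(2) subspace_0[OF I_subspace] by blast
  have "v \<in> span (I \<union> {word ks u |ks u. u \<in> U \<and> int (wt ks) \<le> n})"
    using assms(1) by (simp add: P_def)
  then show ?thesis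
    by (induction rule: span_induct_alt) (use assms Q0 in auto)
qed

lemma D_lower_P: assumes "v \<in> P n" shows "D (- int k) v \<in> P (n + int k + 1)"
  using assms
proof (induction rule: P_induct)
  case (word ks u)
  then show ?case using word_in_P[of u "k # ks" "n + int k + 1"] by simp
qed (auto simp: D_add D_scale D_I intro: P_add P_scale I_sub_P)

lemma Z_word: "Z (word ks u) - word ks (Z u) \<in> I"
proof (induction ks)
  case Nil
  then show ?case using subspace_0[OF I_subspace] by simp
next
  case (Cons k ks)
  have "Z (word (k # ks) u) - word (k # ks) (Z u)
      = (Z (D (- int k) (word ks u)) - D (- int k) (Z (word ks u)))
        + D (- int k) (Z (word ks u) - word ks (Z u))"
    by (simp add: D_diff)
  then show ?case using Z_central D_I[OF Cons] subspace_add[OF I_subspace] by presburger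
qed

lemma Z_P: assumes "v \<in> P n" shows "Z v \<in> P n"
  using assms
proof (induction rule: P_induct)
  case (word ks u)
  have "word ks (Z u) \<in> P n" using word Z_U word_in_P by blast
  from P_add[OF I_sub_P[OF Z_word[of ks u]] this] show ?case by simp
qed (auto simp: Z_add Z_scale Z_I intro: P_add P_scale I_sub_P)

lemma E_linear: "E m (x + y) = E m x + E m y" "E m (c *s x) = c *s E m x"
  by (simp_all add: E_def D_add D_scale scale_right_distrib scale_right_diff_distrib mult.commute)

lemma E_sum: "E m (sum f A) = (\<Sum>a\<in>A. E m (f a))"
  by (simp add: E_def D_sum scale_sum_right sum_subtractf)

lemma E_I: "v \<in> I \<Longrightarrow> E m v \<in> I"
  by (simp add: E_def D_I I_subspace subspace_diff subspace_scale)

text \<open>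
  Commuting \<open>d_m\<close> past \<open>d_(-k)\<close> produces \<open>d_(m-k)\<close> and possibly \<open>z\<close>. If \<open>m \<le> k\<close> this is a factor of
  smaller weight; if \<open>m - k \<ge> 3\<close> it is \<open>d_(m-k) - \<psi>(d_(m-k))\<close>, to which the hypothesis on \<open>v\<close> applies.
  The scalar \<open>\<psi>(d_(m-k))\<close> remains for \<open>m - k = 1\<close>, where the term lies within the bound, and for
  \<open>m - k = 2\<close>, where it is the leading term: there the coefficient of the commutator is \<open>-(k + m) = -(2 k + 2)\<close>.
\<close>
lemma E_D_lower:
  assumes v: "v \<in> P n" and Ev: "\<And>j. 1 \<le> j \<Longrightarrow> E j v \<in> P (n - int j + 1)" and m: "1 \<le> m"
  shows "E m (D (- int k) v) - D (- int k) (E m v)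
      + (if k + 2 = m then (of_nat (2 * k + 2) * \<psi> 2) *s v else 0) \<in> P (n + int k + 1 - int m)"
    (is "?x + ?c \<in> P ?n")
proof -
  let ?z = "if - int k = - int m then ((of_int (int m) ^ 3 - of_int (int m)) / 12) *s Z v else 0"
  define y where "y = D (int m - int k) v"
  have "E m (D (- int k) v) - D (- int k) (E m v)
      = D (int m) (D (- int k) v) - D (- int k) (D (int m) v)"
    by (simp add: E_def D_diff D_scale)
  moreover have "D (int m) (D (- int k) v) - D (- int k) (D (int m) v)
      - (of_int (- int k - int m) *s y + ?z) \<in> P ?n"
    using I_sub_P[OF D_bracket[of "int m" "- int k" v]] by (simp add: y_def)
  ultimately have 1: "?x - (of_int (- int k - int m) *s y + ?z) \<in> P ?n"
    by simp
  have 2: "?z \<in> P ?n"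
  proof (cases "k = m")
    case True
    then have "Z v \<in> P ?n" by (intro P_mono[OF Z_P[OF v]]) simp
    then have "((of_int (int m) ^ 3 - of_int (int m)) / 12) *s Z v \<in> P ?n" by (rule P_scale)
    then show ?thesis using True by (simp only: if_True refl)
  qed (simp add: P_0)
  have 3: "of_int (- int k - int m) *s y + ?c \<in> P ?n"
  proof (cases "k < m")
    case False
    then have "y \<in> P ?n"
      using D_lower_P[OF v, of "k - m"] by (simp add: y_def of_nat_diff algebra_simps)
    with False show ?thesis by (auto intro: P_scale)
  next
    case True
    then have y: "y = E (m - k) v + \<psi> (m - k) *s v"
      by (simp add: y_def E_def of_nat_diff)
    have e: "E (m - k) v \<in> P ?n"
      using Ev[of "m - k"] True by (simp add: of_nat_diff algebra_simps)
    consider "m = k + 1" | "m = k + 2" | "3 \<le> m - k"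
      using True by linarith
    then show ?thesis
    proof cases
      case 1
      then have "y \<in> P ?n" unfolding y using e v by (auto intro: P_add P_scale)
      then show ?thesis using 1 by (auto intro: P_scale)
    next
      case 2
      have "of_int (- int k - int m) *s y + ?c = of_int (- int k - int m) *s E (m - k) v
          + (of_int (- int k - int m) * \<psi> 2 + of_nat (2 * k + 2) * \<psi> 2) *s v"
        unfolding y using 2 by (simp add: scale_right_distrib scale_left_distrib)
      also have "of_int (- int k - int m) * \<psi> 2 + of_nat (2 * k + 2) * \<psi> 2 = 0"
        using 2 by (simp add: algebra_simps)
      finally show ?thesis using e by (auto intro: P_scale)
    next
      case 3
      then have "y \<in> P ?n" unfolding y using e psi_high by simp
      then show ?thesis using 3 by (auto intro: P_scale)
    qed
  qed
  have "?x + ?c = (?x - (of_int (- int k - int m) *s y + ?z)) + ?z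
      + (of_int (- int k - int m) *s y + ?c)"
    by (simp only: algebra_simps)
  then show ?thesis
    using P_add[OF P_add[OF 1 2] 3] by simp
qed

text \<open>All terms of \<open>(d_m - \<psi>(d_m)) d_(-k1) ... d_(-kn) u\<close> lose at least the weight \<open>m - 1\<close>.\<close>
lemma E_word: assumes "u \<in> U" "1 \<le> m" shows "E m (word ks u) \<in> P (int (wt ks) - int m + 1)"
  using assms(2)
proof (induction ks arbitrary: m)
  case Nil
  then show ?case using whittaker[OF assms(1), of m] by (simp add: E_def I_sub_P)
next
  case (Cons k ks)
  let ?v = "word ks u" and ?n = "int (wt ks) + int k + 1 - int m"
  define c where "c = (if k + 2 = m then (of_nat (2 * k + 2) * \<psi> 2) *s ?v else 0)"
  have v: "?v \<in> P (int (wt ks))" using assms(1) by (simp add: word_in_P)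
  have "E m (D (- int k) ?v) - D (- int k) (E m ?v) + c \<in> P ?n"
    unfolding c_def using E_D_lower[OF v Cons.IH Cons.prems] .
  moreover have "D (- int k) (E m ?v) \<in> P (?n + 1)"
    using D_lower_P[OF Cons.IH[OF Cons.prems], of k] by (simp add: algebra_simps)
  moreover have "c \<in> P (?n + 1)"
    using P_mono[OF v] by (auto simp: c_def intro!: P_0 P_scale)
  ultimately have "(E m (D (- int k) ?v) - D (- int k) (E m ?v) + c) + D (- int k) (E m ?v) - c
      \<in> P (?n + 1)"
    using P_mono[of _ ?n "?n + 1"] by (meson P_add P_diff less_add_one less_imp_le)
  then have "E m (D (- int k) ?v) \<in> P (?n + 1)" by simp
  then show ?case by (simp add: algebra_simps)
qed

lemma E_P: assumes "v \<in> P n" "1 \<le> m" shows "E m v \<in> P (n - int m + 1)"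
  using assms(1)
proof (induction rule: P_induct)
  case (word ks u)
  with assms E_word[of u m ks] show ?case by (auto elim: P_mono)
qed (auto simp: E_linear E_I intro: P_add P_scale I_sub_P)

text \<open>
  The leading term: modulo terms that lose one more unit of weight, \<open>d_(k+2) - \<psi>(d_(k+2))\<close> acts as
  \<open>-(2 k + 2) \<psi>(d_2)\<close> times the partial derivative by \<open>d_(-k)\<close>. Sortedness makes all equal factors
  adjacent, so it does not matter which of them is removed.
\<close>
lemma E_sorted_word:
  assumes "u \<in> U" "sorted ks"
  shows "E (k + 2) (word ks u) + (of_nat (2 * k + 2) * \<psi> 2 * of_nat (count_list ks k)) *s
      word (remove1 k ks) u \<in> P (int (wt ks) - int (k + 2))"
  using assms(2)
proof (induction ks)
  case Nil
  then show ?case using whittaker[OF assms(1), of "k + 2"] by (simp add: E_def I_sub_P)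
next
  case (Cons j ks)
  let ?v = "word ks u" and ?n = "int (wt ks) + int j + 1 - int (k + 2)"
  let ?a = "of_nat (2 * k + 2) * \<psi> 2" and ?b = "complex_of_nat (count_list ks k)"
  let ?c = "if j + 2 = k + 2 then (of_nat (2 * j + 2) * \<psi> 2) *s ?v else 0"
  let ?r = "word (remove1 k ks) u"
  have v: "?v \<in> P (int (wt ks))" using assms(1) by (simp add: word_in_P)
  have 1: "E (k + 2) (D (- int j) ?v) - D (- int j) (E (k + 2) ?v) + ?c \<in> P ?n"
    by (rule E_D_lower[OF v E_word[OF assms(1)]]) auto
  have 2: "D (- int j) (E (k + 2) ?v + (?a * ?b) *s ?r) \<in> P ?n"
    using D_lower_P[OF Cons.IH, of j] Cons.prems by (simp add: algebra_simps)
  \<comment> \<open>If \<open>j = k\<close> occurs again in \<open>ks\<close>, then it is the head of \<open>ks\<close> because the list is sorted.\<close>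
  have 3: "?c + (?a * ?b) *s D (- int j) ?r
      = (?a * of_nat (count_list (j # ks) k)) *s word (remove1 k (j # ks)) u"
  proof (cases "j = k")
    case True
    have "D (- int j) ?r = ?v" if "k \<in> set ks"
    proof (cases ks)
      case i: (Cons i ls)
      have "k \<le> i" "i \<le> k" using that Cons.prems True i by auto
      then show ?thesis using True i by simp
    qed (use that in simp)
    then have "?b *s D (- int j) ?r = ?b *s ?v"
      by (cases "k \<in> set ks") auto
    then have "(?a * ?b) *s D (- int j) ?r = (?a * ?b) *s ?v"
      by (metis scale_scale)
    then show ?thesis using True by (simp add: algebra_simps)
  qed auto
  have "E (k + 2) (word (j # ks) u) + (?c + (?a * ?b) *s D (- int j) ?r) \<in> P ?n"
    using P_add[OF 1 2] by (simp add: D_add D_scale algebra_simps)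
  then show ?case unfolding 3 by (simp add: algebra_simps)
qed

lemma wt_remove1: "k \<in> set ks \<Longrightarrow> wt (remove1 k ks) + (k + 1) = wt ks"
  by (induction ks) auto

text \<open>
  Ordered words of weight \<open>n\<close> are independent modulo smaller weight. For a word \<open>ks\<close> in the sum that
  contains \<open>k\<close>, apply \<open>d_(k+2) - \<psi>(d_(k+2))\<close>: the sum becomes, up to a nonzero factor, its derivative by
  \<open>d_(-k)\<close>, a sum of ordered words of weight \<open>n - (k + 1)\<close> in which the coefficient of \<open>ks\<close> survives,
  multiplied with the number of occurrences of \<open>k\<close>.
\<close>
lemma sorted_words_independent_graded:
  assumes "finite A" "\<And>ks. ks \<in> A \<Longrightarrow> sorted ks \<and> wt ks = n \<and> c ks \<in> U"
    and "(\<Sum>ks\<in>A. word ks (c ks)) \<in> P (int n - 1)" and "ks \<in> A"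
  shows "c ks \<in> I"
  using assms
proof (induction n arbitrary: A c ks rule: less_induct)
  case (less n)
  show ?case
  proof (cases "ks = []")
    case True
    with less.prems(2)[OF less.prems(4)] have "n = 0" by simp
    have "A = {[]}"
    proof -
      have "ls = []" if "ls \<in> A" for ls
        using less.prems(2)[OF that] \<open>n = 0\<close> by (cases ls) auto
      then show ?thesis using less.prems(4) True by blast
    qed
    then show ?thesis using less.prems(3) \<open>n = 0\<close> True by (simp add: P_neg_eq)
  next
    case False
    then obtain k where k: "k \<in> set ks" by (cases ks) auto
    have n: "k + 1 \<le> n" using wt_remove1[OF k] less.prems(2,4) by force
    define n' where "n' = n - (k + 1)"
    define B where "B = {ls \<in> A. k \<in> set ls}"
    let ?a = "of_nat (2 * k + 2) * \<psi> 2"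
    \<comment> \<open>The coefficients of the derivative by the factor \<open>D (- int k)\<close>.\<close>
    define c' where "c' ls = of_nat (count_list (insort k ls) k) *s c (insort k ls)" for ls
    have a: "?a \<noteq> 0" using psi_2 of_nat_neq_0[of "2 * k + 1", where 'a = complex] by simp
    have inj: "inj_on (remove1 k) B"
      by (rule inj_on_inverseI[where g = "insort k"])
        (use less.prems(2) in \<open>auto simp: B_def insort_remove1\<close>)
    have E1: "E (k + 2) (\<Sum>ls\<in>A. word ls (c ls)) \<in> P (int n' - 1)"
      using E_P[OF less.prems(3), of "k + 2"] n by (simp add: n'_def of_nat_diff algebra_simps)
    have E2: "(\<Sum>ls\<in>A. E (k + 2) (word ls (c ls)) + (?a * of_nat (count_list ls k)) *s
        word (remove1 k ls) (c ls)) \<in> P (int n' - 1)"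
    proof (rule P_sum)
      fix ls assume "ls \<in> A"
      then have "sorted ls" "wt ls = n" "c ls \<in> U" using less.prems(2) by auto
      with E_sorted_word[of "c ls" ls k] n
      show "E (k + 2) (word ls (c ls)) + (?a * of_nat (count_list ls k)) *s
        word (remove1 k ls) (c ls) \<in> P (int n' - 1)"
        by (simp add: n'_def of_nat_diff algebra_simps)
    qed
    have "(\<Sum>ls\<in>A. (?a * of_nat (count_list ls k)) *s word (remove1 k ls) (c ls)) \<in> P (int n' - 1)"
      using P_diff[OF E2 E1] by (simp add: sum.distrib E_sum)
    also have "(\<Sum>ls\<in>A. (?a * of_nat (count_list ls k)) *s word (remove1 k ls) (c ls))
        = (\<Sum>ls\<in>B. (?a * of_nat (count_list ls k)) *s word (remove1 k ls) (c ls))"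
      by (rule sum.mono_neutral_right) (auto simp: B_def \<open>finite A\<close>)
    also have "\<dots> = ?a *s (\<Sum>ls\<in>B. word (remove1 k ls) (c' (remove1 k ls)))"
      unfolding scale_sum_right
      by (rule sum.cong) (use less.prems(2) in \<open>auto simp: B_def c'_def insort_remove1 word_scale\<close>)
    also have "\<dots> = ?a *s (\<Sum>ls\<in>remove1 k ` B. word ls (c' ls))"
      using inj by (simp add: sum.reindex)
    finally have sum: "(\<Sum>ls\<in>remove1 k ` B. word ls (c' ls)) \<in> P (int n' - 1)"
      by (rule subspace_unscale[OF subspace_P a])
    have "c' (remove1 k ks) \<in> I"
    proof (rule less.IH[OF _ _ _ sum])
      show "n' < n" using n by (simp add: n'_def)
      show "finite (remove1 k ` B)" using \<open>finite A\<close> by (simp add: B_def)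
      show "remove1 k ks \<in> remove1 k ` B" using k less.prems(4) by (simp add: B_def)
    next
      fix ls assume "ls \<in> remove1 k ` B"
      then obtain js where js: "js \<in> A" "k \<in> set js" "ls = remove1 k js" by (auto simp: B_def)
      with less.prems(2)[OF js(1)] wt_remove1[OF js(2)]
      show "sorted ls \<and> wt ls = n' \<and> c' ls \<in> U"
        by (auto simp: n'_def sorted_remove1 c'_def insort_remove1 intro: subspace_scale[OF U_subspace])
    qed
    then have "of_nat (count_list ks k) *s c ks \<in> I"
      using k less.prems(2)[OF less.prems(4)] by (simp add: c'_def insort_remove1)
    then show ?thesis
      by (rule subspace_unscale[OF I_subspace, rotated]) (use k in \<open>simp add: count_list_0_iff\<close>)
  qed
qed

text \<open>Otherwise the words of maximal weight among those with a nonzero coefficient contradict the graded statement.\<close>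
theorem sorted_words_independent:
  assumes "finite A" "\<And>ks. ks \<in> A \<Longrightarrow> sorted ks \<and> c ks \<in> U"
    and sum: "(\<Sum>ks\<in>A. word ks (c ks)) \<in> I" and "ks \<in> A"
  shows "c ks \<in> I"
proof (rule ccontr)
  assume "c ks \<notin> I"
  define A0 where "A0 = {ks \<in> A. c ks \<notin> I}"
  define n where "n = Max (wt ` A0)"
  define A1 where "A1 = {ks \<in> A0. wt ks = n}"
  have fin: "finite A0" "A0 \<noteq> {}" "finite A1" using assms \<open>c ks \<notin> I\<close> by (auto simp: A0_def A1_def)
  then have "n \<in> wt ` A0" unfolding n_def by (intro Max_in) auto
  then obtain ls where ls: "ls \<in> A1" by (auto simp: A1_def)
  have "(\<Sum>ks\<in>A - A1. word ks (c ks)) \<in> P (int n - 1)"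
  proof (rule P_sum)
    fix ks assume ks: "ks \<in> A - A1"
    show "word ks (c ks) \<in> P (int n - 1)"
    proof (cases "c ks \<in> I")
      case True
      then show ?thesis by (simp add: I_sub_P word_I)
    next
      case False
      with ks have "ks \<in> A0" "wt ks \<noteq> n" by (auto simp: A0_def A1_def)
      moreover from this fin have "wt ks \<le> n" unfolding n_def by simp
      ultimately show ?thesis using assms(2)[of ks] ks by (intro word_in_P) auto
    qed
  qed
  with I_sub_P[OF sum] have "(\<Sum>ks\<in>A. word ks (c ks)) - (\<Sum>ks\<in>A - A1. word ks (c ks)) \<in> P (int n - 1)"
    by (rule P_diff)
  also have "(\<Sum>ks\<in>A. word ks (c ks)) - (\<Sum>ks\<in>A - A1. word ks (c ks)) = (\<Sum>ks\<in>A1. word ks (c ks))"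
    using \<open>finite A\<close> by (subst sum.subset_diff[of A1 A]) (auto simp: A1_def A0_def)
  finally have "c ls \<in> I"
    using ls assms(2) fin(3)
    by (intro sorted_words_independent_graded[of A1 n c ls]) (auto simp: A1_def A0_def)
  with ls show False by (simp add: A1_def A0_def)
qed

text \<open>
  Exchanging \<open>d_(-k)\<close> and \<open>d_(-j)\<close> costs a multiple of \<open>d_(-(k+j))\<close>, whose weight is smaller by one. The central term
  can occur only for \<open>k = j = 0\<close>, where its coefficient vanishes.
\<close>
lemma word_insort:
  assumes "u \<in> U" shows "word (k # ks) u - word (insort k ks) u \<in> P (int (wt ks) + int k)"
proof (induction ks)
  case Nil
  then show ?case by (simp add: P_0)
next
  case (Cons j ks)
  show ?case
  proof (cases "k \<le> j")
    case True
    then show ?thesis by (simp add: P_0)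
  next
    case False
    let ?v = "word ks u" and ?n = "int (wt (j # ks)) + int k"
    have v: "?v \<in> P (int (wt ks))" using assms by (simp add: word_in_P)
    have "D (- int k) (D (- int j) ?v) - D (- int j) (D (- int k) ?v)
        - of_int (- int j - - int k) *s D (- int k + - int j) ?v \<in> P ?n"
      using I_sub_P[OF D_bracket[of "- int k" "- int j" ?v]] False
      by (auto split: if_splits)
    moreover have "of_int (- int j - - int k) *s D (- int k + - int j) ?v \<in> P ?n"
      using D_lower_P[OF v, of "k + j"] by (intro P_scale) (simp add: algebra_simps)
    moreover have "D (- int j) (word (k # ks) u - word (insort k ks) u) \<in> P ?n"
      using D_lower_P[OF Cons, of j] by (simp add: algebra_simps)
    ultimately have "(D (- int k) (D (- int j) ?v) - D (- int j) (D (- int k) ?v)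
        - of_int (- int j - - int k) *s D (- int k + - int j) ?v)
        + of_int (- int j - - int k) *s D (- int k + - int j) ?v
        + D (- int j) (word (k # ks) u - word (insort k ks) u) \<in> P ?n"
      by (intro P_add)
    then show ?thesis using False by (simp add: D_diff)
  qed
qed

lemma wt_sort [simp]: "wt (sort ks) = wt ks"
  by (metis mset_sort mset_map sum_mset_sum_list wt_def)

lemma word_sort: assumes "u \<in> U" shows "word ks u - word (sort ks) u \<in> P (int (wt ks) - 1)"
proof (induction ks)
  case Nil
  then show ?case by (simp add: P_0)
next
  case (Cons k ks)
  have "D (- int k) (word ks u - word (sort ks) u) \<in> P (int (wt (k # ks)) - 1)"
    using D_lower_P[OF Cons, of k] by (simp add: algebra_simps)
  moreover have "word (k # sort ks) u - word (insort k (sort ks)) u \<in> P (int (wt (k # ks)) - 1)"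
    using word_insort[OF assms, of k "sort ks"] by (simp add: algebra_simps)
  ultimately have "D (- int k) (word ks u - word (sort ks) u)
      + (word (k # sort ks) u - word (insort k (sort ks)) u) \<in> P (int (wt (k # ks)) - 1)"
    by (rule P_add)
  then show ?case by (simp add: D_diff)
qed

text \<open>
  The vectors that are combinations of ordered words modulo \<open>I\<close>. They are shown to be stable under all
  operators, so that they contain everything that \<open>U\<close> generates.
\<close>
definition sorted_form :: "'v \<Rightarrow> bool"
  where "sorted_form v \<longleftrightarrow> (\<exists>A c. finite A \<and> (\<forall>ks\<in>A. sorted ks) \<and> (\<forall>ks. c ks \<in> U)
    \<and> v - (\<Sum>ks\<in>A. word ks (c ks)) \<in> I)"

lemma sorted_form_I: "v \<in> I \<Longrightarrow> sorted_form v"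
  unfolding sorted_form_def
  by (rule exI[of _ "{}"], rule exI[of _ "\<lambda>_. 0"]) (simp add: subspace_0[OF U_subspace])

lemma sorted_form_word: "u \<in> U \<Longrightarrow> sorted ks \<Longrightarrow> sorted_form (word ks u)"
  unfolding sorted_form_def
  by (rule exI[of _ "{ks}"], rule exI[of _ "\<lambda>_. u"]) (simp add: subspace_0[OF I_subspace])

lemma sorted_form_scale: assumes "sorted_form v" shows "sorted_form (a *s v)"
proof -
  from assms obtain A c where A: "finite A" "\<forall>ks\<in>A. sorted ks" "\<forall>ks. c ks \<in> U"
    and v: "v - (\<Sum>ks\<in>A. word ks (c ks)) \<in> I"
    unfolding sorted_form_def by blast
  have "a *s v - (\<Sum>ks\<in>A. word ks (a *s c ks)) \<in> I"
    using subspace_scale[OF I_subspace v, of a]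
    by (simp add: word_scale scale_sum_right scale_right_diff_distrib)
  with A show ?thesis
    unfolding sorted_form_def by (intro exI[of _ A] exI[of _ "\<lambda>ks. a *s c ks"])
      (auto intro: subspace_scale[OF U_subspace])
qed

lemma sorted_form_add: assumes "sorted_form v" "sorted_form v'" shows "sorted_form (v + v')"
proof -
  from assms obtain A c A' c' where A: "finite A" "\<forall>ks\<in>A. sorted ks" "\<forall>ks. c ks \<in> U"
    and v: "v - (\<Sum>ks\<in>A. word ks (c ks)) \<in> I"
    and A': "finite A'" "\<forall>ks\<in>A'. sorted ks" "\<forall>ks. c' ks \<in> U"
    and v': "v' - (\<Sum>ks\<in>A'. word ks (c' ks)) \<in> I"
    unfolding sorted_form_def by blast
  let ?d = "\<lambda>ks. (if ks \<in> A then c ks else 0) + (if ks \<in> A' then c' ks else 0)"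
  have "(\<Sum>ks\<in>A \<union> A'. word ks (?d ks))
      = (\<Sum>ks\<in>A \<union> A'. word ks (if ks \<in> A then c ks else 0))
        + (\<Sum>ks\<in>A \<union> A'. word ks (if ks \<in> A' then c' ks else 0))"
    by (simp add: word_add sum.distrib)
  also have "(\<Sum>ks\<in>A \<union> A'. word ks (if ks \<in> A then c ks else 0)) = (\<Sum>ks\<in>A. word ks (c ks))"
    using A A' by (intro sum.mono_neutral_cong_right) (auto simp: word_zero)
  also have "(\<Sum>ks\<in>A \<union> A'. word ks (if ks \<in> A' then c' ks else 0)) = (\<Sum>ks\<in>A'. word ks (c' ks))"
    using A A' by (intro sum.mono_neutral_cong_right) (auto simp: word_zero)
  finally have "v + v' - (\<Sum>ks\<in>A \<union> A'. word ks (?d ks)) \<in> I"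
    using subspace_add[OF I_subspace v v'] by (simp add: algebra_simps)
  moreover have "\<forall>ks. ?d ks \<in> U"
    using A A' by (auto intro: subspace_add[OF U_subspace] subspace_0[OF U_subspace])
  ultimately show ?thesis
    unfolding sorted_form_def using A A' by (intro exI[of _ "A \<union> A'"] exI[of _ ?d]) auto
qed

lemma sorted_form_P: "v \<in> P (int n) \<Longrightarrow> sorted_form v"
proof (induction n arbitrary: v rule: less_induct)
  case (less n)
  from less.prems show ?case
  proof (induction rule: P_induct)
    case (word ks u)
    have "sorted_form (word ks u - word (sort ks) u)"
    proof (cases "wt ks = 0")
      case True
      then show ?thesis using word_sort[OF word(1), of ks] by (simp add: P_neg_eq sorted_form_I)
    next
      case False
      then show ?thesis
        using word_sort[OF word(1), of ks] word(2) less.IH[of "wt ks - 1"]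
        by (simp add: of_nat_diff)
    qed
    from sorted_form_add[OF this sorted_form_word[OF word(1), of "sort ks"]]
    show ?case by simp
  qed (auto intro: sorted_form_I sorted_form_add sorted_form_scale)
qed

lemma sorted_form_D: assumes "sorted_form v" shows "sorted_form (D k v)"
proof -
  from assms obtain A c where A: "finite A" "\<forall>ks\<in>A. sorted ks" "\<forall>ks. c ks \<in> U"
    and v: "v - (\<Sum>ks\<in>A. word ks (c ks)) \<in> I"
    unfolding sorted_form_def by blast
  have "sorted_form (D k (word ks u))" if "u \<in> U" for ks u
  proof (cases "k \<le> 0")
    case True
    have "D k (word ks u) = word (nat (- k) # ks) u" using True by simp
    also have "\<dots> \<in> P (int (wt (nat (- k) # ks)))" using that by (rule word_in_P) simp
    finally show ?thesis by (rule sorted_form_P)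
  next
    case False
    have w: "word ks u \<in> P (int (wt ks))" using that by (rule word_in_P) simp
    have "E (nat k) (word ks u) \<in> P (int (wt ks))"
      by (rule P_mono[OF E_P[OF w, of "nat k"]]) (use False in auto)
    from P_add[OF this P_scale[OF w, of "\<psi> (nat k)"]] show ?thesis
      using False by (intro sorted_form_P[of _ "wt ks"]) (simp add: E_def)
  qed
  with A(3) have terms: "sorted_form (D k (word ks (c ks)))" for ks by blast
  from A(1) have sum: "sorted_form (\<Sum>ks\<in>A. D k (word ks (c ks)))"
    by (induction A rule: finite_induct) (auto intro: sorted_form_add terms sorted_form_I subspace_0[OF I_subspace])
  from sorted_form_add[OF sorted_form_I[OF D_I[OF v]] sum, of k] show ?thesis
    by (simp add: D_diff D_sum)
qed

lemma Z_sorted_sum: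
  assumes "v - (\<Sum>ks\<in>A. word ks (c ks)) \<in> I"
  shows "Z v - (\<Sum>ks\<in>A. word ks (Z (c ks))) \<in> I"
proof -
  have "Z (v - (\<Sum>ks\<in>A. word ks (c ks))) + (\<Sum>ks\<in>A. Z (word ks (c ks)) - word ks (Z (c ks))) \<in> I"
    by (intro subspace_add[OF I_subspace] Z_I[OF assms] subspace_sum[OF I_subspace] Z_word)
  then show ?thesis by (simp add: Z_diff Z_sum sum_subtractf)
qed

lemma sorted_form_Z: "sorted_form v \<Longrightarrow> sorted_form (Z v)"
  unfolding sorted_form_def using Z_sorted_sum Z_U by metis

text \<open>
  If \<open>u = z v\<close> with \<open>u\<close> in \<open>U\<close>, expand \<open>v\<close> into ordered words. Since \<open>z\<close> is central it acts on the
  coefficients, and by independence the coefficient of the empty word in \<open>v\<close> is already a preimage of \<open>u\<close>.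
\<close>
lemma Z_surjective_on_U:
  assumes "u \<in> U" "sorted_form v" "Z v - u \<in> I"
  shows "\<exists>u'\<in>U. Z u' - u \<in> I"
proof -
  from assms(2) obtain A c where A: "finite A" "\<forall>ks\<in>A. sorted ks" "\<forall>ks. c ks \<in> U"
    and v: "v - (\<Sum>ks\<in>A. word ks (c ks)) \<in> I"
    unfolding sorted_form_def by blast
  let ?c = "\<lambda>ks. if ks \<in> A then c ks else 0"
  \<comment> \<open>The coefficients of \<open>Z v - u\<close>, where \<open>u\<close> belongs to the empty word.\<close>
  let ?d = "\<lambda>ks. Z (?c ks) - (if ks = [] then u else 0)"
  have fin: "finite (insert [] A)" using A by simp
  have "(\<Sum>ks\<in>insert [] A. word ks (?d ks))
      = (\<Sum>ks\<in>insert [] A. word ks (Z (?c ks)) - (if ks = [] then u else 0))"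
    by (rule sum.cong) (auto simp: word_def)
  also have "\<dots> = (\<Sum>ks\<in>insert [] A. word ks (Z (?c ks)))
      - (\<Sum>ks\<in>insert [] A. if ks = [] then u else 0)"
    by (rule sum_subtractf)
  also have "(\<Sum>ks\<in>insert [] A. word ks (Z (?c ks))) = (\<Sum>ks\<in>A. word ks (Z (c ks)))"
    using A by (intro sum.mono_neutral_cong_right) (auto simp: Z_zero word_zero)
  also have "(\<Sum>ks\<in>insert [] A. if ks = [] then u else 0) = u"
    using fin by simp
  also have "(\<Sum>ks\<in>A. word ks (Z (c ks))) - u
      = (Z v - u) - (Z v - (\<Sum>ks\<in>A. word ks (Z (c ks))))"
    by simp
  also have "\<dots> \<in> I"
    using subspace_diff[OF I_subspace assms(3) Z_sorted_sum[OF v]] .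
  finally have sum: "(\<Sum>ks\<in>insert [] A. word ks (?d ks)) \<in> I" .
  have "?d [] \<in> I"
  proof (rule sorted_words_independent[OF fin _ sum])
    fix ks assume "ks \<in> insert [] A"
    with A assms(1) show "sorted ks \<and> ?d ks \<in> U"
      by (auto simp: Z_zero intro!: subspace_diff[OF U_subspace] Z_U subspace_0[OF U_subspace] subspace_neg[OF U_subspace])
  qed simp
  moreover have "?c [] \<in> U" using A subspace_0[OF U_subspace] by simp
  ultimately show ?thesis by (intro bexI[of _ "?c []"]) auto
qed

end

section \<open>Finitely supported functions\<close>

lemma lookup_cscale [simp]: "Poly_Mapping.lookup (cscale c p) b = c * Poly_Mapping.lookup p b"
  by (simp add: cscale_def Poly_Mapping.map.rep_eq when_def)

interpretation cscale: vector_space cscale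
  by unfold_locales (auto intro!: poly_mapping_eqI simp: lookup_add algebra_simps)

lemma cscale_single [simp]: "cscale c (Poly_Mapping.single b a) = Poly_Mapping.single b (c * a)"
  by (rule poly_mapping_eqI) (simp add: lookup_single when_def)

lemma keys_cscale: "Poly_Mapping.keys (cscale c p) \<subseteq> Poly_Mapping.keys p"
  by (auto simp: in_keys_iff)

lemma keys_diff_subset: "Poly_Mapping.keys (p - q) \<subseteq> Poly_Mapping.keys p \<union> Poly_Mapping.keys q"
  for p q :: "'b \<Rightarrow>\<^sub>0 complex"
  by (auto simp: in_keys_iff lookup_minus)

lemma sum_of_singles:
  fixes p :: "'b \<Rightarrow>\<^sub>0 complex"
  shows "p = (\<Sum>b\<in>Poly_Mapping.keys p. cscale (Poly_Mapping.lookup p b) (Poly_Mapping.single b 1))"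
  by (rule poly_mapping_eqI) (auto simp: lookup_sum lookup_single when_def in_keys_iff)

text \<open>A linear statement about the span of a set of basis vectors has to be checked on these basis vectors only.\<close>
lemma poly_mapping_linear_induct [consumes 1, case_names zero single add scale]:
  fixes p :: "'b \<Rightarrow>\<^sub>0 complex"
  assumes "Poly_Mapping.keys p \<subseteq> B" and "Q 0"
    and "\<And>b. b \<in> B \<Longrightarrow> Q (Poly_Mapping.single b 1)"
    and "\<And>p q. Poly_Mapping.keys p \<subseteq> B \<Longrightarrow> Poly_Mapping.keys q \<subseteq> B \<Longrightarrow> Q p \<Longrightarrow> Q q \<Longrightarrow> Q (p + q)"
    and "\<And>c p. Poly_Mapping.keys p \<subseteq> B \<Longrightarrow> Q p \<Longrightarrow> Q (cscale c p)"
  shows "Q p"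
proof -
  have *: "Poly_Mapping.keys (\<Sum>b\<in>A. cscale (f b) (Poly_Mapping.single b 1)) \<subseteq> B
      \<and> Q (\<Sum>b\<in>A. cscale (f b) (Poly_Mapping.single b 1))" if "finite A" "A \<subseteq> B" for A f
    using that
  proof (induction A rule: finite_induct)
    case (insert b A)
    let ?t = "cscale (f b) (Poly_Mapping.single b 1)" and ?s = "\<Sum>b\<in>A. cscale (f b) (Poly_Mapping.single b 1)"
    have t: "Poly_Mapping.keys ?t \<subseteq> B" using insert.prems by auto
    have s: "Poly_Mapping.keys ?s \<subseteq> B" "Q ?s" using insert.IH insert.prems by auto
    have "Q ?t" using insert.prems by (intro assms(3,5)) auto
    then have "Q (?t + ?s)" by (rule assms(4)[OF t s(1) _ s(2)])
    moreover have "Poly_Mapping.keys (?t + ?s) \<subseteq> B"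
      using keys_add[of ?t ?s] s(1) t by blast
    moreover have "(\<Sum>b\<in>insert b A. cscale (f b) (Poly_Mapping.single b 1)) = ?t + ?s"
      using insert.hyps by (rule sum.insert)
    ultimately show ?case by simp
  qed (simp add: assms(2))
  show ?thesis
    using *[OF finite_keys assms(1), of "Poly_Mapping.lookup p"] sum_of_singles[of p] by simp
qed

lemma cscale_mult_left: "cscale c (p * q) = cscale c p * q"
  for p q :: "'b::monoid_add \<Rightarrow>\<^sub>0 complex"
  by (simp add: cscale_def mult_map_scale_conv_mult mult.assoc)

lemma cscale_conv_mult: "cscale c p = cscale c 1 * p"
  for p :: "'b::monoid_add \<Rightarrow>\<^sub>0 complex"
  by (simp flip: cscale_mult_left)

lemma cscale_mult_right: "p * cscale c q = cscale c (p * q)"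
  for p q :: "'b::monoid_add \<Rightarrow>\<^sub>0 complex"
proof -
  have comm: "p * cscale c 1 = cscale c p"
    using subset_UNIV
  proof (induction p rule: poly_mapping_linear_induct)
    case (single b)
    then show ?case by (simp add: mult_single flip: single_one)
  next
    case (scale a p)
    then show ?case by (simp flip: cscale_mult_left add: mult.commute)
  qed (simp_all add: distrib_right cscale.scale_right_distrib)
  then show ?thesis by (simp add: cscale_conv_mult[of c q] comm cscale_mult_left flip: mult.assoc)
qed

section \<open>Linear extension to finitely supported functions\<close>

lemma complex_field_simps [simp]:
  "carrier complex_field = UNIV" "add complex_field = (+)" "monoid.mult complex_field = (*)"
  "one complex_field = 1" "ring.zero complex_field = 0"
  by (simp_all add: ring_of_type_algebra_def)

text \<open>
  The linear extension of a map from a basis to a module. The action of the free algebra and the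
  homomorphisms out of a free tensor space are both of this form.
\<close>
definition linear_extension :: "('m, 'x) lie_module_scheme \<Rightarrow> ('b \<Rightarrow> 'm) \<Rightarrow> ('b \<Rightarrow>\<^sub>0 complex) \<Rightarrow> 'm"
  where "linear_extension M f p =
    (\<Oplus>\<^bsub>M\<^esub>b\<in>Poly_Mapping.keys p. Poly_Mapping.lookup p b \<odot>\<^bsub>M\<^esub> f b)"

locale complex_module = module complex_field M for M :: "'m lie_module" (structure)
begin

lemma smult_in [simp]: "m \<in> carrier M \<Longrightarrow> c \<odot> m \<in> carrier M"
  using smult_closed[of c m] by simp

lemma smult_zero_scalar [simp]: "m \<in> carrier M \<Longrightarrow> 0 \<odot> m = \<zero>\<^bsub>M\<^esub>"
  using smult_l_null[of m] by simp

lemma smult_zero_vector [simp]: "c \<odot> \<zero>\<^bsub>M\<^esub> = \<zero>\<^bsub>M\<^esub>"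
  using smult_r_null[of c] by simp

lemma smult_one_scalar [simp]: "m \<in> carrier M \<Longrightarrow> 1 \<odot> m = m"
  using smult_one[of m] by simp

lemma smult_add_scalar: "m \<in> carrier M \<Longrightarrow> (a + b) \<odot> m = a \<odot> m \<oplus>\<^bsub>M\<^esub> b \<odot> m"
  using smult_l_distr[of a b m] by simp

lemma smult_add_vector:
  "m \<in> carrier M \<Longrightarrow> m' \<in> carrier M \<Longrightarrow> c \<odot> (m \<oplus>\<^bsub>M\<^esub> m') = c \<odot> m \<oplus>\<^bsub>M\<^esub> c \<odot> m'"
  using smult_r_distr[of c m m'] by simp

lemma smult_smult: "m \<in> carrier M \<Longrightarrow> a \<odot> (b \<odot> m) = (a * b) \<odot> m"
  using smult_assoc1[of a b m] by simp

lemma smult_minus_one: "m \<in> carrier M \<Longrightarrow> (- 1) \<odot> m = \<ominus>\<^bsub>M\<^esub> m"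
  using smult_add_scalar[of m "- 1" 1] by (simp add: M.minus_equality)

lemma smult_diff_vector:
  "m \<in> carrier M \<Longrightarrow> m' \<in> carrier M \<Longrightarrow> c \<odot> (m \<ominus>\<^bsub>M\<^esub> m') = c \<odot> m \<ominus>\<^bsub>M\<^esub> c \<odot> m'"
  using smult_r_minus[of c m'] by (simp add: a_minus_def smult_add_vector)

lemma diff_zero_iff: "m \<in> carrier M \<Longrightarrow> m' \<in> carrier M \<Longrightarrow> m \<ominus>\<^bsub>M\<^esub> m' = \<zero>\<^bsub>M\<^esub> \<longleftrightarrow> m = m'"
proof
  assume m: "m \<in> carrier M" "m' \<in> carrier M" and "m \<ominus>\<^bsub>M\<^esub> m' = \<zero>\<^bsub>M\<^esub>"
  then have "\<ominus>\<^bsub>M\<^esub> (\<ominus>\<^bsub>M\<^esub> m') = m"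
    by (intro M.minus_equality) (auto simp: a_minus_def)
  with m show "m = m'" by simp
qed (simp add: a_minus_def M.r_neg)

lemma linear_extension_superset:
  assumes "finite K" "Poly_Mapping.keys p \<subseteq> K" "f \<in> K \<rightarrow> carrier M"
  shows "linear_extension M f p = (\<Oplus>\<^bsub>M\<^esub>b\<in>K. Poly_Mapping.lookup p b \<odot> f b)"
  unfolding linear_extension_def
  by (rule M.add.finprod_mono_neutral_cong_left) (use assms in \<open>auto simp: in_keys_iff Pi_iff\<close>)

lemma linear_extension_closed:
  assumes "f \<in> Poly_Mapping.keys p \<rightarrow> carrier M"
  shows "linear_extension M f p \<in> carrier M"
  unfolding linear_extension_def using assms by (intro M.finsum_closed) auto

lemma linear_extension_zero [simp]: "linear_extension M f 0 = \<zero>\<^bsub>M\<^esub>"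
  by (simp add: linear_extension_def)

lemma linear_extension_single [simp]:
  assumes "f b \<in> carrier M"
  shows "linear_extension M f (Poly_Mapping.single b a) = a \<odot> f b"
  using linear_extension_superset[of "{b}" "Poly_Mapping.single b a" f] assms by simp

lemma linear_extension_add:
  assumes "Poly_Mapping.keys p \<subseteq> B" "Poly_Mapping.keys q \<subseteq> B" "f \<in> B \<rightarrow> carrier M"
  shows "linear_extension M f (p + q) = linear_extension M f p \<oplus>\<^bsub>M\<^esub> linear_extension M f q"
proof -
  let ?K = "Poly_Mapping.keys p \<union> Poly_Mapping.keys q"
  have f: "f \<in> ?K \<rightarrow> carrier M" using assms by blast
  have "linear_extension M f (p + q) = (\<Oplus>\<^bsub>M\<^esub>b\<in>?K. Poly_Mapping.lookup (p + q) b \<odot> f b)"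
    by (rule linear_extension_superset) (use f keys_add[of p q] in auto)
  also have "\<dots> = (\<Oplus>\<^bsub>M\<^esub>b\<in>?K. Poly_Mapping.lookup p b \<odot> f b \<oplus>\<^bsub>M\<^esub> Poly_Mapping.lookup q b \<odot> f b)"
    by (rule M.finsum_cong') (use f in \<open>auto simp: lookup_add smult_add_scalar Pi_iff\<close>)
  also have "\<dots> = (\<Oplus>\<^bsub>M\<^esub>b\<in>?K. Poly_Mapping.lookup p b \<odot> f b)
      \<oplus>\<^bsub>M\<^esub> (\<Oplus>\<^bsub>M\<^esub>b\<in>?K. Poly_Mapping.lookup q b \<odot> f b)"
    by (rule M.finsum_addf) (use f in auto)
  finally show ?thesis
    using linear_extension_superset[of ?K _ f] f by simp
qed

lemma linear_extension_cscale:
  assumes "Poly_Mapping.keys p \<subseteq> B" "f \<in> B \<rightarrow> carrier M"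
  shows "linear_extension M f (cscale c p) = c \<odot> linear_extension M f p"
proof -
  let ?K = "Poly_Mapping.keys p"
  have f: "f \<in> ?K \<rightarrow> carrier M" using assms by blast
  have "linear_extension M f (cscale c p) = (\<Oplus>\<^bsub>M\<^esub>b\<in>?K. Poly_Mapping.lookup (cscale c p) b \<odot> f b)"
    by (rule linear_extension_superset) (use f keys_cscale[of c p] in auto)
  also have "\<dots> = (\<Oplus>\<^bsub>M\<^esub>b\<in>?K. c \<odot> (Poly_Mapping.lookup p b \<odot> f b))"
    by (rule M.finsum_cong') (use f in \<open>auto simp: smult_smult Pi_iff\<close>)
  also have "\<dots> = c \<odot> linear_extension M f p"
    unfolding linear_extension_def using f
    by (subst finsum_smult_ldistr) auto
  finally show ?thesis .
qed

lemma linear_extension_diff: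
  assumes "Poly_Mapping.keys p \<subseteq> B" "Poly_Mapping.keys q \<subseteq> B" "f \<in> B \<rightarrow> carrier M"
  shows "linear_extension M f (p - q) = linear_extension M f p \<ominus>\<^bsub>M\<^esub> linear_extension M f q"
proof -
  have "linear_extension M f q \<in> carrier M"
    using assms by (intro linear_extension_closed) auto
  moreover have "p - q = p + cscale (- 1) q"
    by (rule poly_mapping_eqI) (simp add: lookup_add lookup_minus)
  moreover have "Poly_Mapping.keys (cscale (- 1) q) \<subseteq> B"
    using subset_trans[OF keys_cscale assms(2)] .
  ultimately show ?thesis
    using linear_extension_add[of p B "cscale (- 1) q" f] linear_extension_cscale[of q B f "- 1"] assms
    by (metis a_minus_def smult_minus_one)
qed

end

sublocale lie_module \<subseteq> complex_module M
  by unfold_locales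

section \<open>The enveloping algebra and its action\<close>

definition lie_subalgebra :: "vir set \<Rightarrow> bool"
  where "lie_subalgebra h \<longleftrightarrow> (\<forall>x\<in>h. \<forall>y\<in>h. x + y \<in> h \<and> vbracket x y \<in> h) \<and> (\<forall>c. \<forall>x\<in>h. cscale c x \<in> h)"

lemma lie_subalgebra_UNIV: "lie_subalgebra UNIV"
  by (simp add: lie_subalgebra_def)

lemma free_algebra_simps [simp]:
  "carrier (free_algebra h) = {p. Poly_Mapping.keys p \<subseteq> lists h}"
  "monoid.mult (free_algebra h) = (*)" "one (free_algebra h) = 1"
  "ring.zero (free_algebra h) = 0" "add (free_algebra h) = (+)"
  by (simp_all add: free_algebra_def)

lemma keys_add_lists:
  "Poly_Mapping.keys p \<subseteq> B \<Longrightarrow> Poly_Mapping.keys q \<subseteq> B \<Longrightarrow> Poly_Mapping.keys (p + q) \<subseteq> B"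
  using keys_add[of p q] by blast

lemma keys_mult_lists:
  fixes p q :: "'a list \<Rightarrow>\<^sub>0 complex"
  assumes "Poly_Mapping.keys p \<subseteq> lists h" "Poly_Mapping.keys q \<subseteq> lists h"
  shows "Poly_Mapping.keys (p * q) \<subseteq> lists h"
proof -
  have "a + b \<in> lists h" if "a \<in> lists h" "b \<in> lists h" for a b
    using that by (simp add: plus_list_def)
  then show ?thesis using keys_mult[of p q] assms by blast
qed

lemma keys_letter [simp]: "Poly_Mapping.keys (letter x) = {[x]}"
  by (simp add: letter_def)

lemma zero_in_lists [simp]: "0 \<in> lists h"
  by (simp add: zero_list_def)

lemma ring_free_algebra: "ring (free_algebra h)"
proof (rule ringI)
  show "abelian_group (free_algebra h)"
  proof (rule abelian_groupI)
    fix p assume "p \<in> carrier (free_algebra h)"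
    then have "- p \<in> carrier (free_algebra h)" by (simp add: keys_minus)
    then show "\<exists>q\<in>carrier (free_algebra h). q \<oplus>\<^bsub>free_algebra h\<^esub> p = \<zero>\<^bsub>free_algebra h\<^esub>"
      by (intro bexI[of _ "- p"]) simp_all
  qed (simp_all add: keys_add_lists add.assoc add.commute)
  show "Group.monoid (free_algebra h)"
    by (rule monoidI) (simp_all add: keys_mult_lists mult.assoc)
qed (simp_all add: distrib_left distrib_right)

lemma uea_relations_subset:
  assumes "lie_subalgebra h" shows "uea_relations h \<subseteq> carrier (free_algebra h)"
proof -
  have letter: "Poly_Mapping.keys (letter x) \<subseteq> lists h" if "x \<in> h" for x
    using that by simp
  have diff: "Poly_Mapping.keys (p - q) \<subseteq> lists h"
    if "Poly_Mapping.keys p \<subseteq> lists h" "Poly_Mapping.keys q \<subseteq> lists h"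
    for p q :: "vir list \<Rightarrow>\<^sub>0 complex"
    using that keys_diff_subset[of p q] by blast
  have cscale: "Poly_Mapping.keys (cscale c p) \<subseteq> lists h"
    if "Poly_Mapping.keys p \<subseteq> lists h" for c and p :: "vir list \<Rightarrow>\<^sub>0 complex"
    using that keys_cscale[of c p] by blast
  show ?thesis
  proof
    fix r assume "r \<in> uea_relations h"
    then consider (add) x y where "x \<in> h" "y \<in> h" "r = letter (x + y) - letter x - letter y"
      | (scale) c x where "x \<in> h" "r = letter (cscale c x) - cscale c (letter x)"
      | (bracket) x y where "x \<in> h" "y \<in> h"
          "r = letter x * letter y - letter y * letter x - letter (vbracket x y)"
      unfolding uea_relations_def by blast
    then show "r \<in> carrier (free_algebra h)"
      using assms unfolding lie_subalgebra_def
      by cases (simp_all add: diff letter cscale keys_mult_lists del: keys_letter)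
  qed
qed

lemma ideal_uea_ideal: "lie_subalgebra h \<Longrightarrow> ideal (uea_ideal h) (free_algebra h)"
  unfolding uea_ideal_def
  by (rule ring.genideal_ideal[OF ring_free_algebra uea_relations_subset])

lemma uea_relations_in_ideal: "lie_subalgebra h \<Longrightarrow> uea_relations h \<subseteq> uea_ideal h"
  unfolding uea_ideal_def
  by (rule ring.genideal_self[OF ring_free_algebra uea_relations_subset])

lemma uea_ideal_subset: "lie_subalgebra h \<Longrightarrow> p \<in> uea_ideal h \<Longrightarrow> Poly_Mapping.keys p \<subseteq> lists h"
  using additive_subgroup.a_subset[OF ideal.axioms(1)[OF ideal_uea_ideal]] by fastforce

lemma uea_ideal_add: "lie_subalgebra h \<Longrightarrow> p \<in> uea_ideal h \<Longrightarrow> q \<in> uea_ideal h \<Longrightarrow> p + q \<in> uea_ideal h"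
  using additive_subgroup.a_closed[OF ideal.axioms(1)[OF ideal_uea_ideal]] by fastforce

lemma uea_ideal_zero: "lie_subalgebra h \<Longrightarrow> 0 \<in> uea_ideal h"
  using additive_subgroup.zero_closed[OF ideal.axioms(1)[OF ideal_uea_ideal]] by fastforce

lemma uea_ideal_mult_left:
  "lie_subalgebra h \<Longrightarrow> p \<in> uea_ideal h \<Longrightarrow> Poly_Mapping.keys q \<subseteq> lists h \<Longrightarrow> q * p \<in> uea_ideal h"
  using ideal.I_l_closed[OF ideal_uea_ideal, of h p q] by simp

lemma uea_ideal_mult_right:
  "lie_subalgebra h \<Longrightarrow> p \<in> uea_ideal h \<Longrightarrow> Poly_Mapping.keys q \<subseteq> lists h \<Longrightarrow> p * q \<in> uea_ideal h"
  using ideal.I_r_closed[OF ideal_uea_ideal, of h p q] by simp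

lemma uea_ideal_cscale: "lie_subalgebra h \<Longrightarrow> p \<in> uea_ideal h \<Longrightarrow> cscale c p \<in> uea_ideal h"
  by (subst cscale_conv_mult, rule uea_ideal_mult_left)
    (auto simp: zero_list_def intro!: subset_trans[OF keys_cscale])

lemma uea_ideal_minus: "lie_subalgebra h \<Longrightarrow> p \<in> uea_ideal h \<Longrightarrow> - p \<in> uea_ideal h"
  using uea_ideal_cscale[of h p "- 1"] by simp

lemma uea_ideal_diff: "lie_subalgebra h \<Longrightarrow> p \<in> uea_ideal h \<Longrightarrow> q \<in> uea_ideal h \<Longrightarrow> p - q \<in> uea_ideal h"
  using uea_ideal_add[of h p "- q"] uea_ideal_minus[of h q] by simp

text \<open>
  An ideal of the free algebra is closed under scalar multiples, hence under negation, because the scalars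
  are multiples of the unit; so sums and products suffice.
\<close>
lemma uea_ideal_minimal:
  assumes "lie_subalgebra h" and rel: "uea_relations h \<subseteq> J" and sub: "J \<subseteq> carrier (free_algebra h)"
    and zero: "0 \<in> J" and add: "\<And>p q. p \<in> J \<Longrightarrow> q \<in> J \<Longrightarrow> p + q \<in> J"
    and left: "\<And>p q. p \<in> J \<Longrightarrow> Poly_Mapping.keys q \<subseteq> lists h \<Longrightarrow> q * p \<in> J"
    and right: "\<And>p q. p \<in> J \<Longrightarrow> Poly_Mapping.keys q \<subseteq> lists h \<Longrightarrow> p * q \<in> J"
  shows "uea_ideal h \<subseteq> J"
  unfolding uea_ideal_def
proof (rule ring.genideal_minimal[OF ring_free_algebra _ rel], rule idealI[OF ring_free_algebra])
  have neg: "- p \<in> J" if "p \<in> J" for p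
    using left[OF that, of "- 1"] by (simp add: keys_minus)
  have group: "Group.group (add_monoid (free_algebra h))"
    using ring_free_algebra[of h] by (meson abelian_group.a_group ring.is_abelian_group)
  show "subgroup J (add_monoid (free_algebra h))"
  proof (rule group.subgroupI[OF group])
    fix p assume p: "p \<in> J"
    have "inv\<^bsub>add_monoid (free_algebra h)\<^esub> p = - p"
      by (rule group.inv_equality[OF group]) (use p sub in \<open>auto simp: keys_minus\<close>)
    then show "inv\<^bsub>add_monoid (free_algebra h)\<^esub> p \<in> J" using neg p by simp
  qed (use sub zero add in auto)
qed (use left right in auto)

lemma mem_uea_of: "r \<in> uea_of h s \<longleftrightarrow> r - s \<in> uea_ideal h"
  by (auto simp: uea_of_def a_r_coset_def' intro!: bexI[of _ "r - s"])

lemma uea_of_eq_iff: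
  assumes "lie_subalgebra h" "Poly_Mapping.keys p \<subseteq> lists h" "Poly_Mapping.keys q \<subseteq> lists h"
  shows "uea_of h p = uea_of h q \<longleftrightarrow> p - q \<in> uea_ideal h"
proof -
  show ?thesis
  proof
    assume "uea_of h p = uea_of h q"
    moreover have "p \<in> uea_of h p" by (simp add: mem_uea_of uea_ideal_zero[OF assms(1)])
    ultimately show "p - q \<in> uea_ideal h" by (simp add: mem_uea_of)
  next
    assume pq: "p - q \<in> uea_ideal h"
    have "r - p \<in> uea_ideal h \<longleftrightarrow> r - q \<in> uea_ideal h" for r
      using uea_ideal_add[OF assms(1) _ pq, of "r - p"] uea_ideal_diff[OF assms(1) _ pq, of "r - q"]
      by auto
    then show "uea_of h p = uea_of h q" by (auto simp: mem_uea_of)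
  qed
qed

lemma carrier_uea: "carrier (uea h) = uea_of h ` {p. Poly_Mapping.keys p \<subseteq> lists h}"
  by (auto simp: uea_def FactRing_def uea_of_def A_RCOSETS_def')

lemma uea_of_mult:
  assumes "lie_subalgebra h" "Poly_Mapping.keys p \<subseteq> lists h" "Poly_Mapping.keys q \<subseteq> lists h"
  shows "uea_of h p \<otimes>\<^bsub>uea h\<^esub> uea_of h q = uea_of h (p * q)"
  using ring_hom_mult[OF ideal.rcos_ring_hom[OF ideal_uea_ideal[OF assms(1)]], of p q] assms(2,3)
  by (simp add: uea_def uea_of_def)

lemma uea_of_add:
  assumes "lie_subalgebra h" "Poly_Mapping.keys p \<subseteq> lists h" "Poly_Mapping.keys q \<subseteq> lists h"
  shows "uea_of h p \<oplus>\<^bsub>uea h\<^esub> uea_of h q = uea_of h (p + q)"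
  using ring_hom_add[OF ideal.rcos_ring_hom[OF ideal_uea_ideal[OF assms(1)]], of p q] assms(2,3)
  by (simp add: uea_def uea_of_def)

context lie_module
begin

lemma foldr_act_closed: "ws \<in> lists h \<Longrightarrow> m \<in> carrier M \<Longrightarrow> foldr (act M) ws m \<in> carrier M"
  by (induction ws) (auto intro: act_closed)

lemma act_zero: "x \<in> h \<Longrightarrow> act M x \<zero>\<^bsub>M\<^esub> = \<zero>\<^bsub>M\<^esub>"
  using act_smult[of x "\<zero>\<^bsub>M\<^esub>" 0] act_closed[of x "\<zero>\<^bsub>M\<^esub>"] by simp

lemma act_minus: "x \<in> h \<Longrightarrow> m \<in> carrier M \<Longrightarrow> act M x (\<ominus>\<^bsub>M\<^esub> m) = \<ominus>\<^bsub>M\<^esub> act M x m"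
  using act_smult[of x m "- 1"] act_closed[of x m] by (simp add: smult_minus_one)

lemma act_diff: "x \<in> h \<Longrightarrow> m \<in> carrier M \<Longrightarrow> m' \<in> carrier M \<Longrightarrow>
    act M x (m \<ominus>\<^bsub>M\<^esub> m') = act M x m \<ominus>\<^bsub>M\<^esub> act M x m'"
  by (simp add: a_minus_def act_add act_minus)

lemma foldr_act_add: "ws \<in> lists h \<Longrightarrow> m \<in> carrier M \<Longrightarrow> m' \<in> carrier M \<Longrightarrow>
    foldr (act M) ws (m \<oplus>\<^bsub>M\<^esub> m') = foldr (act M) ws m \<oplus>\<^bsub>M\<^esub> foldr (act M) ws m'"
  by (induction ws) (auto simp: act_add foldr_act_closed)

lemma foldr_act_smult: "ws \<in> lists h \<Longrightarrow> m \<in> carrier M \<Longrightarrow>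
    foldr (act M) ws (c \<odot>\<^bsub>M\<^esub> m) = c \<odot>\<^bsub>M\<^esub> foldr (act M) ws m"
  by (induction ws) (auto simp: act_smult foldr_act_closed)

lemma free_act_conv: "free_act M p m = linear_extension M (\<lambda>ws. foldr (act M) ws m) p"
  by (simp add: free_act_def linear_extension_def)

lemma foldr_act_Pi: "m \<in> carrier M \<Longrightarrow> (\<lambda>ws. foldr (act M) ws m) \<in> lists h \<rightarrow> carrier M"
  using foldr_act_closed by blast

lemma free_act_closed [simp]:
  "Poly_Mapping.keys p \<subseteq> lists h \<Longrightarrow> m \<in> carrier M \<Longrightarrow> free_act M p m \<in> carrier M"
  unfolding free_act_conv using foldr_act_Pi by (intro linear_extension_closed) blast

lemma free_act_zero [simp]: "free_act M 0 m = \<zero>\<^bsub>M\<^esub>"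
  by (simp add: free_act_conv)

lemma free_act_add:
  "Poly_Mapping.keys p \<subseteq> lists h \<Longrightarrow> Poly_Mapping.keys q \<subseteq> lists h \<Longrightarrow> m \<in> carrier M \<Longrightarrow>
    free_act M (p + q) m = free_act M p m \<oplus>\<^bsub>M\<^esub> free_act M q m"
  unfolding free_act_conv by (rule linear_extension_add[OF _ _ foldr_act_Pi])

lemma free_act_cscale:
  "Poly_Mapping.keys p \<subseteq> lists h \<Longrightarrow> m \<in> carrier M \<Longrightarrow>
    free_act M (cscale c p) m = c \<odot>\<^bsub>M\<^esub> free_act M p m"
  unfolding free_act_conv by (rule linear_extension_cscale[OF _ foldr_act_Pi])

lemma free_act_diff:
  "Poly_Mapping.keys p \<subseteq> lists h \<Longrightarrow> Poly_Mapping.keys q \<subseteq> lists h \<Longrightarrow> m \<in> carrier M \<Longrightarrow>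
    free_act M (p - q) m = free_act M p m \<ominus>\<^bsub>M\<^esub> free_act M q m"
  unfolding free_act_conv by (rule linear_extension_diff[OF _ _ foldr_act_Pi])

lemma free_act_single:
  "ws \<in> lists h \<Longrightarrow> m \<in> carrier M \<Longrightarrow>
    free_act M (Poly_Mapping.single ws c) m = c \<odot>\<^bsub>M\<^esub> foldr (act M) ws m"
  unfolding free_act_conv by (rule linear_extension_single) (rule foldr_act_closed)

lemma free_act_letter [simp]:
  "x \<in> h \<Longrightarrow> m \<in> carrier M \<Longrightarrow> free_act M (letter x) m = act M x m"
  by (simp add: letter_def free_act_single act_closed)

lemma free_act_one [simp]: "m \<in> carrier M \<Longrightarrow> free_act M 1 m = m"
  using free_act_single[of "[]" m 1] by (simp add: zero_list_def flip: single_one)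

lemma free_act_add_vector:
  "Poly_Mapping.keys p \<subseteq> lists h \<Longrightarrow> m \<in> carrier M \<Longrightarrow> m' \<in> carrier M \<Longrightarrow>
    free_act M p (m \<oplus>\<^bsub>M\<^esub> m') = free_act M p m \<oplus>\<^bsub>M\<^esub> free_act M p m'"
proof (induction p rule: poly_mapping_linear_induct)
  case (single ws)
  then show ?case by (simp add: free_act_single foldr_act_add foldr_act_closed)
next
  case (add p q)
  then show ?case by (simp add: free_act_add M.a_ac)
next
  case (scale c p)
  then show ?case by (simp add: free_act_cscale smult_add_vector)
qed simp_all

lemma free_act_smult_vector:
  "Poly_Mapping.keys p \<subseteq> lists h \<Longrightarrow> m \<in> carrier M \<Longrightarrow>
    free_act M p (c \<odot>\<^bsub>M\<^esub> m) = c \<odot>\<^bsub>M\<^esub> free_act M p m"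
proof (induction p rule: poly_mapping_linear_induct)
  case (single ws)
  then show ?case by (simp add: free_act_single foldr_act_smult foldr_act_closed)
next
  case (add p q)
  then show ?case by (simp add: free_act_add smult_add_vector)
next
  case (scale c p)
  then show ?case by (simp add: free_act_cscale smult_smult mult.commute)
qed simp_all

lemma free_act_zero_vector [simp]:
  "Poly_Mapping.keys p \<subseteq> lists h \<Longrightarrow> free_act M p \<zero>\<^bsub>M\<^esub> = \<zero>\<^bsub>M\<^esub>"
  using free_act_smult_vector[of p "\<zero>\<^bsub>M\<^esub>" 0] by simp

lemma free_act_mult:
  assumes "Poly_Mapping.keys p \<subseteq> lists h" "Poly_Mapping.keys q \<subseteq> lists h" "m \<in> carrier M"
  shows "free_act M (p * q) m = free_act M p (free_act M q m)"
  using assms(2)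
proof (induction q rule: poly_mapping_linear_induct)
  case q: (single vs)
  show ?case
    using assms(1)
  proof (induction p rule: poly_mapping_linear_induct)
    case (single ws)
    then show ?case using q assms(3)
      by (simp add: mult_single plus_list_def free_act_single foldr_act_closed)
  next
    case (add p p')
    then show ?case using q assms(3)
      by (simp add: distrib_right free_act_add keys_mult_lists)
  next
    case (scale c p)
    then show ?case using q assms(3)
      by (simp add: free_act_cscale keys_mult_lists flip: cscale_mult_left)
  qed (use q assms(3) in simp_all)
next
  case (add q q')
  then show ?case using assms(1,3)
    by (simp add: distrib_left free_act_add free_act_add_vector keys_mult_lists)
next
  case (scale c q)
  then show ?case using assms(1,3)
    by (simp add: cscale_mult_right free_act_cscale free_act_smult_vector keys_mult_lists)
qed (use assms in simp_all)

text \<open>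
  The elements of the free algebra that kill the whole module form an ideal, and it contains the defining relations of the
  enveloping algebra since the module axioms are exactly these relations.
\<close>
lemma free_act_uea_ideal:
  assumes h: "lie_subalgebra h" and p: "p \<in> uea_ideal h" and m: "m \<in> carrier M"
  shows "free_act M p m = \<zero>\<^bsub>M\<^esub>"
proof -
  define J where
    "J = {p. Poly_Mapping.keys p \<subseteq> lists h \<and> (\<forall>m\<in>carrier M. free_act M p m = \<zero>\<^bsub>M\<^esub>)}"
  note closed = h[unfolded lie_subalgebra_def]
  have "uea_ideal h \<subseteq> J"
  proof (rule uea_ideal_minimal[OF h])
    have cs: "Poly_Mapping.keys (cscale c (letter x)) \<subseteq> lists h" if "x \<in> h" for c x
      using keys_cscale[of c "letter x"] that by auto
    have diff: "Poly_Mapping.keys (p - q) \<subseteq> lists h"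
      if "Poly_Mapping.keys p \<subseteq> lists h" "Poly_Mapping.keys q \<subseteq> lists h"
      for p q :: "vir list \<Rightarrow>\<^sub>0 complex"
      using that keys_diff_subset[of p q] by blast
    have "free_act M r m = \<zero>\<^bsub>M\<^esub>" if r: "r \<in> uea_relations h" and m: "m \<in> carrier M" for r m
    proof -
      consider (add) x y where "x \<in> h" "y \<in> h" "r = letter (x + y) - letter x - letter y"
        | (scale) c x where "x \<in> h" "r = letter (cscale c x) - cscale c (letter x)"
        | (bracket) x y where "x \<in> h" "y \<in> h"
            "r = letter x * letter y - letter y * letter x - letter (vbracket x y)"
        using r unfolding uea_relations_def by blast
      then show ?thesis
      proof cases
        case add
        then have "r = letter (x + y) - (letter x + letter y)" by simp
        with add show ?thesis
          using m closed act_closed[of x m] act_closed[of y m] keys_add_lists[of "letter x" "lists h" "letter y"]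
          by (simp add: free_act_diff free_act_add add_act diff_zero_iff)
      next
        case scale
        then show ?thesis
          using m closed cs act_closed[of x m]
          by (simp add: free_act_diff free_act_cscale cscale_act diff_zero_iff)
      next
        case bracket
        then show ?thesis
          using m closed act_closed
          by (simp add: free_act_diff free_act_mult keys_mult_lists diff bracket_act diff_zero_iff)
      qed
    qed
    then show "uea_relations h \<subseteq> J"
      using uea_relations_subset[OF h] unfolding J_def free_algebra_simps by blast
  qed (auto simp: J_def free_act_add keys_add_lists keys_mult_lists free_act_mult intro: subsetD[OF keys_add_lists] subsetD[OF keys_mult_lists])
  with p m show ?thesis by (auto simp: J_def)
qed

lemma uea_act_uea_of:
  assumes h: "lie_subalgebra h" and p: "Poly_Mapping.keys p \<subseteq> lists h" and m: "m \<in> carrier M"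
  shows "uea_act M (uea_of h p) m = free_act M p m"
proof -
  have "free_act M q m = free_act M p m" if "q \<in> uea_of h p" for q
  proof -
    from that have pq: "q - p \<in> uea_ideal h" by (simp add: mem_uea_of)
    have "Poly_Mapping.keys ((q - p) + p) \<subseteq> lists h"
      using p uea_ideal_subset[OF h pq] by (rule keys_add_lists[rotated])
    then have "free_act M q m = free_act M (q - p) m \<oplus>\<^bsub>M\<^esub> free_act M p m"
      using free_act_add[OF uea_ideal_subset[OF h pq] p m] by simp
    then show ?thesis using free_act_uea_ideal[OF h pq m] p m by simp
  qed
  moreover have "p \<in> uea_of h p" by (simp add: mem_uea_of uea_ideal_zero[OF h])
  ultimately have "(\<lambda>p. free_act M p m) ` uea_of h p = {free_act M p m}" by blast
  then show ?thesis by (simp add: uea_act_def)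
qed

end

section \<open>Quotient modules\<close>

definition lie_module_hom :: "'m lie_module \<Rightarrow> 'n lie_module \<Rightarrow> ('m \<Rightarrow> 'n) set"
  where "lie_module_hom M N = {f. f \<in> carrier M \<rightarrow> carrier N \<and>
    (\<forall>m\<in>carrier M. \<forall>m'\<in>carrier M. f (m \<oplus>\<^bsub>M\<^esub> m') = f m \<oplus>\<^bsub>N\<^esub> f m') \<and>
    (\<forall>c. \<forall>m\<in>carrier M. f (c \<odot>\<^bsub>M\<^esub> m) = c \<odot>\<^bsub>N\<^esub> f m) \<and>
    (\<forall>x. \<forall>m\<in>carrier M. f (act M x m) = act N x (f m))}"

text \<open>
  The Lie algebra axioms for the action are not part of this locale: on the free tensor
  space they hold only after passing to the quotient.
\<close>
locale stable_submodule = complex_module M for M :: "'m lie_module" (structure) and N :: "'m set" +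
  assumes submodule_N: "submodule N complex_field M"
    and act_in: "m \<in> carrier M \<Longrightarrow> act M x m \<in> carrier M"
    and act_plus: "m \<in> carrier M \<Longrightarrow> m' \<in> carrier M \<Longrightarrow>
      act M x (m \<oplus> m') = act M x m \<oplus> act M x m'"
    and act_times: "m \<in> carrier M \<Longrightarrow> act M x (c \<odot>\<^bsub>M\<^esub> m) = c \<odot>\<^bsub>M\<^esub> act M x m"
    and act_N: "m \<in> N \<Longrightarrow> act M x m \<in> N"
begin

abbreviation Q :: "'m set lie_module" where "Q \<equiv> quotient_module M N"

definition coset :: "'m \<Rightarrow> 'm set" where "coset m = N +> m"

lemma N_sub: "m \<in> N \<Longrightarrow> m \<in> carrier M"
  using submoduleE(1)[OF submodule_N] by blast

lemma N_smult: "m \<in> N \<Longrightarrow> c \<odot>\<^bsub>M\<^esub> m \<in> N"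
  by (rule submoduleE(4)[OF submodule_N]) auto

lemma N_zero: "\<zero> \<in> N"
  using submoduleE(2)[OF submodule_N] N_smult[of _ 0] N_sub by fastforce

lemma abelian_subgroup_N: "abelian_subgroup N M"
  by (rule abelian_subgroupI3)
    (auto intro: additive_subgroup.intro submodule.axioms(1)[OF submodule_N] M.abelian_group_axioms)

lemma mem_coset: "m \<in> carrier M \<Longrightarrow> m' \<in> coset m \<longleftrightarrow> m' \<in> carrier M \<and> m' \<ominus> m \<in> N"
proof
  assume m: "m \<in> carrier M" and "m' \<in> coset m"
  then obtain n where n: "n \<in> N" "m' = n \<oplus> m" by (auto simp: coset_def a_r_coset_def')
  with m N_sub[OF n(1)] show "m' \<in> carrier M \<and> m' \<ominus> m \<in> N"
    by (simp add: a_minus_def M.a_assoc M.r_neg)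
next
  assume m: "m \<in> carrier M" and m': "m' \<in> carrier M \<and> m' \<ominus> m \<in> N"
  then have "m' = (m' \<ominus> m) \<oplus> m"
    by (simp add: a_minus_def M.a_assoc M.l_neg)
  with m' show "m' \<in> coset m" by (auto simp: coset_def a_r_coset_def')
qed

lemma coset_self: "m \<in> carrier M \<Longrightarrow> m \<in> coset m"
  by (simp add: mem_coset a_minus_def M.r_neg N_zero)

lemma coset_cong: "m \<in> carrier M \<Longrightarrow> m' \<in> coset m \<Longrightarrow> coset m' = coset m"
  using M.a_repr_independence[of m' N m] submodule.axioms(1)[OF submodule_N]
  by (simp add: coset_def)

lemma coset_eq_iff:
  "m \<in> carrier M \<Longrightarrow> m' \<in> carrier M \<Longrightarrow> coset m = coset m' \<longleftrightarrow> m \<ominus> m' \<in> N"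
  using coset_cong[of m' m] coset_self[of m] mem_coset[of m' m] by auto

lemma carrier_Q: "carrier Q = coset ` carrier M"
  by (auto simp: quotient_module_def coset_def A_RCOSETS_def')

lemma zero_Q: "\<zero>\<^bsub>Q\<^esub> = N"
  by (simp add: quotient_module_def)

lemma coset_zero_iff: "m \<in> carrier M \<Longrightarrow> coset m = \<zero>\<^bsub>Q\<^esub> \<longleftrightarrow> m \<in> N"
proof -
  assume m: "m \<in> carrier M"
  have minus_zero: "\<ominus> \<zero> = \<zero>" using M.minus_equality[of \<zero> \<zero>] by simp
  have "coset \<zero> = N"
    by (auto simp: mem_coset a_minus_def N_sub minus_zero)
  with m coset_eq_iff[of m \<zero>] show ?thesis by (simp add: zero_Q a_minus_def minus_zero)
qed

lemma coset_add: "m \<in> carrier M \<Longrightarrow> m' \<in> carrier M \<Longrightarrow> coset m \<oplus>\<^bsub>Q\<^esub> coset m' = coset (m \<oplus> m')"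
  using abelian_subgroup.a_rcos_sum[OF abelian_subgroup_N] by (simp add: quotient_module_def coset_def)

text \<open>
  The operations of the quotient are unions over the elements of a coset. For a map that preserves the
  submodule, all members of such a union agree.
\<close>
lemma coset_union:
  assumes m: "m \<in> carrier M" and f: "\<And>m. m \<in> carrier M \<Longrightarrow> f m \<in> carrier M"
    and diff: "\<And>m m'. m \<in> carrier M \<Longrightarrow> m' \<in> carrier M \<Longrightarrow> f (m \<ominus> m') = f m \<ominus> f m'"
    and f_N: "\<And>m. m \<in> N \<Longrightarrow> f m \<in> N"
  shows "(\<Union>a\<in>coset m. N +> f a) = coset (f m)"
proof -
  have "coset (f a) = coset (f m)" if "a \<in> coset m" for a
    using that m f diff[of a m] f_N[of "a \<ominus> m"] by (simp add: mem_coset coset_eq_iff)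
  with coset_self[OF m] show ?thesis unfolding coset_def by blast
qed

lemma act_minus': "m \<in> carrier M \<Longrightarrow> act M x (\<ominus> m) = \<ominus> act M x m"
  using act_times[of m x "- 1"] act_in[of m x] by (simp add: smult_minus_one)

lemma act_diff': "m \<in> carrier M \<Longrightarrow> m' \<in> carrier M \<Longrightarrow> act M x (m \<ominus> m') = act M x m \<ominus> act M x m'"
  by (simp add: a_minus_def act_plus act_minus')

lemma coset_smult: "m \<in> carrier M \<Longrightarrow> c \<odot>\<^bsub>Q\<^esub> coset m = coset (c \<odot>\<^bsub>M\<^esub> m)"
  unfolding quotient_module_def
  using coset_union[of m "\<lambda>m. c \<odot>\<^bsub>M\<^esub> m"] by (simp add: smult_diff_vector N_smult)

lemma coset_act: "m \<in> carrier M \<Longrightarrow> act Q x (coset m) = coset (act M x m)"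
  unfolding quotient_module_def
  using coset_union[of m "act M x"] by (simp add: act_diff' act_in act_N)

lemma module_Q: "module complex_field Q"
proof (rule moduleI)
  show "cring complex_field" ..
  show "abelian_group Q"
  proof (rule abelian_groupI)
    show "\<zero>\<^bsub>Q\<^esub> \<in> carrier Q"
      using coset_zero_iff[of \<zero>] N_zero by (force simp: carrier_Q)
    fix x assume "x \<in> carrier Q"
    then obtain a where a: "a \<in> carrier M" "x = coset a" by (auto simp: carrier_Q)
    have zero: "\<zero>\<^bsub>Q\<^esub> = coset \<zero>" using coset_zero_iff[of \<zero>] N_zero by simp
    show "\<zero>\<^bsub>Q\<^esub> \<oplus>\<^bsub>Q\<^esub> x = x" using a by (simp add: zero coset_add)
    show "\<exists>y\<in>carrier Q. y \<oplus>\<^bsub>Q\<^esub> x = \<zero>\<^bsub>Q\<^esub>"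
      using a by (intro bexI[of _ "coset (\<ominus> a)"]) (auto simp: zero coset_add M.l_neg carrier_Q)
  qed (auto simp: carrier_Q coset_add M.a_ac)
qed (auto simp: carrier_Q coset_smult coset_add smult_add_scalar smult_add_vector smult_smult)

lemma coset_diff:
  assumes "m \<in> carrier M" "m' \<in> carrier M"
  shows "coset m \<ominus>\<^bsub>Q\<^esub> coset m' = coset (m \<ominus> m')"
proof -
  interpret Q: complex_module Q by (intro complex_module.intro module_Q)
  have "coset m' \<in> carrier Q" using assms by (simp add: carrier_Q)
  then have "\<ominus>\<^bsub>Q\<^esub> coset m' = coset (\<ominus> m')"
    using assms by (simp add: coset_smult flip: Q.smult_minus_one smult_minus_one)
  then show ?thesis using assms by (simp add: a_minus_def coset_add)
qed

lemma lie_module_Q: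
  assumes "\<And>x y m. m \<in> carrier M \<Longrightarrow> act M (x + y) m \<ominus> (act M x m \<oplus> act M y m) \<in> N"
    and "\<And>c x m. m \<in> carrier M \<Longrightarrow> act M (cscale c x) m \<ominus> c \<odot>\<^bsub>M\<^esub> act M x m \<in> N"
    and "\<And>x y m. m \<in> carrier M \<Longrightarrow>
      act M (vbracket x y) m \<ominus> (act M x (act M y m) \<ominus> act M y (act M x m)) \<in> N"
  shows "lie_module UNIV Q"
proof (intro lie_module.intro lie_module_axioms.intro module_Q)
  fix x y :: vir and m assume "m \<in> carrier Q"
  then obtain a where a: "a \<in> carrier M" "m = coset a" by (auto simp: carrier_Q)
  then show "act Q (vbracket x y) m = act Q x (act Q y m) \<ominus>\<^bsub>Q\<^esub> act Q y (act Q x m)"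
    using assms(3)[of a x y] by (simp add: coset_act act_in coset_diff coset_eq_iff)
  from a show "act Q (x + y) m = act Q x m \<oplus>\<^bsub>Q\<^esub> act Q y m"
    using assms(1)[of a x y] by (simp add: coset_act act_in coset_add coset_eq_iff)
  from a show "act Q (cscale c x) m = c \<odot>\<^bsub>Q\<^esub> act Q x m" for c
    using assms(2)[of a c x] by (simp add: coset_act act_in coset_smult coset_eq_iff)
qed (auto simp: carrier_Q coset_act coset_add coset_smult act_in act_plus act_times)

lemma coset_hom: "coset \<in> lie_module_hom M Q"
  by (auto simp: lie_module_hom_def carrier_Q coset_add coset_smult coset_act)

lemma quotient_universal:
  assumes S: "complex_module S" and f: "f \<in> lie_module_hom M S"
    and f_N: "\<And>m. m \<in> N \<Longrightarrow> f m = \<zero>\<^bsub>S\<^esub>"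
  shows "\<exists>g\<in>lie_module_hom Q S. \<forall>m\<in>carrier M. g (coset m) = f m"
proof -
  interpret S: complex_module S by fact
  note hom = f[unfolded lie_module_hom_def mem_Collect_eq]
  have eq: "f m = f m'" if "m \<in> carrier M" "m' \<in> carrier M" "coset m = coset m'" for m m'
  proof -
    have "m \<ominus> m' \<in> N" using that coset_eq_iff by blast
    then have "f ((m \<ominus> m') \<oplus> m') = \<zero>\<^bsub>S\<^esub> \<oplus>\<^bsub>S\<^esub> f m'"
      using hom that f_N by simp
    moreover have "(m \<ominus> m') \<oplus> m' = m" using that by (simp add: a_minus_def M.a_assoc M.l_neg)
    moreover have "f m' \<in> carrier S" using hom that by blast
    ultimately show ?thesis by simp
  qed
  define g where "g A = f (SOME m. m \<in> carrier M \<and> coset m = A)" for A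
  have g: "g (coset m) = f m" if "m \<in> carrier M" for m
  proof -
    have "(SOME m'. m' \<in> carrier M \<and> coset m' = coset m) \<in> carrier M \<and>
        coset (SOME m'. m' \<in> carrier M \<and> coset m' = coset m) = coset m"
      by (rule someI[of _ m]) (simp add: that)
    then show ?thesis unfolding g_def using eq that by blast
  qed
  have "g \<in> lie_module_hom Q S"
    using hom by (auto simp: lie_module_hom_def carrier_Q coset_add coset_smult coset_act act_in g)
  with g show ?thesis by blast
qed

end

section \<open>Induced modules\<close>

abbreviation ptensor :: "(vir list \<Rightarrow>\<^sub>0 complex) \<Rightarrow> 'n \<Rightarrow> (uea_elem \<times> 'n \<Rightarrow>\<^sub>0 complex)"
  where "ptensor p v \<equiv> pure_tensor (uea_of UNIV p) v"

lemma carrier_uea_UNIV: "carrier (uea UNIV) = range (uea_of UNIV)"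
  by (simp add: carrier_uea)

lemmas uea_of_mult_UNIV = uea_of_mult[OF lie_subalgebra_UNIV, simplified]
  and uea_of_add_UNIV = uea_of_add[OF lie_subalgebra_UNIV, simplified]

lemma uea_smult_UNIV: "uea_smult UNIV c (uea_of UNIV p) = uea_of UNIV (cscale c p)"
  by (simp add: uea_smult_def uea_of_mult_UNIV flip: cscale_conv_mult)

lemma uea_ideal_mono: assumes h: "lie_subalgebra h" shows "uea_ideal h \<subseteq> uea_ideal UNIV"
proof -
  have "uea_ideal h \<subseteq> uea_ideal UNIV \<inter> carrier (free_algebra h)"
  proof (rule uea_ideal_minimal[OF h])
    have "uea_relations h \<subseteq> uea_relations UNIV"
      unfolding uea_relations_def by blast
    then show "uea_relations h \<subseteq> uea_ideal UNIV \<inter> carrier (free_algebra h)"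
      using uea_relations_in_ideal[OF lie_subalgebra_UNIV] uea_relations_subset[OF h] by blast
  qed (simp_all add: uea_ideal_zero uea_ideal_add lie_subalgebra_UNIV uea_ideal_mult_left
      uea_ideal_mult_right keys_add_lists keys_mult_lists)
  then show ?thesis by blast
qed

lemma uea_incl_uea_of:
  assumes h: "lie_subalgebra h" and p: "Poly_Mapping.keys p \<subseteq> lists h"
  shows "uea_incl (uea_of h p) = uea_of UNIV p"
proof -
  have "uea_of UNIV q = uea_of UNIV p" if "q \<in> uea_of h p" for q
    using that uea_ideal_mono[OF h] by (auto simp: mem_uea_of uea_of_eq_iff[OF lie_subalgebra_UNIV])
  moreover have "p \<in> uea_of h p" by (simp add: mem_uea_of uea_ideal_zero[OF h])
  ultimately show ?thesis unfolding uea_incl_def by blast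
qed

lemma free_tensor_simps [simp]:
  "ring.zero (free_tensor N) = 0" "add (free_tensor N) = (+)" "module.smult (free_tensor N) = cscale"
  by (simp_all add: free_tensor_def)

lemma carrier_free_tensor:
  "carrier (free_tensor N) = {t. Poly_Mapping.keys t \<subseteq> carrier (uea UNIV) \<times> carrier N}"
  by (simp add: free_tensor_def)

lemma act_free_tensor:
  "act (free_tensor N) x t = (\<Sum>b\<in>Poly_Mapping.keys t. cscale (Poly_Mapping.lookup t b)
    (pure_tensor (uea_of UNIV (letter x) \<otimes>\<^bsub>uea UNIV\<^esub> fst b) (snd b)))"
  by (simp add: free_tensor_def case_prod_beta)

lemma sum_keys_add:
  fixes s t :: "'b \<Rightarrow>\<^sub>0 complex"
  shows "(\<Sum>b\<in>Poly_Mapping.keys (s + t). cscale (Poly_Mapping.lookup (s + t) b) (f b))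
    = (\<Sum>b\<in>Poly_Mapping.keys s. cscale (Poly_Mapping.lookup s b) (f b))
      + (\<Sum>b\<in>Poly_Mapping.keys t. cscale (Poly_Mapping.lookup t b) (f b))"
proof -
  let ?K = "Poly_Mapping.keys s \<union> Poly_Mapping.keys t"
  have *: "(\<Sum>b\<in>Poly_Mapping.keys r. cscale (Poly_Mapping.lookup r b) (f b))
      = (\<Sum>b\<in>?K. cscale (Poly_Mapping.lookup r b) (f b))" if "Poly_Mapping.keys r \<subseteq> ?K" for r
    using that by (intro sum.mono_neutral_left) (auto simp: in_keys_iff)
  show ?thesis
    using *[OF keys_add] *[of s] *[of t]
    by (simp add: lookup_add cscale.scale_left_distrib sum.distrib)
qed

lemma sum_keys_cscale:
  fixes t :: "'b \<Rightarrow>\<^sub>0 complex"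
  shows "(\<Sum>b\<in>Poly_Mapping.keys (cscale c t). cscale (Poly_Mapping.lookup (cscale c t) b) (f b))
    = cscale c (\<Sum>b\<in>Poly_Mapping.keys t. cscale (Poly_Mapping.lookup t b) (f b))"
proof -
  have "(\<Sum>b\<in>Poly_Mapping.keys (cscale c t). cscale (Poly_Mapping.lookup (cscale c t) b) (f b))
      = (\<Sum>b\<in>Poly_Mapping.keys t. cscale (Poly_Mapping.lookup (cscale c t) b) (f b))"
    using keys_cscale[of c t] by (intro sum.mono_neutral_left) (auto simp: in_keys_iff)
  then show ?thesis by (simp add: cscale.scale_sum_right)
qed

lemma act_free_tensor_linear: "module_hom cscale cscale (act (free_tensor N) x)"
proof (intro module_hom.intro module_hom_axioms.intro cscale.module_axioms)
  fix s t show "act (free_tensor N) x (s + t) = act (free_tensor N) x s + act (free_tensor N) x t"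
    unfolding act_free_tensor by (rule sum_keys_add)
next
  fix c t show "act (free_tensor N) x (cscale c t) = cscale c (act (free_tensor N) x t)"
    unfolding act_free_tensor by (rule sum_keys_cscale)
qed

lemma act_ptensor [simp]: "act (free_tensor N) x (ptensor p v) = ptensor (letter x * p) v"
  by (simp add: act_free_tensor pure_tensor_def uea_of_mult_UNIV)

lemma ptensor_carrier: "v \<in> carrier N \<Longrightarrow> ptensor p v \<in> carrier (free_tensor N)"
  by (simp add: carrier_free_tensor pure_tensor_def carrier_uea_UNIV)

lemma free_tensor_induct [consumes 1, case_names zero ptensor add scale]:
  assumes "t \<in> carrier (free_tensor N)" "Q 0"
    and "\<And>p v. v \<in> carrier N \<Longrightarrow> Q (ptensor p v)"
    and "\<And>s t. s \<in> carrier (free_tensor N) \<Longrightarrow> t \<in> carrier (free_tensor N) \<Longrightarrow> Q s \<Longrightarrow> Q t \<Longrightarrow> Q (s + t)"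
    and "\<And>c t. t \<in> carrier (free_tensor N) \<Longrightarrow> Q t \<Longrightarrow> Q (cscale c t)"
  shows "Q t"
  using assms(1)[unfolded carrier_free_tensor mem_Collect_eq]
proof (induction t rule: poly_mapping_linear_induct)
  case (single b)
  then obtain p v where "b = (uea_of UNIV p, v)" "v \<in> carrier N" by (auto simp: carrier_uea_UNIV)
  with assms(3)[of v p] show ?case by (simp add: pure_tensor_def)
qed (use assms(2,4,5) in \<open>auto simp: carrier_free_tensor\<close>)

lemma complex_module_free_tensor: "complex_module (free_tensor N)"
proof (intro complex_module.intro moduleI)
  show "cring complex_field" by (rule comm_ring_1_class.cring_from_type_algebra)
  show "abelian_group (free_tensor N)"
  proof (rule abelian_groupI)
    fix t assume "t \<in> carrier (free_tensor N)"
    then show "\<exists>s\<in>carrier (free_tensor N). s \<oplus>\<^bsub>free_tensor N\<^esub> t = \<zero>\<^bsub>free_tensor N\<^esub>"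
      by (intro bexI[of _ "- t"]) (simp_all add: carrier_free_tensor keys_minus)
  qed (simp_all add: carrier_free_tensor keys_add_lists add.assoc add.commute)
qed (simp_all add: carrier_free_tensor subset_trans[OF keys_cscale] cscale.scale_left_distrib cscale.scale_right_distrib)

lemma free_tensor_minus:
  assumes "s \<in> carrier (free_tensor N)" "t \<in> carrier (free_tensor N)"
  shows "s \<ominus>\<^bsub>free_tensor N\<^esub> t = s - t"
proof -
  interpret complex_module "free_tensor N" by (rule complex_module_free_tensor)
  show ?thesis using smult_minus_one[OF assms(2)] by (simp add: a_minus_def)
qed

lemma subspace_free_tensor: "cscale.subspace (carrier (free_tensor N))"
  unfolding cscale.subspace_def carrier_free_tensor
  by (simp add: keys_add_lists subset_trans[OF keys_cscale])

context
  fixes h :: "vir set" and N :: "'n lie_module"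
  assumes h: "lie_subalgebra h" and N: "lie_module h N"
begin

interpretation N: lie_module h N by (fact N)

text \<open>Every element of the enveloping algebra is the class of a noncommutative polynomial; this rewrites the tensor relations in terms of representatives.\<close>
lemma tensor_relations_ptensor:
  "tensor_relations h N =
    {ptensor (p + q) v - ptensor p v - ptensor q v |p q v. v \<in> carrier N} \<union>
    {ptensor p (v \<oplus>\<^bsub>N\<^esub> v') - ptensor p v - ptensor p v' |p v v'. v \<in> carrier N \<and> v' \<in> carrier N} \<union>
    {ptensor (cscale c p) v - cscale c (ptensor p v) |c p v. v \<in> carrier N} \<union>
    {ptensor p (c \<odot>\<^bsub>N\<^esub> v) - cscale c (ptensor p v) |c p v. v \<in> carrier N} \<union>
    {ptensor (p * q) v - ptensor p (free_act N q v) |p q v. Poly_Mapping.keys q \<subseteq> lists h \<and> v \<in> carrier N}"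
proof -
  have 1: "{pure_tensor (u \<oplus>\<^bsub>uea UNIV\<^esub> u') v - pure_tensor u v - pure_tensor u' v |u u' v.
       u \<in> carrier (uea UNIV) \<and> u' \<in> carrier (uea UNIV) \<and> v \<in> carrier N}
     = {ptensor (p + q) v - ptensor p v - ptensor q v |p q v. v \<in> carrier N}"
    unfolding carrier_uea_UNIV by (force simp: uea_of_add_UNIV)
  have 2: "{pure_tensor u (v \<oplus>\<^bsub>N\<^esub> v') - pure_tensor u v - pure_tensor u v' |u v v'.
       u \<in> carrier (uea UNIV) \<and> v \<in> carrier N \<and> v' \<in> carrier N}
     = {ptensor p (v \<oplus>\<^bsub>N\<^esub> v') - ptensor p v - ptensor p v' |p v v'. v \<in> carrier N \<and> v' \<in> carrier N}"
    unfolding carrier_uea_UNIV by blast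
  have 3: "{pure_tensor (uea_smult UNIV c u) v - cscale c (pure_tensor u v) |c u v.
       u \<in> carrier (uea UNIV) \<and> v \<in> carrier N}
     = {ptensor (cscale c p) v - cscale c (ptensor p v) |c p v. v \<in> carrier N}"
    unfolding carrier_uea_UNIV by (force simp: uea_smult_UNIV)
  have 4: "{pure_tensor u (c \<odot>\<^bsub>N\<^esub> v) - cscale c (pure_tensor u v) |c u v.
       u \<in> carrier (uea UNIV) \<and> v \<in> carrier N}
     = {ptensor p (c \<odot>\<^bsub>N\<^esub> v) - cscale c (ptensor p v) |c p v. v \<in> carrier N}"
    unfolding carrier_uea_UNIV by blast
  have 5: "pure_tensor (uea_of UNIV p \<otimes>\<^bsub>uea UNIV\<^esub> uea_incl (uea_of h q)) v
      - pure_tensor (uea_of UNIV p) (uea_act N (uea_of h q) v) = ptensor (p * q) v - ptensor p (free_act N q v)"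
    if "Poly_Mapping.keys q \<subseteq> lists h" "v \<in> carrier N" for p q v
    using that by (simp add: uea_incl_uea_of[OF h] uea_of_mult_UNIV N.uea_act_uea_of[OF h])
  have 6: "{pure_tensor (u \<otimes>\<^bsub>uea UNIV\<^esub> uea_incl r) v - pure_tensor u (uea_act N r v) |u r v.
       u \<in> carrier (uea UNIV) \<and> r \<in> carrier (uea h) \<and> v \<in> carrier N}
     = {ptensor (p * q) v - ptensor p (free_act N q v) |p q v. Poly_Mapping.keys q \<subseteq> lists h \<and> v \<in> carrier N}"
    (is "?A = ?B")
  proof
    show "?A \<subseteq> ?B" using 5 unfolding carrier_uea_UNIV carrier_uea[of h] by blast
    show "?B \<subseteq> ?A"
    proof
      fix t assume "t \<in> ?B"
      then obtain p q v where "Poly_Mapping.keys q \<subseteq> lists h" "v \<in> carrier N"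
        "t = ptensor (p * q) v - ptensor p (free_act N q v)" by blast
      with 5[of q v p] show "t \<in> ?A"
        unfolding carrier_uea_UNIV carrier_uea[of h] mem_Collect_eq
        by (intro exI[of _ "uea_of UNIV p"] exI[of _ "uea_of h q"] exI[of _ v]) auto
    qed
  qed
  show ?thesis unfolding tensor_relations_def 1 2 3 4 6 by (rule refl)
qed

abbreviation Rel :: "(uea_elem \<times> 'n \<Rightarrow>\<^sub>0 complex) set"
  where "Rel \<equiv> module.span cscale (tensor_relations h N)"

lemma Rel_subspace: "cscale.subspace Rel"
  by (rule cscale.subspace_span)

text \<open>The universal property of the tensor product, in the form used below: a subspace that contains the five kinds of relations contains their span.\<close>
lemma Rel_minimal:
  assumes "cscale.subspace Y"
    and "\<And>p q v. v \<in> carrier N \<Longrightarrow> ptensor (p + q) v - ptensor p v - ptensor q v \<in> Y"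
    and "\<And>p v v'. v \<in> carrier N \<Longrightarrow> v' \<in> carrier N \<Longrightarrow>
      ptensor p (v \<oplus>\<^bsub>N\<^esub> v') - ptensor p v - ptensor p v' \<in> Y"
    and "\<And>c p v. v \<in> carrier N \<Longrightarrow> ptensor (cscale c p) v - cscale c (ptensor p v) \<in> Y"
    and "\<And>c p v. v \<in> carrier N \<Longrightarrow> ptensor p (c \<odot>\<^bsub>N\<^esub> v) - cscale c (ptensor p v) \<in> Y"
    and "\<And>p q v. v \<in> carrier N \<Longrightarrow> Poly_Mapping.keys q \<subseteq> lists h \<Longrightarrow>
      ptensor (p * q) v - ptensor p (free_act N q v) \<in> Y"
  shows "Rel \<subseteq> Y"
  by (rule cscale.span_minimal[OF _ assms(1)], unfold tensor_relations_ptensor) (intro Un_least subsetI; elim CollectE exE conjE; simp add: assms(2-6))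

lemma Rel_relations:
  "v \<in> carrier N \<Longrightarrow> ptensor (p + q) v - ptensor p v - ptensor q v \<in> Rel"
  "v \<in> carrier N \<Longrightarrow> v' \<in> carrier N \<Longrightarrow> ptensor p (v \<oplus>\<^bsub>N\<^esub> v') - ptensor p v - ptensor p v' \<in> Rel"
  "v \<in> carrier N \<Longrightarrow> ptensor (cscale c p) v - cscale c (ptensor p v) \<in> Rel"
  "v \<in> carrier N \<Longrightarrow> ptensor p (c \<odot>\<^bsub>N\<^esub> v) - cscale c (ptensor p v) \<in> Rel"
  "v \<in> carrier N \<Longrightarrow> Poly_Mapping.keys q \<subseteq> lists h \<Longrightarrow> ptensor (p * q) v - ptensor p (free_act N q v) \<in> Rel"
  by (rule cscale.span_base, subst tensor_relations_ptensor, blast)+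

lemma Rel_sub_carrier: "Rel \<subseteq> carrier (free_tensor N)"
  by (rule Rel_minimal[OF subspace_free_tensor])
    (simp_all add: cscale.subspace_diff[OF subspace_free_tensor] cscale.subspace_scale[OF subspace_free_tensor]
      ptensor_carrier)

lemma act_Rel: assumes "t \<in> Rel" shows "act (free_tensor N) x t \<in> Rel"
proof -
  note linear = module_hom.diff[OF act_free_tensor_linear] module_hom.scale[OF act_free_tensor_linear]
  have "cscale.subspace (act (free_tensor N) x -` Rel)"
    by (rule module_hom.subspace_vimage[OF act_free_tensor_linear Rel_subspace])
  then have "Rel \<subseteq> act (free_tensor N) x -` Rel"
  proof (rule Rel_minimal)
    fix p q :: "vir list \<Rightarrow>\<^sub>0 complex" and v assume v: "v \<in> carrier N" and q: "Poly_Mapping.keys q \<subseteq> lists h"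
    show "ptensor (p * q) v - ptensor p (free_act N q v) \<in> act (free_tensor N) x -` Rel"
      using Rel_relations(5)[OF v q, of "letter x * p"] by (simp add: linear mult.assoc)
  qed (simp_all add: linear Rel_relations(1-4) distrib_left cscale_mult_right)
  with assms show ?thesis by blast
qed

lemma stable_submodule_Rel: "stable_submodule (free_tensor N) Rel"
proof -
  interpret T: complex_module "free_tensor N" by (rule complex_module_free_tensor)
  note linear = module_hom.add[OF act_free_tensor_linear] module_hom.scale[OF act_free_tensor_linear]
    module_hom.zero[OF act_free_tensor_linear]
  show ?thesis
  proof (intro stable_submodule.intro stable_submodule_axioms.intro T.submoduleI)
    show "complex_module (free_tensor N)" ..
    fix t assume t: "t \<in> Rel"
    then have "\<ominus>\<^bsub>free_tensor N\<^esub> t = - t"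
      using T.smult_minus_one[of t] Rel_sub_carrier by auto
    with t show "\<ominus>\<^bsub>free_tensor N\<^esub> t \<in> Rel"
      using cscale.subspace_neg[OF Rel_subspace] by simp
  next
    fix t x assume "t \<in> carrier (free_tensor N)"
    then show "act (free_tensor N) x t \<in> carrier (free_tensor N)"
      by (induction rule: free_tensor_induct)
        (simp_all add: linear ptensor_carrier T.smult_in[simplified] cscale.subspace_0[OF subspace_free_tensor]
          cscale.subspace_add[OF subspace_free_tensor] cscale.subspace_scale[OF subspace_free_tensor])
  qed (use Rel_sub_carrier in \<open>auto simp: linear act_Rel intro: cscale.subspace_0[OF Rel_subspace]
      cscale.subspace_add[OF Rel_subspace] cscale.subspace_scale[OF Rel_subspace]\<close>)
qed

text \<open>
  On pure tensors \<open>x\<close> acts by left multiplication, so the three axioms that fail on the free tensor space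
  follow from the relations of the enveloping algebra together with the linearity of the
  tensor product in its left factor.
\<close>
lemma lie_module_induced: "lie_module UNIV (induced_module h N)"
proof -
  interpret T: stable_submodule "free_tensor N" Rel by (rule stable_submodule_Rel)
  let ?a = "act (free_tensor N)"
  note linear = module_hom.add[OF act_free_tensor_linear] module_hom.scale[OF act_free_tensor_linear]
    module_hom.zero[OF act_free_tensor_linear]
  have diff: "s \<ominus>\<^bsub>free_tensor N\<^esub> t = s - t"
    if "s \<in> carrier (free_tensor N)" "t \<in> carrier (free_tensor N)" for s t
    using that by (rule free_tensor_minus)
  note closed = T.act_in T.M.a_closed[simplified] T.smult_in[simplified]
    cscale.subspace_diff[OF subspace_free_tensor]
  have ideal: "ptensor p v = ptensor q v" if "p - q \<in> uea_ideal UNIV" for p q v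
    using that uea_of_eq_iff[OF lie_subalgebra_UNIV, of p q] by simp
  have rel: "r * p \<in> uea_ideal UNIV" if "r \<in> uea_relations UNIV" for r p
    using that uea_relations_in_ideal[OF lie_subalgebra_UNIV]
    by (intro uea_ideal_mult_right[OF lie_subalgebra_UNIV]) auto
  have add: "?a (x + y) t - (?a x t + ?a y t) \<in> Rel" if "t \<in> carrier (free_tensor N)" for x y t
    using that
  proof (induction rule: free_tensor_induct)
    case (ptensor p v)
    have "(letter (x + y) - letter x - letter y) * p \<in> uea_ideal UNIV"
      by (rule rel) (auto simp: uea_relations_def)
    then have "ptensor (letter (x + y) * p) v = ptensor (letter x * p + letter y * p) v"
      by (intro ideal) (simp add: algebra_simps)
    with Rel_relations(1)[OF ptensor, of "letter x * p" "letter y * p"] show ?case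
      by (simp add: algebra_simps)
  next
    case (add s t)
    from cscale.subspace_add[OF Rel_subspace add(3,4)] show ?case by (simp add: linear algebra_simps)
  next
    case (scale c t)
    from cscale.subspace_scale[OF Rel_subspace scale(2), of c] show ?case
      by (simp add: linear cscale.scale_right_distrib cscale.scale_right_diff_distrib)
  qed (simp add: linear cscale.subspace_0[OF Rel_subspace])
  have scale: "?a (cscale c x) t - cscale c (?a x t) \<in> Rel" if "t \<in> carrier (free_tensor N)" for c x t
    using that
  proof (induction rule: free_tensor_induct)
    case (ptensor p v)
    have "(letter (cscale c x) - cscale c (letter x)) * p \<in> uea_ideal UNIV"
      by (rule rel) (auto simp: uea_relations_def)
    then have "ptensor (letter (cscale c x) * p) v = ptensor (cscale c (letter x * p)) v"
      by (intro ideal) (simp add: cscale_mult_left algebra_simps)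
    with Rel_relations(3)[OF ptensor, of c "letter x * p"] show ?case
      by simp
  next
    case (add s t)
    from cscale.subspace_add[OF Rel_subspace add(3,4)] show ?case
      by (simp add: linear cscale.scale_right_distrib algebra_simps)
  next
    case (scale d t)
    from cscale.subspace_scale[OF Rel_subspace scale(2), of d] show ?case
      by (simp add: linear cscale.scale_right_diff_distrib mult.commute)
  qed (simp add: linear cscale.subspace_0[OF Rel_subspace])
  have bracket: "?a (vbracket x y) t - (?a x (?a y t) - ?a y (?a x t)) \<in> Rel"
    if "t \<in> carrier (free_tensor N)" for x y t
    using that
  proof (induction rule: free_tensor_induct)
    case (ptensor p v)
    have "(letter x * letter y - letter y * letter x - letter (vbracket x y)) * p \<in> uea_ideal UNIV"
      by (rule rel) (auto simp: uea_relations_def)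
    then have "ptensor (letter x * letter y * p) v
        = ptensor (letter (vbracket x y) * p + letter y * letter x * p) v"
      by (intro ideal) (simp add: algebra_simps)
    with cscale.subspace_neg[OF Rel_subspace Rel_relations(1)[OF ptensor, of "letter (vbracket x y) * p" "letter y * letter x * p"]]
    have "ptensor (letter (vbracket x y) * p) v + ptensor (letter y * letter x * p) v
      - ptensor (letter x * letter y * p) v \<in> Rel"
      by (simp add: algebra_simps)
    then show ?case by (simp add: algebra_simps)
  next
    case (add s t)
    from cscale.subspace_add[OF Rel_subspace add(3,4)] show ?case
      by (simp add: linear algebra_simps)
  next
    case (scale d t)
    from cscale.subspace_scale[OF Rel_subspace scale(2), of d] show ?case
      by (simp add: linear cscale.scale_right_diff_distrib)
  qed (simp add: linear cscale.subspace_0[OF Rel_subspace])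
  show ?thesis
    unfolding induced_module_def
    by (rule T.lie_module_Q) (use add scale bracket in \<open>simp_all add: diff closed\<close>)
qed

end

section \<open>The positive part and its characters\<close>

lemma vd_in_nplus: "1 \<le> k \<Longrightarrow> vd k \<in> nplus"
  unfolding nplus_def by (rule cscale.span_base) auto

lemma vbracket_vd: "vbracket (vd k) (vd j) = basis_bracket (D_sym k) (D_sym j)"
  by (simp add: vbracket_def vd_def)

lemma vbracket_vz: "vbracket x vz = 0"
  by (simp add: vbracket_def vz_def)

lemma keys_nplus: assumes "x \<in> nplus" shows "Poly_Mapping.keys x \<subseteq> D_sym ` {1..}"
proof -
  have "cscale.subspace {x. Poly_Mapping.keys x \<subseteq> D_sym ` {1..}}"
    unfolding cscale.subspace_def by (simp add: keys_add_lists subset_trans[OF keys_cscale])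
  then have "nplus \<subseteq> {x. Poly_Mapping.keys x \<subseteq> D_sym ` {1..}}"
    unfolding nplus_def by (rule cscale.span_minimal[rotated]) (auto simp: vd_def)
  with assms show ?thesis by blast
qed

lemma lie_subalgebra_nplus: "lie_subalgebra nplus"
proof -
  have sub: "cscale.subspace nplus" unfolding nplus_def by (rule cscale.subspace_span)
  have "vbracket x y \<in> nplus" if x: "x \<in> nplus" and y: "y \<in> nplus" for x y
    unfolding vbracket_def
  proof (intro cscale.subspace_sum[OF sub] cscale.subspace_scale[OF sub])
    fix a b assume "a \<in> Poly_Mapping.keys x" "b \<in> Poly_Mapping.keys y"
    then have "a \<in> D_sym ` {1..}" "b \<in> D_sym ` {1..}"
      using keys_nplus[OF x] keys_nplus[OF y] by blast+
    then obtain k j where "a = D_sym k" "b = D_sym j" "1 \<le> k" "1 \<le> j"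
      by auto
    then show "basis_bracket a b \<in> nplus"
      by (auto intro!: cscale.subspace_scale[OF sub] vd_in_nplus)
  qed
  then show ?thesis
    unfolding lie_subalgebra_def
    using cscale.subspace_add[OF sub] cscale.subspace_scale[OF sub] by blast
qed

text \<open>The bracket \<open>[d_1, d_(k-1)] = (k - 2) d_k\<close> shows that a nonzero multiple of \<open>d_k\<close> is a commutator, and a character vanishes on commutators.\<close>
lemma psi_vd_high:
  assumes "lie_hom_to_complex nplus \<psi>" "3 \<le> k"
  shows "\<psi> (vd k) = 0"
proof -
  have "vbracket (vd 1) (vd (k - 1)) = cscale (of_int (k - 2)) (vd k)"
    using assms(2) by (simp add: vbracket_vd)
  moreover have "\<psi> (vbracket (vd 1) (vd (k - 1))) = 0"
    using assms vd_in_nplus[of 1] vd_in_nplus[of "k - 1"] by (simp add: lie_hom_to_complex_def)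
  ultimately have "of_int (k - 2) * \<psi> (vd k) = 0"
    using assms vd_in_nplus[of k] by (simp add: lie_hom_to_complex_def)
  moreover have "k - 2 \<noteq> 0" using assms(2) by simp
  ultimately show ?thesis by (simp only: mult_eq_0_iff of_int_eq_0_iff) simp
qed

lemma C_psi_simps [simp]:
  "carrier (C_psi \<psi>) = UNIV" "ring.zero (C_psi \<psi>) = 0" "add (C_psi \<psi>) = (+)"
  "module.smult (C_psi \<psi>) = (*)" "act (C_psi \<psi>) x c = \<psi> x * c"
  by (simp_all add: C_psi_def)

lemma lie_module_C_psi:
  assumes "lie_hom_to_complex nplus \<psi>"
  shows "lie_module nplus (C_psi \<psi>)"
proof -
  have module: "module complex_field (C_psi \<psi>)"
  proof (rule moduleI)
    show "cring complex_field" by (rule comm_ring_1_class.cring_from_type_algebra)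
    show "abelian_group (C_psi \<psi>)"
      by (rule abelian_groupI) (auto intro: exI[of _ "- x" for x])
  qed (simp_all add: algebra_simps)
  interpret complex_module "C_psi \<psi>" by (intro complex_module.intro module)
  have minus: "a \<ominus>\<^bsub>C_psi \<psi>\<^esub> b = a - b" for a b
    using smult_minus_one[of b] by (simp add: a_minus_def)
  show ?thesis
    by (intro lie_module.intro lie_module_axioms.intro module)
      (use assms in \<open>simp_all add: minus lie_hom_to_complex_def algebra_simps\<close>)
qed

section \<open>Annihilators of Whittaker vectors\<close>

definition annihilator :: "'m lie_module \<Rightarrow> 'm \<Rightarrow> (vir list \<Rightarrow>\<^sub>0 complex) set"
  where "annihilator M m = {p. free_act M p m = \<zero>\<^bsub>M\<^esub>}"

context
  fixes M :: "'m lie_module" (structure)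
  assumes M: "lie_module UNIV M"
begin

interpretation lie_module UNIV M by (fact M)

lemma free_act_hom:
  assumes N: "lie_module UNIV N" and f: "f \<in> lie_module_hom M N" and m: "m \<in> carrier M"
  shows "f (free_act M p m) = free_act N p (f m)"
proof -
  interpret N: lie_module UNIV N by (fact N)
  have fm: "f m \<in> carrier N" using f m by (auto simp: lie_module_hom_def)
  have f_zero: "f \<zero> = \<zero>\<^bsub>N\<^esub>"
  proof -
    have "f (0 \<odot>\<^bsub>M\<^esub> m) = 0 \<odot>\<^bsub>N\<^esub> f m" using f m unfolding lie_module_hom_def by blast
    then show ?thesis using fm m by simp
  qed
  have foldr: "f (foldr (act M) ws m) = foldr (act N) ws (f m)" for ws
    using f by (induction ws) (simp_all add: lie_module_hom_def foldr_act_closed m)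
  have "Poly_Mapping.keys p \<subseteq> lists UNIV" by simp
  then show ?thesis
  proof (induction p rule: poly_mapping_linear_induct)
    case (single ws)
    then show ?case using f m fm
      by (simp add: free_act_single N.free_act_single lie_module_hom_def foldr_act_closed N.foldr_act_closed foldr)
  next
    case (add p q)
    then show ?case using f m fm by (simp add: free_act_add N.free_act_add lie_module_hom_def)
  next
    case (scale c p)
    then show ?case using f m fm by (simp add: free_act_cscale N.free_act_cscale lie_module_hom_def)
  qed (simp add: f_zero)
qed

lemma lie_submodule_range_free_act:
  assumes m: "m \<in> carrier M"
  shows "lie_submodule UNIV M (range (\<lambda>p. free_act M p m))"
  unfolding lie_submodule_def
proof (intro conjI ballI submoduleI)
  show "range (\<lambda>p. free_act M p m) \<subseteq> carrier M" using m by auto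
  show "\<zero> \<in> range (\<lambda>p. free_act M p m)" by (rule range_eqI[of _ _ 0]) simp
next
  fix a assume "a \<in> range (\<lambda>p. free_act M p m)"
  then obtain p where "a = free_act M p m" by blast
  then have "\<ominus> a = free_act M (- p) m"
    using m free_act_cscale[of p m "- 1"] by (simp add: smult_minus_one)
  then show "\<ominus> a \<in> range (\<lambda>p. free_act M p m)" by blast
next
  fix a b assume "a \<in> range (\<lambda>p. free_act M p m)" "b \<in> range (\<lambda>p. free_act M p m)"
  then obtain p q where "a = free_act M p m" "b = free_act M q m" by blast
  then have "a \<oplus> b = free_act M (p + q) m" using m by (simp add: free_act_add)
  then show "a \<oplus> b \<in> range (\<lambda>p. free_act M p m)" by blast
next
  fix c a assume "a \<in> range (\<lambda>p. free_act M p m)"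
  then obtain p where "a = free_act M p m" by blast
  then have "c \<odot>\<^bsub>M\<^esub> a = free_act M (cscale c p) m" using m by (simp add: free_act_cscale)
  then show "c \<odot>\<^bsub>M\<^esub> a \<in> range (\<lambda>p. free_act M p m)" by blast
next
  fix x a assume "a \<in> range (\<lambda>p. free_act M p m)"
  then obtain p where "a = free_act M p m" by blast
  then have "act M x a = free_act M (letter x * p) m" using m by (simp add: free_act_mult)
  then show "act M x a \<in> range (\<lambda>p. free_act M p m)" by blast
qed

lemma generated_submodule_free_act:
  assumes m: "m \<in> carrier M" and gen: "generated_submodule UNIV M {m} = carrier M"
    and a: "a \<in> carrier M"
  shows "\<exists>p. a = free_act M p m"
proof -
  have "m \<in> range (\<lambda>p. free_act M p m)" using m by (intro range_eqI[of _ _ 1]) simp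
  with lie_submodule_range_free_act[OF m]
  have "generated_submodule UNIV M {m} \<subseteq> range (\<lambda>p. free_act M p m)"
    unfolding generated_submodule_def by blast
  with gen a show ?thesis by blast
qed

lemma act_zero_left: assumes m: "m \<in> carrier M" shows "act M 0 m = \<zero>"
  using cscale_act[of 0 m 0] act_closed[of 0 m] m by simp

lemma act_central: assumes m: "m \<in> carrier M" shows "act M x (act M vz m) = act M vz (act M x m)"
proof -
  have "act M x (act M vz m) \<ominus> act M vz (act M x m) = \<zero>"
    using bracket_act[of x vz m] act_zero_left[OF m] m by (simp add: vbracket_vz)
  then show ?thesis using m by (simp add: diff_zero_iff act_closed)
qed

text \<open>The image of \<open>z - \<xi>\<close> is a submodule because \<open>z\<close> commutes with the action.\<close>
lemma stable_submodule_central_image: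
  "stable_submodule M {act M vz m \<ominus> (\<xi> \<odot>\<^bsub>M\<^esub> m) |m. m \<in> carrier M}"
  (is "stable_submodule M ?N")
proof -
  let ?f = "\<lambda>m. act M vz m \<ominus> (\<xi> \<odot>\<^bsub>M\<^esub> m)"
  have N: "?f m \<in> ?N" if "m \<in> carrier M" for m using that by blast
  have f_smult: "c \<odot>\<^bsub>M\<^esub> ?f m = ?f (c \<odot>\<^bsub>M\<^esub> m)" if "m \<in> carrier M" for c m
    using that by (simp add: act_closed act_smult smult_diff_vector smult_smult mult.commute)
  have f_add: "?f m \<oplus> ?f m' = ?f (m \<oplus> m')" if "m \<in> carrier M" "m' \<in> carrier M" for m m'
    using that by (simp add: act_closed act_add smult_add_vector a_minus_def M.minus_add M.a_ac)
  have f_act: "act M x (?f m) = ?f (act M x m)" if "m \<in> carrier M" for x m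
    using that by (simp add: act_closed act_diff act_smult act_central)
  show ?thesis
  proof (intro stable_submodule.intro stable_submodule_axioms.intro submoduleI)
    show "complex_module M" ..
    show "?N \<subseteq> carrier M" by (auto simp: act_closed)
    show "\<zero> \<in> ?N" using N[of \<zero>] f_smult[of \<zero> 0] by (simp add: act_closed)
  next
    fix a assume "a \<in> ?N"
    then obtain m where m: "m \<in> carrier M" "a = ?f m" by blast
    then have "\<ominus> a = ?f ((- 1) \<odot>\<^bsub>M\<^esub> m)"
      using f_smult[of m "- 1"] by (simp add: smult_minus_one act_closed)
    then show "\<ominus> a \<in> ?N" using m by (intro CollectI exI[of _ "(- 1) \<odot>\<^bsub>M\<^esub> m"]) simp
  next
    fix a b assume "a \<in> ?N" "b \<in> ?N"
    then obtain m m' where m: "m \<in> carrier M" "a = ?f m" "m' \<in> carrier M" "b = ?f m'" by blast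
    then have "a \<oplus> b = ?f (m \<oplus> m')" using f_add by simp
    then show "a \<oplus> b \<in> ?N" using m by (intro CollectI exI[of _ "m \<oplus> m'"]) simp
  next
    fix c a assume "a \<in> ?N"
    then obtain m where m: "m \<in> carrier M" "a = ?f m" by blast
    then have "c \<odot>\<^bsub>M\<^esub> a = ?f (c \<odot>\<^bsub>M\<^esub> m)" using f_smult by simp
    then show "c \<odot>\<^bsub>M\<^esub> a \<in> ?N" using m by (intro CollectI exI[of _ "c \<odot>\<^bsub>M\<^esub> m"]) simp
  next
    fix a x assume "a \<in> ?N"
    then obtain m where m: "m \<in> carrier M" "a = ?f m" by blast
    then have "act M x a = ?f (act M x m)" using f_act by simp
    then show "act M x a \<in> ?N" using m by (intro CollectI exI[of _ "act M x m"]) (simp add: act_closed)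
  qed (simp_all add: act_closed act_add act_smult)
qed

lemma lie_module_stable_quotient:
  assumes "stable_submodule M N" shows "lie_module UNIV (quotient_module M N)"
proof -
  interpret stable_submodule M N by fact
  have zero: "a \<ominus> a \<in> N" if "a \<in> carrier M" for a
    using that N_zero by (simp add: diff_zero_iff[THEN iffD2])
  show ?thesis
    by (rule lie_module_Q) (simp_all add: add_act cscale_act bracket_act act_closed zero)
qed

end

locale whittaker_vector_of = lie_module UNIV M for M :: "'m lie_module" (structure) +
  fixes \<psi> :: "vir \<Rightarrow> complex" and w :: 'm
  assumes psi_hom: "lie_hom_to_complex nplus \<psi>" and psi_vd_2: "\<psi> (vd 2) \<noteq> 0"
    and w: "whittaker_vector \<psi> M w"
begin

abbreviation Ann where "Ann \<equiv> annihilator M w"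
abbreviation ev where "ev p \<equiv> free_act M p w"

lemma w_closed [simp]: "w \<in> carrier M"
  using w by (simp add: whittaker_vector_def)

lemma act_in_UNIV [simp]: "m \<in> carrier M \<Longrightarrow> act M x m \<in> carrier M"
  by (simp add: act_closed)

lemma ev_closed [simp]: "ev p \<in> carrier M"
  by simp

lemma ev_simps [simp]:
  "ev 0 = \<zero>" "ev 1 = w" "ev (p + q) = ev p \<oplus> ev q" "ev (p - q) = ev p \<ominus> ev q"
  "ev (cscale c p) = c \<odot>\<^bsub>M\<^esub> ev p" "ev (letter x * p) = act M x (ev p)"
  by (simp_all add: free_act_add free_act_diff free_act_cscale free_act_mult)

lemma Ann_iff: "p \<in> Ann \<longleftrightarrow> ev p = \<zero>"
  by (simp add: annihilator_def)

lemma Ann_diff_iff: "p - q \<in> Ann \<longleftrightarrow> ev p = ev q"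
  by (simp add: Ann_iff diff_zero_iff)

lemma Ann_subspace: "cscale.subspace Ann"
  unfolding cscale.subspace_def by (simp add: Ann_iff)

lemma letter_linear: "module_hom cscale cscale ((*) (letter x))"
  by (intro module_hom.intro module_hom_axioms.intro cscale.module_axioms)
    (simp_all add: distrib_left cscale_mult_right)

lemma whittaker_vector_add:
  "whittaker_vector \<psi> M m \<Longrightarrow> whittaker_vector \<psi> M m' \<Longrightarrow> whittaker_vector \<psi> M (m \<oplus> m')"
  by (simp add: whittaker_vector_def act_add smult_add_vector)

lemma whittaker_vector_smult: "whittaker_vector \<psi> M m \<Longrightarrow> whittaker_vector \<psi> M (c \<odot>\<^bsub>M\<^esub> m)"
  by (simp add: whittaker_vector_def act_smult smult_smult mult.commute)

lemma whittaker_vector_vz: "whittaker_vector \<psi> M m \<Longrightarrow> whittaker_vector \<psi> M (act M vz m)"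
  by (simp add: whittaker_vector_def act_smult act_central[OF lie_module_axioms])

text \<open>
  The cyclic module generated by \<open>w\<close> is the free algebra modulo the annihilator of \<open>w\<close>, on which \<open>d_k\<close> and \<open>z\<close> act by left
  multiplication; this makes the results on ordered words available.
\<close>
lemma whittaker_space_Ann:
  assumes "cscale.subspace U" "Ann \<subseteq> U" "\<And>u. u \<in> U \<Longrightarrow> letter vz * u \<in> U"
    and U: "\<And>u. u \<in> U \<Longrightarrow> whittaker_vector \<psi> M (ev u)"
  shows "whittaker_space cscale (\<lambda>k p. letter (vd k) * p) ((*) (letter vz)) (\<lambda>m. \<psi> (vd (int m))) Ann U"
proof (intro whittaker_space.intro whittaker_space_axioms.intro cscale.vector_space_axioms
    letter_linear Ann_subspace assms(1-3))
  fix k j :: int and v :: "vir list \<Rightarrow>\<^sub>0 complex"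
  have "ev (letter (vbracket (vd k) (vd j)) * v) = act M (vd k) (act M (vd j) (ev v)) \<ominus> act M (vd j) (act M (vd k) (ev v))"
    by (simp add: bracket_act)
  moreover have "ev (letter (vbracket (vd k) (vd j)) * v) = ev (cscale (of_int (j - k)) (letter (vd (k + j)) * v) +
      (if j = - k then cscale ((of_int k ^ 3 - of_int k) / 12) (letter vz * v) else 0))"
    by (simp add: vbracket_vd add_act cscale_act act_zero_left[OF lie_module_axioms])
  ultimately show "letter (vd k) * (letter (vd j) * v) - letter (vd j) * (letter (vd k) * v) -
      (cscale (of_int (j - k)) (letter (vd (k + j)) * v) +
      (if j = - k then cscale ((of_int k ^ 3 - of_int k) / 12) (letter vz * v) else 0)) \<in> Ann"
    by (simp only: Ann_diff_iff) simp
next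
  show "letter vz * (letter (vd k) * v) - letter (vd k) * (letter vz * v) \<in> Ann" for k v
    by (simp add: Ann_diff_iff act_central[OF lie_module_axioms])
next
  fix u and m :: nat assume "u \<in> U" "1 \<le> m"
  with U[of u] show "letter (vd (int m)) * u - cscale (\<psi> (vd (int m))) u \<in> Ann"
    by (simp add: Ann_diff_iff whittaker_vector_def vd_in_nplus)
qed (use psi_vd_high[OF psi_hom] psi_vd_2 in \<open>auto simp: Ann_iff act_zero\<close>)

text \<open>
  Start with the empty word and multiply from the left with one Lie algebra element at a time; each of
  them is a combination of \<open>z\<close> and the \<open>d_k\<close>, under which the sorted forms are stable.
\<close>
lemma all_sorted_form:
  assumes ws: "whittaker_space cscale (\<lambda>k p. letter (vd k) * p) ((*) (letter vz)) (\<lambda>m. \<psi> (vd (int m))) Ann U"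
    and one: "1 \<in> U"
  shows "whittaker_space.sorted_form (\<lambda>k p. letter (vd k) * p) Ann U p"
proof -
  interpret whittaker_space cscale "\<lambda>k p. letter (vd k) * p" "(*) (letter vz)"
    "\<lambda>m. \<psi> (vd (int m))" Ann U by (fact ws)
  have cong: "sorted_form p" if "sorted_form q" "ev p = ev q" for p q
    using sorted_form_add[OF sorted_form_I that(1), of "p - q"] that(2) by (simp add: Ann_diff_iff)
  have letter: "sorted_form (letter x * q)" if q: "sorted_form q" for x q
  proof -
    have "Poly_Mapping.keys x \<subseteq> UNIV" by simp
    then show ?thesis
    proof (induction x rule: poly_mapping_linear_induct)
      case zero
      show ?case by (intro sorted_form_I) (simp add: Ann_iff act_zero_left[OF lie_module_axioms])
    next
      case (single b)
      then show ?case
        using sorted_form_D[OF q] sorted_form_Z[OF q] by (cases b) (simp_all add: vd_def vz_def)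
    next
      case (add x y)
      then show ?case
        by (intro cong[OF sorted_form_add[OF add(3,4)]]) (simp add: add_act)
    next
      case (scale c x)
      then show ?case
        by (intro cong[OF sorted_form_scale[OF scale(2), of c]]) (simp add: cscale_act)
    qed
  qed
  have "Poly_Mapping.keys p \<subseteq> UNIV" by simp
  then show ?thesis
  proof (induction p rule: poly_mapping_linear_induct)
    case zero
    then show ?case by (intro sorted_form_I) (simp add: Ann_iff)
  next
    case (single ws)
    show ?case
    proof (induction ws)
      case Nil
      have "Poly_Mapping.single [] 1 = (1 :: vir list \<Rightarrow>\<^sub>0 complex)"
        by (simp add: zero_list_def flip: single_one)
      then show ?case using sorted_form_word[OF one, of "[]"] by simp
    next
      case (Cons x ws)
      have "Poly_Mapping.single (x # ws) 1 = letter x * Poly_Mapping.single ws 1"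
        by (simp add: letter_def mult_single plus_list_def)
      with letter[OF Cons, of x] show ?case by simp
    qed
  qed (auto intro: sorted_form_add sorted_form_scale)
qed

end

section \<open>The central character\<close>

context whittaker_vector_of
begin

lemma Z_poly_combination: "whittaker_vector \<psi> M (ev (poly_op cscale ((*) (letter vz)) p 1))"
proof (induction p)
  case 0
  then show ?case
    using whittaker_vector_smult[OF w, of 0] by simp
next
  case (pCons a p)
  then show ?case
    using whittaker_vector_add[OF whittaker_vector_smult[OF w, of a] whittaker_vector_vz[OF pCons(2)]]
    by (simp add: poly_op_pCons[OF cscale.vector_space_axioms letter_linear])
qed

text \<open>The first choice of \<open>U\<close>: all vectors \<open>p(z) w\<close>.\<close>
lemma whittaker_space_Z_polys:
  "whittaker_space cscale (\<lambda>k p. letter (vd k) * p) ((*) (letter vz)) (\<lambda>m. \<psi> (vd (int m))) Ann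
    {u. \<exists>p. ev u = ev (poly_op cscale ((*) (letter vz)) p 1)}" (is "whittaker_space _ _ ?Z _ _ ?U")
proof (rule whittaker_space_Ann)
  note poly_op = poly_op_pCons[OF cscale.vector_space_axioms letter_linear]
    poly_op_add[OF cscale.vector_space_axioms letter_linear]
    poly_op_smult[OF cscale.vector_space_axioms letter_linear]
  show "cscale.subspace ?U"
    unfolding cscale.subspace_def
  proof (intro conjI ballI allI)
    show "0 \<in> ?U" by (intro CollectI exI[of _ 0]) simp
  next
    fix u v assume "u \<in> ?U" "v \<in> ?U"
    then obtain p q where "ev u = ev (poly_op cscale ?Z p 1)" "ev v = ev (poly_op cscale ?Z q 1)" by blast
    then show "u + v \<in> ?U" by (intro CollectI exI[of _ "p + q"]) (simp add: poly_op)
  next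
    fix c u assume "u \<in> ?U"
    then obtain p where "ev u = ev (poly_op cscale ?Z p 1)" by blast
    then show "cscale c u \<in> ?U" by (intro CollectI exI[of _ "smult c p"]) (simp add: poly_op)
  qed
  show "Ann \<subseteq> ?U"
  proof
    fix u assume "u \<in> Ann"
    then show "u \<in> ?U" by (intro CollectI exI[of _ 0]) (simp add: Ann_iff)
  qed
  show "letter vz * u \<in> ?U" if u: "u \<in> ?U" for u
  proof -
    from u obtain p where "ev u = ev (poly_op cscale ?Z p 1)" by blast
    then show ?thesis by (intro CollectI exI[of _ "pCons 0 p"]) (simp add: poly_op)
  qed
  show "whittaker_vector \<psi> M (ev u)" if "u \<in> ?U" for u
    using that Z_poly_combination by auto
qed

lemma lie_submodule_eigenspace: "lie_submodule UNIV M {m \<in> carrier M. act M vz m = \<xi> \<odot>\<^bsub>M\<^esub> m}"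
  unfolding lie_submodule_def
  by (intro conjI submoduleI)
    (auto simp: act_zero act_add act_minus act_smult smult_add_vector smult_smult mult.commute
      smult_r_minus[simplified] act_central[OF lie_module_axioms, symmetric])

lemma lie_submodule_central_image: "lie_submodule UNIV M (act M vz ` carrier M)"
  unfolding lie_submodule_def
proof (intro conjI submoduleI ballI)
  show "\<zero> \<in> act M vz ` carrier M" by (rule image_eqI[of _ _ \<zero>]) (simp_all add: act_zero)
next
  fix a assume "a \<in> act M vz ` carrier M"
  then obtain m where "m \<in> carrier M" "a = act M vz m" by blast
  then show "\<ominus> a \<in> act M vz ` carrier M" by (intro image_eqI[of _ _ "\<ominus> m"]) (simp_all add: act_minus)
next
  fix a b assume "a \<in> act M vz ` carrier M" "b \<in> act M vz ` carrier M"
  then obtain m m' where "m \<in> carrier M" "a = act M vz m" "m' \<in> carrier M" "b = act M vz m'" by blast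
  then show "a \<oplus> b \<in> act M vz ` carrier M" by (intro image_eqI[of _ _ "m \<oplus> m'"]) (simp_all add: act_add)
next
  fix c a assume "a \<in> act M vz ` carrier M"
  then obtain m where "m \<in> carrier M" "a = act M vz m" by blast
  then show "c \<odot>\<^bsub>M\<^esub> a \<in> act M vz ` carrier M" by (intro image_eqI[of _ _ "c \<odot>\<^bsub>M\<^esub> m"]) (simp_all add: act_smult)
next
  fix x a assume "a \<in> act M vz ` carrier M"
  then obtain m where "m \<in> carrier M" "a = act M vz m" by blast
  then show "act M x a \<in> act M vz ` carrier M"
    by (intro image_eqI[of _ _ "act M x m"]) (simp_all add: act_central[OF lie_module_axioms])
qed auto

text \<open>
  The image and the eigenspaces of \<open>z\<close> are submodules, so it suffices to find an eigenvector. If \<open>z\<close> is onto,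
  then \<open>w\<close> has a preimage of the form \<open>p(z) w\<close>, and \<open>X p - 1\<close> is a nonzero polynomial whatever \<open>p\<close> is.
\<close>
lemma central_character:
  assumes simple: "simple_lie_module UNIV M" and gen: "generated_submodule UNIV M {w} = carrier M"
    and w_nonzero: "w \<noteq> \<zero>"
  shows "\<exists>\<xi>. \<forall>m\<in>carrier M. act M vz m = \<xi> \<odot>\<^bsub>M\<^esub> m"
proof -
  let ?Z = "(*) (letter vz)" and ?E = "\<lambda>\<xi>. {m \<in> carrier M. act M vz m = \<xi> \<odot>\<^bsub>M\<^esub> m}"
  have eigen: "\<exists>\<xi>. \<forall>m\<in>carrier M. act M vz m = \<xi> \<odot>\<^bsub>M\<^esub> m"
    if "m \<in> carrier M" "m \<noteq> \<zero>" "act M vz m = \<xi> \<odot>\<^bsub>M\<^esub> m" for m \<xi>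
  proof -
    have "?E \<xi> = {\<zero>} \<or> ?E \<xi> = carrier M"
      using simple lie_submodule_eigenspace unfolding simple_lie_module_def by blast
    moreover have "m \<in> ?E \<xi>" using that by blast
    ultimately have "?E \<xi> = carrier M" using that(2) by blast
    then show ?thesis by blast
  qed
  have "act M vz ` carrier M = {\<zero>} \<or> act M vz ` carrier M = carrier M"
    using simple lie_submodule_central_image unfolding simple_lie_module_def by blast
  then show ?thesis
  proof
    assume "act M vz ` carrier M = {\<zero>}"
    moreover have "act M vz w \<in> act M vz ` carrier M" by simp
    ultimately have "act M vz w = 0 \<odot>\<^bsub>M\<^esub> w" by simp
    then show ?thesis using eigen w_nonzero w_closed by blast
  next
    assume surj: "act M vz ` carrier M = carrier M"
    then obtain m where m: "m \<in> carrier M" "w = act M vz m" using w_closed by blast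
    obtain v where v: "m = ev v"
      using generated_submodule_free_act[OF lie_module_axioms w_closed gen m(1)] by blast
    interpret ws: whittaker_space cscale "\<lambda>k p. letter (vd k) * p" ?Z "\<lambda>m. \<psi> (vd (int m))" Ann
      "{u. \<exists>p. ev u = ev (poly_op cscale ?Z p 1)}" by (rule whittaker_space_Z_polys)
    note poly_op = poly_op_pCons[OF cscale.vector_space_axioms letter_linear]
    have one: "1 \<in> {u. \<exists>p. ev u = ev (poly_op cscale ?Z p 1)}"
      by (intro CollectI exI[of _ "[:1:]"]) (simp add: poly_op act_zero)
    have "\<exists>u'\<in>{u. \<exists>p. ev u = ev (poly_op cscale ?Z p 1)}. letter vz * u' - 1 \<in> Ann"
      by (rule ws.Z_surjective_on_U[OF one all_sorted_form[OF whittaker_space_Z_polys one], of v])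
        (simp add: Ann_diff_iff m(2)[unfolded v, symmetric])
    then obtain u p where u: "ev u = ev (poly_op cscale ?Z p 1)" "letter vz * u - 1 \<in> Ann" by blast
    \<comment> \<open>Hence \<open>z p(z) - 1\<close> is a nonzero polynomial in \<open>z\<close> that annihilates \<open>w\<close>.\<close>
    have "ev (poly_op cscale ?Z (pCons (- 1) p) 1) = act M vz (ev u) \<ominus> w"
      using u(1) by (simp add: poly_op smult_minus_one a_minus_def M.a_comm)
    also have "\<dots> = \<zero>"
      using u(2) by (simp add: Ann_diff_iff diff_zero_iff)
    finally have ann: "poly_op cscale ?Z (pCons (- 1) p) 1 \<in> Ann" by (simp add: Ann_iff)
    have "\<exists>\<xi> v. v \<notin> Ann \<and> letter vz * v - cscale \<xi> v \<in> Ann"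
      by (rule eigenvector_of_annihilating_poly[OF cscale.vector_space_axioms letter_linear Ann_subspace _ _ ann])
        (use w_nonzero in \<open>simp_all add: Ann_iff\<close>)
    then obtain \<xi> v where "v \<notin> Ann" "letter vz * v - cscale \<xi> v \<in> Ann" by blast
    then show ?thesis
      using eigen[of "ev v" \<xi>] by (simp add: Ann_iff[of v] Ann_diff_iff)
  qed
qed

text \<open>The second choice of \<open>U\<close>, available once \<open>z\<close> acts on \<open>w\<close> by a scalar: the multiples of \<open>w\<close>.\<close>
lemma whittaker_space_scalars:
  assumes z: "act M vz w = \<xi> \<odot>\<^bsub>M\<^esub> w"
  shows "whittaker_space cscale (\<lambda>k p. letter (vd k) * p) ((*) (letter vz)) (\<lambda>m. \<psi> (vd (int m))) Ann
    {u. \<exists>c. ev u = c \<odot>\<^bsub>M\<^esub> w}" (is "whittaker_space _ _ ?Z _ _ ?U")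
proof (rule whittaker_space_Ann)
  show "cscale.subspace ?U"
    unfolding cscale.subspace_def
  proof (intro conjI ballI allI)
    show "0 \<in> ?U" by (intro CollectI exI[of _ 0]) simp
  next
    fix u v assume "u \<in> ?U" "v \<in> ?U"
    then obtain a b where "ev u = a \<odot>\<^bsub>M\<^esub> w" "ev v = b \<odot>\<^bsub>M\<^esub> w" by blast
    then show "u + v \<in> ?U" by (intro CollectI exI[of _ "a + b"]) (simp add: smult_add_scalar)
  next
    fix c u assume "u \<in> ?U"
    then obtain a where "ev u = a \<odot>\<^bsub>M\<^esub> w" by blast
    then show "cscale c u \<in> ?U" by (intro CollectI exI[of _ "c * a"]) (simp add: smult_smult)
  qed
  show "Ann \<subseteq> ?U"
  proof
    fix u assume "u \<in> Ann"
    then show "u \<in> ?U" by (intro CollectI exI[of _ 0]) (simp add: Ann_iff)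
  qed
  show "letter vz * u \<in> ?U" if u: "u \<in> ?U" for u
  proof -
    from u obtain a where "ev u = a \<odot>\<^bsub>M\<^esub> w" by blast
    then show ?thesis
      by (intro CollectI exI[of _ "a * \<xi>"]) (simp add: act_smult z smult_smult)
  qed
  show "whittaker_vector \<psi> M (ev u)" if "u \<in> ?U" for u
    using that whittaker_vector_smult[OF w] by auto
qed

end

text \<open>
  This is the injectivity of \<open>L \<rightarrow> S\<close>. An element \<open>p\<close> that kills \<open>w\<close> equals, modulo the annihilator of \<open>w'\<close>,
  a sum of ordered words with scalar coefficients. This sum still kills \<open>w\<close>, so by independence in \<open>S\<close> its coefficients
  vanish, and \<open>p\<close> kills \<open>w'\<close>.
\<close>
lemma annihilator_subset:
  assumes S: "whittaker_vector_of S \<psi> w" and L: "whittaker_vector_of L \<psi> w'"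
    and zS: "act S vz w = \<xi> \<odot>\<^bsub>S\<^esub> w" and zL: "act L vz w' = \<xi> \<odot>\<^bsub>L\<^esub> w'"
    and sub: "annihilator L w' \<subseteq> annihilator S w" and w: "w \<noteq> \<zero>\<^bsub>S\<^esub>"
  shows "annihilator S w \<subseteq> annihilator L w'"
proof
  interpret S: whittaker_vector_of S \<psi> w by (fact S)
  interpret L: whittaker_vector_of L \<psi> w' by (fact L)
  interpret wS: whittaker_space cscale "\<lambda>k p. letter (vd k) * p" "(*) (letter vz)" "\<lambda>m. \<psi> (vd (int m))"
    "annihilator S w" "{u. \<exists>c. S.ev u = c \<odot>\<^bsub>S\<^esub> w}" by (rule S.whittaker_space_scalars[OF zS])
  interpret wL: whittaker_space cscale "\<lambda>k p. letter (vd k) * p" "(*) (letter vz)" "\<lambda>m. \<psi> (vd (int m))"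
    "annihilator L w'" "{u. \<exists>c. L.ev u = c \<odot>\<^bsub>L\<^esub> w'}" by (rule L.whittaker_space_scalars[OF zL])
  have L_S: "S.ev u = c \<odot>\<^bsub>S\<^esub> w" if "L.ev u = c \<odot>\<^bsub>L\<^esub> w'" for u c
  proof -
    have "u - cscale c 1 \<in> annihilator L w'" using that by (simp add: L.Ann_diff_iff)
    then have "u - cscale c 1 \<in> annihilator S w" using sub by blast
    then show ?thesis by (simp add: S.Ann_diff_iff)
  qed
  fix p assume p: "p \<in> annihilator S w"
  have "1 \<in> {u. \<exists>c. L.ev u = c \<odot>\<^bsub>L\<^esub> w'}"
    by (intro CollectI exI[of _ 1]) simp
  from L.all_sorted_form[OF wL.whittaker_space_axioms this, of p]
  obtain A c where A: "finite A" "\<forall>ks\<in>A. sorted ks" and c: "\<And>ks. \<exists>a. L.ev (c ks) = a \<odot>\<^bsub>L\<^esub> w'"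
    and sum: "p - (\<Sum>ks\<in>A. wL.word ks (c ks)) \<in> annihilator L w'"
    unfolding wL.sorted_form_def by blast
  have sum_S: "(\<Sum>ks\<in>A. wL.word ks (c ks)) \<in> annihilator S w"
    using cscale.subspace_diff[OF S.Ann_subspace p subsetD[OF sub sum]] by simp
  have "c ks \<in> annihilator L w'" if "ks \<in> A" for ks
  proof -
    have "c ks \<in> annihilator S w"
      by (rule wS.sorted_words_independent[OF A(1) _ sum_S that]) (use A c L_S in blast)
    moreover obtain a where a: "L.ev (c ks) = a \<odot>\<^bsub>L\<^esub> w'" using c by blast
    ultimately have "a \<odot>\<^bsub>S\<^esub> w = \<zero>\<^bsub>S\<^esub>" using L_S[OF a] by (simp add: S.Ann_iff)
    then have "inverse a \<odot>\<^bsub>S\<^esub> (a \<odot>\<^bsub>S\<^esub> w) = \<zero>\<^bsub>S\<^esub>" by simp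
    then have "a = 0" using w by (cases "a = 0") (simp_all add: S.smult_smult)
    then show ?thesis using a by (simp add: L.Ann_iff)
  qed
  then have "(\<Sum>ks\<in>A. wL.word ks (c ks)) \<in> annihilator L w'"
    by (intro cscale.subspace_sum[OF L.Ann_subspace] wL.word_I)
  from cscale.subspace_add[OF L.Ann_subspace sum this] show "p \<in> annihilator L w'" by simp
qed

section \<open>The universal Whittaker modules\<close>

context
  fixes \<psi> :: "vir \<Rightarrow> complex"
  assumes psi: "lie_hom_to_complex nplus \<psi>"
begin

interpretation T: stable_submodule "free_tensor (C_psi \<psi>)" "module.span cscale (tensor_relations nplus (C_psi \<psi>))"
  rewrites "T.Q = M_psi \<psi>"
  by (rule stable_submodule_Rel[OF lie_subalgebra_nplus lie_module_C_psi[OF psi]])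
    (simp add: M_psi_def induced_module_def)

lemma lie_module_M_psi: "lie_module UNIV (M_psi \<psi>)"
  unfolding M_psi_def by (rule lie_module_induced[OF lie_subalgebra_nplus lie_module_C_psi[OF psi]])

interpretation M: lie_module UNIV "M_psi \<psi>" by (rule lie_module_M_psi)

interpretation C: lie_module nplus "C_psi \<psi>" by (rule lie_module_C_psi[OF psi])

lemmas relations = Rel_relations[OF lie_subalgebra_nplus lie_module_C_psi[OF psi]]

definition wM :: M_elem where "wM = T.coset (ptensor 1 1)"

lemma ptensor_in [simp]: "ptensor p c \<in> carrier (free_tensor (C_psi \<psi>))"
  by (rule ptensor_carrier) simp

lemma wM_closed: "wM \<in> carrier (M_psi \<psi>)"
  by (simp add: wM_def T.carrier_Q)

lemma coset_eqI: "s \<in> carrier (free_tensor (C_psi \<psi>)) \<Longrightarrow> t \<in> carrier (free_tensor (C_psi \<psi>)) \<Longrightarrow>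
    s - t \<in> module.span cscale (tensor_relations nplus (C_psi \<psi>)) \<Longrightarrow> T.coset s = T.coset t"
  by (simp add: T.coset_eq_iff free_tensor_minus)

lemma whittaker_vector_wM: "whittaker_vector \<psi> (M_psi \<psi>) wM"
  unfolding whittaker_vector_def
proof (intro conjI ballI wM_closed)
  fix x assume x: "x \<in> nplus"
  have "act (M_psi \<psi>) x wM = T.coset (ptensor (1 * letter x) 1)"
    by (simp add: wM_def T.coset_act)
  also have "\<dots> = T.coset (ptensor 1 (\<psi> x))"
    using relations(5)[of 1 "letter x" 1] x by (intro coset_eqI) simp_all
  also have "\<dots> = T.coset (cscale (\<psi> x) (ptensor 1 1))"
    using relations(4)[of 1 1 "\<psi> x"] T.smult_in[of "ptensor 1 1" "\<psi> x"] by (intro coset_eqI) simp_all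
  also have "\<dots> = \<psi> x \<odot>\<^bsub>M_psi \<psi>\<^esub> wM"
    using T.coset_smult[of "ptensor 1 1" "\<psi> x"] by (simp add: wM_def)
  finally show "act (M_psi \<psi>) x wM = \<psi> x \<odot>\<^bsub>M_psi \<psi>\<^esub> wM" .
qed

lemma coset_ptensor_one: "T.coset (ptensor p 1) = free_act (M_psi \<psi>) p wM"
proof -
  have "Poly_Mapping.keys p \<subseteq> lists UNIV" by simp
  then show ?thesis
  proof (induction p rule: poly_mapping_linear_induct)
    case zero
    have "T.coset (ptensor 0 1) = T.coset (cscale 0 (ptensor 0 1))"
      using relations(3)[of 1 0 0] T.smult_in[of "ptensor 0 1" 0] by (intro coset_eqI) simp_all
    then show ?case
      using T.coset_zero_iff[of 0] T.N_zero T.M.zero_closed by simp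
  next
    case (single ws)
    show ?case
    proof (induction ws)
      case Nil
      have "Poly_Mapping.single [] 1 = (1 :: vir list \<Rightarrow>\<^sub>0 complex)"
        by (simp add: zero_list_def flip: single_one)
      then show ?case using wM_closed by (simp add: wM_def)
    next
      case (Cons x ws)
      have eq: "Poly_Mapping.single (x # ws) 1 = letter x * Poly_Mapping.single ws 1"
        by (simp add: letter_def mult_single plus_list_def)
      have "T.coset (ptensor (letter x * Poly_Mapping.single ws 1) 1)
          = act (M_psi \<psi>) x (T.coset (ptensor (Poly_Mapping.single ws 1) 1))"
        by (simp add: T.coset_act)
      with Cons wM_closed show ?case by (simp add: eq M.free_act_mult)
    qed
  next
    case (add p q)
    have "T.coset (ptensor (p + q) 1) = T.coset (ptensor p 1 + ptensor q 1)"
      using relations(1)[of 1 p q] T.M.a_closed[of "ptensor p 1" "ptensor q 1"]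
      by (intro coset_eqI) (simp_all add: algebra_simps)
    also have "\<dots> = T.coset (ptensor p 1) \<oplus>\<^bsub>M_psi \<psi>\<^esub> T.coset (ptensor q 1)"
      by (simp add: T.coset_add)
    finally show ?case using add wM_closed by (simp add: M.free_act_add)
  next
    case (scale c p)
    have "T.coset (ptensor (cscale c p) 1) = T.coset (cscale c (ptensor p 1))"
      using relations(3)[of 1 c p] T.smult_in[of "ptensor p 1" c] by (intro coset_eqI) simp_all
    also have "\<dots> = c \<odot>\<^bsub>M_psi \<psi>\<^esub> T.coset (ptensor p 1)"
      using T.coset_smult[of "ptensor p 1" c] by simp
    finally show ?case using scale wM_closed by (simp add: M.free_act_cscale)
  qed
qed

lemma M_psi_generated: assumes "m \<in> carrier (M_psi \<psi>)" shows "\<exists>p. m = free_act (M_psi \<psi>) p wM"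
proof -
  obtain t where t: "t \<in> carrier (free_tensor (C_psi \<psi>))" "m = T.coset t"
    using assms by (auto simp: T.carrier_Q)
  from t(1) have "\<exists>p. T.coset t = free_act (M_psi \<psi>) p wM"
  proof (induction rule: free_tensor_induct)
    case zero
    have "T.coset 0 = free_act (M_psi \<psi>) 0 wM"
      using T.coset_zero_iff[of 0] T.N_zero T.M.zero_closed by simp
    then show ?case by blast
  next
    case (ptensor p c)
    have "T.coset (ptensor p c) = T.coset (cscale c (ptensor p 1))"
      using relations(4)[of 1 p c] T.smult_in[of "ptensor p 1" c] by (intro coset_eqI) simp_all
    also have "\<dots> = free_act (M_psi \<psi>) (cscale c p) wM"
      using T.coset_smult[of "ptensor p 1" c] wM_closed by (simp add: coset_ptensor_one M.free_act_cscale)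
    finally show ?case by blast
  next
    case (add s t)
    then obtain p q where "T.coset s = free_act (M_psi \<psi>) p wM" "T.coset t = free_act (M_psi \<psi>) q wM" by blast
    then have "T.coset (s + t) = free_act (M_psi \<psi>) (p + q) wM"
      using T.coset_add[OF add(1,2)] wM_closed by (simp add: M.free_act_add)
    then show ?case by blast
  next
    case (scale c t)
    then obtain p where "T.coset t = free_act (M_psi \<psi>) p wM" by blast
    then have "T.coset (cscale c t) = free_act (M_psi \<psi>) (cscale c p) wM"
      using T.coset_smult[OF scale(1), of c] wM_closed by (simp add: M.free_act_cscale)
    then show ?case by blast
  qed
  with t(2) show ?thesis by simp
qed

text \<open>
  The homomorphism is induced by \<open>u \<otimes> c \<mapsto> c u w\<close>. That this respects the balancing
  relation is the Whittaker property of \<open>w\<close>: an element \<open>q\<close> of the free algebra on the positive part acts on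
  \<open>w\<close> by the scalar by which it acts on the one-dimensional module.
\<close>
lemma M_psi_universal:
  assumes S: "lie_module UNIV S" and w: "whittaker_vector \<psi> S w"
  shows "\<exists>f\<in>lie_module_hom (M_psi \<psi>) S. f wM = w"
proof -
  interpret S: lie_module UNIV S by (fact S)
  have w_closed [simp]: "w \<in> carrier S" using w by (simp add: whittaker_vector_def)
  have w_act: "act S x w = \<psi> x \<odot>\<^bsub>S\<^esub> w" if "x \<in> nplus" for x
    using w that by (simp add: whittaker_vector_def)
  define b where "b = (\<lambda>(u, c). c \<odot>\<^bsub>S\<^esub> uea_act S u w)"
  define \<Phi> where "\<Phi> = linear_extension S b"
  let ?T = "free_tensor (C_psi \<psi>)"
  let ?B = "carrier (uea UNIV) \<times> (UNIV :: complex set)"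
  have act: "uea_act S (uea_of UNIV p) w = free_act S p w" for p
    by (rule S.uea_act_uea_of[OF lie_subalgebra_UNIV]) simp_all
  have b: "b \<in> ?B \<rightarrow> carrier S"
    by (auto simp: b_def carrier_uea_UNIV act)
  have keys: "Poly_Mapping.keys t \<subseteq> ?B" if "t \<in> carrier ?T" for t
    using that by (simp add: carrier_free_tensor)
  have \<Phi>_closed: "\<Phi> t \<in> carrier S" if "t \<in> carrier ?T" for t
    unfolding \<Phi>_def using b keys[OF that] by (intro S.linear_extension_closed) blast
  have \<Phi>_zero: "\<Phi> 0 = \<zero>\<^bsub>S\<^esub>" by (simp add: \<Phi>_def)
  have \<Phi>_add: "\<Phi> (s + t) = \<Phi> s \<oplus>\<^bsub>S\<^esub> \<Phi> t" if "s \<in> carrier ?T" "t \<in> carrier ?T" for s t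
    unfolding \<Phi>_def by (rule S.linear_extension_add[OF keys[OF that(1)] keys[OF that(2)] b])
  have \<Phi>_diff: "\<Phi> (s - t) = \<Phi> s \<ominus>\<^bsub>S\<^esub> \<Phi> t" if "s \<in> carrier ?T" "t \<in> carrier ?T" for s t
    unfolding \<Phi>_def by (rule S.linear_extension_diff[OF keys[OF that(1)] keys[OF that(2)] b])
  have \<Phi>_cscale: "\<Phi> (cscale c t) = c \<odot>\<^bsub>S\<^esub> \<Phi> t" if "t \<in> carrier ?T" for c t
    unfolding \<Phi>_def by (rule S.linear_extension_cscale[OF keys[OF that] b])
  have \<Phi>_ptensor: "\<Phi> (ptensor p c) = c \<odot>\<^bsub>S\<^esub> free_act S p w" for p c
  proof -
    have "b (uea_of UNIV p, c) = c \<odot>\<^bsub>S\<^esub> free_act S p w" by (simp add: b_def act)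
    then show ?thesis by (simp add: \<Phi>_def pure_tensor_def)
  qed
  have \<Phi>_act: "\<Phi> (act ?T x t) = act S x (\<Phi> t)" if "t \<in> carrier ?T" for x t
    using that
  proof (induction rule: free_tensor_induct)
    case zero
    show ?case by (simp add: module_hom.zero[OF act_free_tensor_linear] \<Phi>_zero S.act_zero)
  next
    case (ptensor p c)
    show ?case by (simp add: \<Phi>_ptensor S.free_act_mult S.act_smult)
  next
    case (add s t)
    then show ?case
      using T.act_in[of s x] T.act_in[of t x]
      by (simp add: module_hom.add[OF act_free_tensor_linear] \<Phi>_add \<Phi>_closed S.act_add)
  next
    case (scale c t)
    then show ?case
      using T.act_in[of t x]
      by (simp add: module_hom.scale[OF act_free_tensor_linear] \<Phi>_cscale \<Phi>_closed S.act_smult)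
  qed
  have hom: "\<Phi> \<in> lie_module_hom ?T S"
    by (simp add: lie_module_hom_def \<Phi>_closed \<Phi>_add \<Phi>_cscale \<Phi>_act)
  have nplus_act: "c \<odot>\<^bsub>S\<^esub> free_act S q w = free_act (C_psi \<psi>) q c \<odot>\<^bsub>S\<^esub> w"
    if "Poly_Mapping.keys q \<subseteq> lists nplus" for q c
    using that
  proof (induction q rule: poly_mapping_linear_induct)
    case (single ws)
    have foldr: "c \<odot>\<^bsub>S\<^esub> foldr (act S) vs w = foldr (act (C_psi \<psi>)) vs c \<odot>\<^bsub>S\<^esub> w"
      if "vs \<in> lists nplus" for vs
      using that
    proof (induction vs rule: list.induct)
      case (Cons x vs)
      then have x: "x \<in> nplus" and vs: "vs \<in> lists nplus" by auto
      have "c \<odot>\<^bsub>S\<^esub> foldr (act S) (x # vs) w = act S x (c \<odot>\<^bsub>S\<^esub> foldr (act S) vs w)"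
        using S.foldr_act_closed[of vs w] by (simp add: S.act_smult)
      also have "\<dots> = act S x (foldr (act (C_psi \<psi>)) vs c \<odot>\<^bsub>S\<^esub> w)"
        by (simp only: Cons.IH[OF vs])
      also have "\<dots> = foldr (act (C_psi \<psi>)) vs c \<odot>\<^bsub>S\<^esub> (\<psi> x \<odot>\<^bsub>S\<^esub> w)"
        using w_act[OF x] by (simp add: S.act_smult del: C_psi_simps)
      also have "\<dots> = foldr (act (C_psi \<psi>)) (x # vs) c \<odot>\<^bsub>S\<^esub> w"
        by (simp add: S.smult_smult mult.commute)
      finally show ?case .
    qed simp
    have "free_act S (Poly_Mapping.single ws 1) w = foldr (act S) ws w"
      using S.foldr_act_closed[of ws w] by (simp add: S.free_act_single)
    moreover have "free_act (C_psi \<psi>) (Poly_Mapping.single ws 1) c = foldr (act (C_psi \<psi>)) ws c"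
      using C.free_act_single[OF single, of c 1] by simp
    ultimately show ?case using foldr[OF single] by (simp only:)
  next
    case (add p q)
    then show ?case by (simp add: S.free_act_add C.free_act_add S.smult_add_vector S.smult_add_scalar)
  next
    case (scale a q)
    have "c \<odot>\<^bsub>S\<^esub> free_act S (cscale a q) w = a \<odot>\<^bsub>S\<^esub> (c \<odot>\<^bsub>S\<^esub> free_act S q w)"
      by (simp add: S.free_act_cscale S.smult_smult mult.commute)
    also have "\<dots> = free_act (C_psi \<psi>) (cscale a q) c \<odot>\<^bsub>S\<^esub> w"
      using scale by (simp add: C.free_act_cscale S.smult_smult)
    finally show ?case .
  qed simp
  let ?K = "{t \<in> carrier ?T. \<Phi> t = \<zero>\<^bsub>S\<^esub>}"
  have sub: "cscale.subspace ?K"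
    using subspace_free_tensor[where N = "C_psi \<psi>"] unfolding cscale.subspace_def
    by (simp add: \<Phi>_zero \<Phi>_add \<Phi>_cscale)
  note closed = cscale.subspace_diff[OF subspace_free_tensor] cscale.subspace_add[OF subspace_free_tensor]
    cscale.subspace_scale[OF subspace_free_tensor]
  have "module.span cscale (tensor_relations nplus (C_psi \<psi>)) \<subseteq> ?K"
  proof (rule Rel_minimal[OF lie_subalgebra_nplus lie_module_C_psi[OF psi] sub])
    fix p q :: "vir list \<Rightarrow>\<^sub>0 complex" and c
    have "\<Phi> (ptensor (p + q) c - (ptensor p c + ptensor q c)) = \<zero>\<^bsub>S\<^esub>"
      by (simp add: closed \<Phi>_diff \<Phi>_add \<Phi>_ptensor S.free_act_add S.smult_add_vector S.diff_zero_iff)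
    then show "ptensor (p + q) c - ptensor p c - ptensor q c \<in> ?K"
      by (simp add: closed diff_diff_eq)
  next
    fix p :: "vir list \<Rightarrow>\<^sub>0 complex" and c c' :: complex
    have "\<Phi> (ptensor p (c + c') - (ptensor p c + ptensor p c')) = \<zero>\<^bsub>S\<^esub>"
      by (simp add: closed \<Phi>_diff \<Phi>_add \<Phi>_ptensor S.smult_add_scalar S.diff_zero_iff)
    then show "ptensor p (c \<oplus>\<^bsub>C_psi \<psi>\<^esub> c') - ptensor p c - ptensor p c' \<in> ?K"
      by (simp add: closed diff_diff_eq)
  next
    fix p q :: "vir list \<Rightarrow>\<^sub>0 complex" and c
    assume q: "Poly_Mapping.keys q \<subseteq> lists nplus"
    have "free_act S p (c \<odot>\<^bsub>S\<^esub> free_act S q w) = free_act S p (free_act (C_psi \<psi>) q c \<odot>\<^bsub>S\<^esub> w)"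
      using nplus_act[OF q] by simp
    then show "ptensor (p * q) c - ptensor p (free_act (C_psi \<psi>) q c) \<in> ?K"
      by (simp add: closed \<Phi>_diff \<Phi>_ptensor S.free_act_mult S.free_act_smult_vector S.diff_zero_iff)
  qed (simp_all add: closed \<Phi>_diff \<Phi>_cscale \<Phi>_ptensor S.free_act_cscale S.smult_smult S.diff_zero_iff mult.commute)
  then have "\<exists>g\<in>lie_module_hom (M_psi \<psi>) S. \<forall>t\<in>carrier ?T. g (T.coset t) = \<Phi> t"
    by (intro T.quotient_universal[OF S.complex_module_axioms hom]) blast
  then obtain g where g: "g \<in> lie_module_hom (M_psi \<psi>) S" "\<And>t. t \<in> carrier ?T \<Longrightarrow> g (T.coset t) = \<Phi> t"
    by blast
  have "g wM = w" by (simp add: wM_def g(2) \<Phi>_ptensor)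
  with g(1) show ?thesis by blast
qed

context
  fixes \<xi> :: complex
begin

abbreviation "central_image \<equiv>
  {act (M_psi \<psi>) vz m \<ominus>\<^bsub>M_psi \<psi>\<^esub> (\<xi> \<odot>\<^bsub>M_psi \<psi>\<^esub> m) |m. m \<in> carrier (M_psi \<psi>)}"

interpretation N: stable_submodule "M_psi \<psi>" central_image
  rewrites "N.Q = L_psi_xi \<psi> \<xi>"
  by (rule stable_submodule_central_image[OF lie_module_M_psi]) (simp add: L_psi_xi_def)

definition wL :: "M_elem set" where "wL = N.coset wM"

lemma lie_module_L_psi_xi: "lie_module UNIV (L_psi_xi \<psi> \<xi>)"
  unfolding L_psi_xi_def
  by (rule lie_module_stable_quotient[OF lie_module_M_psi N.stable_submodule_axioms])

lemma whittaker_vector_wL: "whittaker_vector \<psi> (L_psi_xi \<psi> \<xi>) wL"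
  using whittaker_vector_wM
  by (simp add: whittaker_vector_def wL_def N.coset_act N.coset_smult N.carrier_Q)

lemma L_psi_xi_generated:
  assumes "l \<in> carrier (L_psi_xi \<psi> \<xi>)"
  shows "\<exists>p. l = free_act (L_psi_xi \<psi> \<xi>) p wL"
proof -
  obtain m where m: "m \<in> carrier (M_psi \<psi>)" "l = N.coset m" using assms by (auto simp: N.carrier_Q)
  obtain p where "m = free_act (M_psi \<psi>) p wM" using M_psi_generated[OF m(1)] by blast
  with m(2) have "l = free_act (L_psi_xi \<psi> \<xi>) p wL"
    using free_act_hom[OF lie_module_M_psi lie_module_L_psi_xi N.coset_hom wM_closed] by (simp add: wL_def)
  then show ?thesis by blast
qed

lemma act_vz_wL: "act (L_psi_xi \<psi> \<xi>) vz wL = \<xi> \<odot>\<^bsub>L_psi_xi \<psi> \<xi>\<^esub> wL"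
  using wM_closed
  by (auto simp: wL_def N.coset_act N.coset_smult N.coset_eq_iff M.act_closed intro!: exI[of _ wM])

lemma L_psi_xi_universal:
  assumes S: "lie_module UNIV S" and w: "whittaker_vector \<psi> S w"
    and z: "\<forall>m\<in>carrier S. act S vz m = \<xi> \<odot>\<^bsub>S\<^esub> m"
  shows "\<exists>g\<in>lie_module_hom (L_psi_xi \<psi> \<xi>) S. g wL = w"
proof -
  interpret S: lie_module UNIV S by (fact S)
  obtain f where f: "f \<in> lie_module_hom (M_psi \<psi>) S" "f wM = w"
    using M_psi_universal[OF S w] by blast
  have "f n = \<zero>\<^bsub>S\<^esub>" if n_in: "n \<in> central_image" for n
  proof -
    obtain m where m: "m \<in> carrier (M_psi \<psi>)"
      and n: "n = act (M_psi \<psi>) vz m \<ominus>\<^bsub>M_psi \<psi>\<^esub> (\<xi> \<odot>\<^bsub>M_psi \<psi>\<^esub> m)"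
      using n_in by blast
    have n': "n = act (M_psi \<psi>) vz m \<oplus>\<^bsub>M_psi \<psi>\<^esub> ((- \<xi>) \<odot>\<^bsub>M_psi \<psi>\<^esub> m)"
      using M.smult_minus_one[of "\<xi> \<odot>\<^bsub>M_psi \<psi>\<^esub> m"] M.smult_smult[of m "- 1" \<xi>] m
      unfolding n a_minus_def by simp
    have fm: "f m \<in> carrier S" using f(1) m by (auto simp: lie_module_hom_def)
    have "f n = act S vz (f m) \<oplus>\<^bsub>S\<^esub> ((- \<xi>) \<odot>\<^bsub>S\<^esub> f m)"
      using f(1) m M.act_closed[of vz m] unfolding n' by (simp add: lie_module_hom_def)
    also have "\<dots> = \<zero>\<^bsub>S\<^esub>"
      using z fm S.smult_add_scalar[OF fm, of \<xi> "- \<xi>"] by simp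
    finally show ?thesis .
  qed
  from N.quotient_universal[OF S.complex_module_axioms f(1) this]
  obtain g where "g \<in> lie_module_hom (L_psi_xi \<psi> \<xi>) S" "\<forall>m\<in>carrier (M_psi \<psi>). g (N.coset m) = f m" ..
  moreover from this(2) have "g wL = w" using wM_closed f(2) unfolding wL_def by simp
  ultimately show ?thesis by (intro bexI[of _ g])
qed

end

end

section \<open>Simple Whittaker modules\<close>

lemma isomorphic_if_bij_hom:
  assumes L: "lie_module UNIV L" and g: "g \<in> lie_module_hom L S" and bij: "bij_betw g (carrier L) (carrier S)"
  shows "isomorphic_modules UNIV S L"
proof -
  interpret L: lie_module UNIV L by (fact L)
  let ?f = "inv_into (carrier L) g"
  have f: "?f s \<in> carrier L" "g (?f s) = s" if "s \<in> carrier S" for s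
    using that bij by (auto simp: bij_betw_def inv_into_into f_inv_into_f)
  have fg: "?f (g l) = l" if "l \<in> carrier L" for l
    using that bij by (auto simp: bij_betw_def)
  have "?f \<in> lie_module_iso UNIV S L"
    unfolding lie_module_iso_def
  proof (intro CollectI conjI ballI allI)
    show "bij_betw ?f (carrier S) (carrier L)" using bij by (rule bij_betw_inv_into)
  next
    fix m m' assume m: "m \<in> carrier S" "m' \<in> carrier S"
    have "g (?f m \<oplus>\<^bsub>L\<^esub> ?f m') = m \<oplus>\<^bsub>S\<^esub> m'"
      using g f[OF m(1)] f[OF m(2)] by (simp add: lie_module_hom_def)
    then show "?f (m \<oplus>\<^bsub>S\<^esub> m') = ?f m \<oplus>\<^bsub>L\<^esub> ?f m'"
      using fg[of "?f m \<oplus>\<^bsub>L\<^esub> ?f m'"] f m by simp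
  next
    fix c m assume m: "m \<in> carrier S"
    have "g (c \<odot>\<^bsub>L\<^esub> ?f m) = c \<odot>\<^bsub>S\<^esub> m"
      using g f[OF m] by (simp add: lie_module_hom_def)
    then show "?f (c \<odot>\<^bsub>S\<^esub> m) = c \<odot>\<^bsub>L\<^esub> ?f m"
      using fg[of "c \<odot>\<^bsub>L\<^esub> ?f m"] f m by simp
  next
    fix x m assume m: "m \<in> carrier S"
    have "g (act L x (?f m)) = act S x m"
      using g f[OF m] by (simp add: lie_module_hom_def)
    then show "?f (act S x m) = act L x (?f m)"
      using fg[of "act L x (?f m)"] f m by (simp add: L.act_closed)
  qed
  then show ?thesis by (auto simp: isomorphic_modules_def)
qed

theorem corollary4p6:
  fixes \<psi> :: "vir \<Rightarrow> complex" and S :: "'m lie_module"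
  assumes "lie_hom_to_complex nplus \<psi>"
    and "\<psi> (vd 1) \<noteq> 0" and "\<psi> (vd 2) \<noteq> 0"
    and "whittaker_module \<psi> S" and "simple_lie_module UNIV S"
  shows "\<exists>\<xi>. isomorphic_modules UNIV S (L_psi_xi \<psi> \<xi>)"
proof -
  obtain w where S: "lie_module UNIV S" and w: "whittaker_vector \<psi> S w"
    and gen: "generated_submodule UNIV S {w} = carrier S"
    using assms(4) by (auto simp: whittaker_module_def)
  interpret S: whittaker_vector_of S \<psi> w
    by (intro whittaker_vector_of.intro whittaker_vector_of_axioms.intro S assms(1,3) w)
  have gen_S: "\<exists>p. m = free_act S p w" if "m \<in> carrier S" for m
    by (rule generated_submodule_free_act[OF S S.w_closed gen that])
  have w_nonzero: "w \<noteq> \<zero>\<^bsub>S\<^esub>"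
  proof
    assume "w = \<zero>\<^bsub>S\<^esub>"
    then have "m = \<zero>\<^bsub>S\<^esub>" if "m \<in> carrier S" for m using gen_S[OF that] by auto
    then have "carrier S = {\<zero>\<^bsub>S\<^esub>}" by auto
    with assms(5) show False by (simp add: simple_lie_module_def)
  qed
  obtain \<xi> where z: "\<forall>m\<in>carrier S. act S vz m = \<xi> \<odot>\<^bsub>S\<^esub> m"
    using S.central_character[OF assms(5) gen w_nonzero] by blast
  let ?L = "L_psi_xi \<psi> \<xi>"
  let ?w = "wL \<psi> \<xi>"
  note L = lie_module_L_psi_xi[OF assms(1), of \<xi>]
  obtain g where g: "g \<in> lie_module_hom ?L S" "g ?w = w"
    using L_psi_xi_universal[OF assms(1) S w z] by blast
  interpret L: whittaker_vector_of ?L \<psi> ?w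
    by (intro whittaker_vector_of.intro whittaker_vector_of_axioms.intro L assms(1,3) whittaker_vector_wL)
  have g_ev: "g (L.ev p) = S.ev p" for p
    using free_act_hom[OF L S g(1) L.w_closed] g(2) by simp
  have g_zero: "g \<zero>\<^bsub>?L\<^esub> = \<zero>\<^bsub>S\<^esub>"
    using g_ev[of 0] by simp
  have sub: "annihilator ?L ?w \<subseteq> annihilator S w"
  proof
    fix p assume "p \<in> annihilator ?L ?w"
    then show "p \<in> annihilator S w" using g_ev[of p] g_zero by (simp add: L.Ann_iff S.Ann_iff)
  qed
  have ann: "annihilator S w \<subseteq> annihilator ?L ?w"
    by (rule annihilator_subset[OF S.whittaker_vector_of_axioms L.whittaker_vector_of_axioms _
          act_vz_wL[OF assms(1)] sub w_nonzero])
      (use z in simp)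
  have "bij_betw g (carrier ?L) (carrier S)"
  proof (rule bij_betw_imageI)
    show "inj_on g (carrier ?L)"
    proof (rule inj_onI)
      fix l l' assume l: "l \<in> carrier ?L" "l' \<in> carrier ?L" and eq: "g l = g l'"
      obtain p p' where p: "l = L.ev p" "l' = L.ev p'" using L_psi_xi_generated[OF assms(1) l(1)] L_psi_xi_generated[OF assms(1) l(2)] by blast
      then have "p - p' \<in> annihilator S w" using eq by (simp add: S.Ann_diff_iff g_ev)
      then have "p - p' \<in> annihilator ?L ?w" using ann by blast
      then show "l = l'" by (simp add: L.Ann_diff_iff p)
    qed
    show "g ` carrier ?L = carrier S"
    proof
      show "g ` carrier ?L \<subseteq> carrier S" using g(1) by (auto simp: lie_module_hom_def)
      show "carrier S \<subseteq> g ` carrier ?L"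
      proof
        fix m assume "m \<in> carrier S"
        then obtain p where "m = S.ev p" using gen_S by blast
        then have "m = g (L.ev p)" by (simp add: g_ev)
        then show "m \<in> g ` carrier ?L" using L.ev_closed by blast
      qed
    qed
  qed
  then have "isomorphic_modules UNIV S ?L" by (rule isomorphic_if_bij_hom[OF L g(1)])
  then show ?thesis by blast
qed

end
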